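(* Let $\gamma_1,\gamma_2\in\mathbb{R}$, let $s\ge2$, let $z_0=(u_0,\rho_0)\in H^s(\mathbb{S})\times H^{s-1}(\mathbb{S})$, and let $T\in(0,\infty]$ be the maximal existence time of the corresponding solution $z=(u,\rho)$ to the periodic 2-component $\mu$-Hunter-Saxton system with initial data $z_0$. Put $$\mu_0=\int_{\mathbb{S}}u_0\,dx,\qquad \mu_1=\Big(\int_{\mathbb{S}}(u_{0,x}^2+\rho_0^2)\,dx\Big)^{1/2},\qquad a=2\mu_0^2+\tfrac12\int_{\mathbb{S}}(u_{0,x}^2+\rho_0^2)\,dx .$$ If $\gamma_1=2\gamma_2$, $\mu_0\neq0$, $$|\mu_0|+\frac{\sqrt3}{6}\mu_1<\frac{a}{2|\mu_0|},$$ and there exists a point $x_0\in\mathbb{S}$ such that $\rho_0(-x_0)=0$, then the solution $z$ blows up in finite time.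
   Context: $\mathbb{S}=\mathbb{R}/\mathbb{Z}$; all functions of $x$ are 1-periodic; $\mu(u)=\int_{\mathbb{S}}u\,dx$; $u_{0,x}$ is the derivative of $u_0$. The periodic 2-component $\mu$-Hunter-Saxton system with parameters $\gamma_1,\gamma_2\in\mathbb{R}$ is $$-u_{txx}=2\mu(u)u_x-2u_xu_{xx}-uu_{xxx}+\rho\rho_x-\gamma_1u_{xxx},\qquad \rho_t=(\rho u)_x+2\gamma_2\rho_x,$$ with $u(0,x)=u_0(x)$, $\rho(0,x)=\rho_0(x)$, studied under the standing assumption $\mu(u_t)=\mu(u)_t=0$. Under this assumption it is equivalent to the form $$u_t-(u+\gamma_1)u_x=\partial_x(\mu-\partial_x^2)^{-1}\Big(2\mu(u)u+\tfrac12u_x^2+\tfrac12\rho^2\Big),\qquad \rho_t-(u+2\gamma_2)\rho_x=u_x\rho,$$ where $(\mu-\partial_x^2)f:=\mu(f)-f_{xx}$ is an isomorphism $H^{r}(\mathbb{S})\to H^{r-2}(\mathbb{S})$. Solutions and maximal existence time: for $s\ge2$ and $z_0=(u_0,\rho_0)\in H^s\times H^{s-1}$ there is a maximal $T\in(0,\infty]$ and a unique solution $z=(u,\rho)\in C([0,T);H^s\times H^{s-1})\cap C^1([0,T);H^{s-1}\times H^{s-2})$ of this system (in the nonlocal form above) with $z(0)=z_0$; "the corresponding solution" is this one and $T$ is its maximal existence time. The solution blows up in finite time if $T<\infty$. *)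

theory Defs
  imports "HOL-Analysis.Analysis"
begin

text \<open>
  Functions on the circle are 1-periodic functions on the real line.
\<close>

definition periodic1 :: "(real \<Rightarrow> real) \<Rightarrow> bool" where
  "periodic1 f \<longleftrightarrow> (\<forall>x. f (x + 1) = f x)"

definition circle_mean :: "(real \<Rightarrow> real) \<Rightarrow> real" where
  "circle_mean f = (LBINT x:{0..1}. f x)"

definition fourier_coeff :: "(real \<Rightarrow> real) \<Rightarrow> int \<Rightarrow> complex" where
  "fourier_coeff f k =
     (LBINT x:{0..1}. complex_of_real (f x) * exp (- 2 * of_real pi * \<i> * of_int k * of_real x))"

text \<open>
  The Sobolev space of order \<open>r \<ge> 0\<close> on the circle.  Its elements are, strictly speaking, classes
  modulo equality almost everywhere, and are given here by Borel representatives.  For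
  \<open>r > 1/2\<close> every class contains exactly one continuous function, and only that one is admitted;
  hence point values, and for \<open>r > 3/2\<close> the classical derivative \<^term>\<open>deriv f\<close>, are meaningful.
\<close>

definition sobolev :: "real \<Rightarrow> (real \<Rightarrow> real) set" where
  "sobolev r = {f. periodic1 f \<and> f \<in> borel_measurable borel
     \<and> set_integrable lborel {0..1} (\<lambda>x. (f x)\<^sup>2)
     \<and> (\<lambda>k. (1 + (of_int k)\<^sup>2) powr r * (cmod (fourier_coeff f k))\<^sup>2) summable_on UNIV
     \<and> (1/2 < r \<longrightarrow> continuous_on UNIV f)}"

definition sobolev_norm :: "real \<Rightarrow> (real \<Rightarrow> real) \<Rightarrow> real" where
  "sobolev_norm r f =
     sqrt (\<Sum>\<^sub>\<infinity>k. (1 + (of_int k)\<^sup>2) powr r * (cmod (fourier_coeff f k))\<^sup>2)"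

text \<open>
  Weak (distributional) derivative on the circle.  Testing against all periodic functions of
  class \<open>C\<^sup>1\<close> amounts to testing against smooth ones.
\<close>

definition has_weak_deriv :: "(real \<Rightarrow> real) \<Rightarrow> (real \<Rightarrow> real) \<Rightarrow> bool" where
  "has_weak_deriv f g \<longleftrightarrow>
     periodic1 f \<and> periodic1 g \<and> f \<in> borel_measurable borel \<and> g \<in> borel_measurable borel
     \<and> set_integrable lborel {0..1} f \<and> set_integrable lborel {0..1} g
     \<and> (\<forall>\<phi> \<phi>'. periodic1 \<phi> \<and> (\<forall>x. (\<phi> has_real_derivative \<phi>' x) (at x)) \<and> continuous_on UNIV \<phi>' \<longrightarrow>
          (LBINT x:{0..1}. f x * \<phi>' x) = - (LBINT x:{0..1}. g x * \<phi> x))"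

text \<open>
  The inverse of \<open>\<mu> - \<partial>\<^sub>x\<^sup>2\<close>, as an isomorphism from the Sobolev space of order 2 onto
  \<open>L\<^sup>2\<close>.  The inverses for the other orders \<open>r \<ge> 2\<close> are restrictions of this one, so no
  order needs to be recorded.
\<close>

definition mu_dxx_inv :: "(real \<Rightarrow> real) \<Rightarrow> real \<Rightarrow> real" where
  "mu_dxx_inv f = (THE w. w \<in> sobolev 2 \<and>
     (\<exists>w\<^sub>x\<^sub>x. has_weak_deriv (deriv w) w\<^sub>x\<^sub>x \<and> (AE x in lborel. circle_mean w - w\<^sub>x\<^sub>x x = f x)))"

definition time_interval :: "ereal \<Rightarrow> real set" where
  "time_interval T = {t. 0 \<le> t \<and> ereal t < T}"

definition C0_sobolev :: "real \<Rightarrow> ereal \<Rightarrow> (real \<Rightarrow> real \<Rightarrow> real) \<Rightarrow> bool" where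
  "C0_sobolev r T v \<longleftrightarrow>
     (\<forall>t\<in>time_interval T. v t \<in> sobolev r) \<and>
     (\<forall>t\<in>time_interval T.
        ((\<lambda>\<tau>. sobolev_norm r (\<lambda>x. v \<tau> x - v t x)) \<longlongrightarrow> 0) (at t within time_interval T))"

text \<open>
  \<open>v\<close> is continuously differentiable in time with values in the Sobolev space of order \<open>r\<close>,
  with time derivative \<open>v\<^sub>t\<close> (one-sided at time 0).
\<close>

definition C1_sobolev ::
    "real \<Rightarrow> ereal \<Rightarrow> (real \<Rightarrow> real \<Rightarrow> real) \<Rightarrow> (real \<Rightarrow> real \<Rightarrow> real) \<Rightarrow> bool" where
  "C1_sobolev r T v v\<^sub>t \<longleftrightarrow>
     C0_sobolev r T v \<and> C0_sobolev r T v\<^sub>t \<and>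
     (\<forall>t\<in>time_interval T.
        ((\<lambda>\<tau>. sobolev_norm r (\<lambda>x. (v \<tau> x - v t x) / (\<tau> - t) - v\<^sub>t t x)) \<longlongrightarrow> 0)
          (at t within time_interval T))"

text \<open>
  Solutions on \<open>[0,T)\<close> of the periodic 2-component \<open>\<mu>\<close>-Hunter-Saxton system in nonlocal form,
  for \<open>s \<ge> 2\<close>.  All terms of the first equation are continuous in \<open>x\<close>; the second one is an
  identity in the Sobolev space of order \<open>s - 2\<close>, hence holds almost everywhere.  Integrating the
  first equation over the circle gives the standing assumption \<open>\<mu>(u\<^sub>t) = 0\<close>.
\<close>

definition mu_HS_solution ::
    "real \<Rightarrow> real \<Rightarrow> real \<Rightarrow> (real \<Rightarrow> real) \<Rightarrow> (real \<Rightarrow> real) \<Rightarrow> ereal \<Rightarrow>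
     (real \<Rightarrow> real \<Rightarrow> real) \<Rightarrow> (real \<Rightarrow> real \<Rightarrow> real) \<Rightarrow> bool" where
  "mu_HS_solution \<gamma>\<^sub>1 \<gamma>\<^sub>2 s u\<^sub>0 \<rho>\<^sub>0 T u \<rho> \<longleftrightarrow>
     0 < T \<and> u 0 = u\<^sub>0 \<and> \<rho> 0 = \<rho>\<^sub>0 \<and> C0_sobolev s T u \<and> C0_sobolev (s - 1) T \<rho> \<and>
     (\<exists>u\<^sub>t \<rho>\<^sub>t. C1_sobolev (s - 1) T u u\<^sub>t \<and> C1_sobolev (s - 2) T \<rho> \<rho>\<^sub>t \<and>
        (\<forall>t\<in>time_interval T.
           (\<forall>x. u\<^sub>t t x - (u t x + \<gamma>\<^sub>1) * deriv (u t) x =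
              deriv (mu_dxx_inv (\<lambda>y. 2 * circle_mean (u t) * u t y
                + 1/2 * (deriv (u t) y)\<^sup>2 + 1/2 * (\<rho> t y)\<^sup>2)) x) \<and>
           (\<exists>\<rho>\<^sub>x. has_weak_deriv (\<rho> t) \<rho>\<^sub>x \<and>
              (AE x in lborel. \<rho>\<^sub>t t x - (u t x + 2 * \<gamma>\<^sub>2) * \<rho>\<^sub>x x = deriv (u t) x * \<rho> t x))))"

text \<open>
  \<open>(u, \<rho>)\<close> is the solution with initial data \<open>(u\<^sub>0, \<rho>\<^sub>0)\<close> and \<open>T\<close> its maximal existence time.
\<close>

definition mu_HS_maximal_solution ::
    "real \<Rightarrow> real \<Rightarrow> real \<Rightarrow> (real \<Rightarrow> real) \<Rightarrow> (real \<Rightarrow> real) \<Rightarrow> ereal \<Rightarrow>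
     (real \<Rightarrow> real \<Rightarrow> real) \<Rightarrow> (real \<Rightarrow> real \<Rightarrow> real) \<Rightarrow> bool" where
  "mu_HS_maximal_solution \<gamma>\<^sub>1 \<gamma>\<^sub>2 s u\<^sub>0 \<rho>\<^sub>0 T u \<rho> \<longleftrightarrow>
     mu_HS_solution \<gamma>\<^sub>1 \<gamma>\<^sub>2 s u\<^sub>0 \<rho>\<^sub>0 T u \<rho> \<and>
     (\<forall>T' u' \<rho>'. mu_HS_solution \<gamma>\<^sub>1 \<gamma>\<^sub>2 s u\<^sub>0 \<rho>\<^sub>0 T' u' \<rho>' \<longrightarrow> T' \<le> T)"

end

theory Submission
  imports Defs
begin

text \<open>
  Suppose the solution is global.  The mean \<open>\<mu>\<^sub>0\<close> of \<open>u\<close> and the energy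
  \<open>\<integral> (u\<^sub>x\<^sup>2 + \<rho>\<^sup>2)\<close> are conserved.  As \<open>\<gamma>\<^sub>1 = 2 \<gamma>\<^sub>2\<close>, both equations have the same
  characteristics \<open>p' = - (u + \<gamma>\<^sub>1)(t, p)\<close>.  Along one that starts at a zero of \<open>\<rho>\<^sub>0\<close>, the function
  \<open>\<rho>\<close> stays zero, and \<open>m = u\<^sub>x(t, p)\<close> satisfies \<open>m' = m\<^sup>2 / 2 + a - 2 \<mu>\<^sub>0 u(t, p)\<close>.
  Since \<open>\<bar>u - \<mu>\<^sub>0\<bar> \<le> sqrt 3 / 6 * \<mu>\<^sub>1\<close>, the hypothesis gives \<open>m' \<ge> m\<^sup>2 / 2 + c\<close> with a constant
  \<open>c > 0\<close>, and such an \<open>m\<close> blows up in finite time.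

  The solution is too rough for the equation of \<open>m\<close> to hold pointwise.  Instead two nearby
  characteristics \<open>p\<close>, \<open>q\<close> are followed and \<open>m\<close> is replaced by the difference quotient
  \<open>D = (u(t, q) - u(t, p)) / (q - p)\<close>.  It is differentiable, with \<open>D' = D\<^sup>2 + w\<^sub>x\<^sub>x\<close> at an intermediate
  point, where \<open>w\<close> is the nonlocal term, and by uniform continuity on a compact time interval
  \<open>D' \<ge> (D\<^sup>2 + c) / 2\<close> holds there once the two characteristics start close enough.
\<close>

section \<open>Fourier coefficients\<close>

text \<open>The time derivative of \<open>u\<close> lies only in H^1 and that of \<rho> only in L^2.
  The energy law is therefore derived on Fourier coefficients, where x-derivatives are multipliers
  and the energy is a square sum, rather than from pointwise identities. The same roughness deprives
  \<rho> of a pointwise transport equation. What survives is that the integral of \<rho> between two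
  characteristics does not change in time. Their distance shrinks at most by the factor exp (- L T),
  where \<open>L\<close> bounds |u_x|, so \<rho> stays small between them if its initial values
  there are small enough. The choices are not circular: the constant \<open>c\<close> of the Riccati
  inequality depends on the initial data alone and fixes the length of the time interval; on that
  interval \<open>L\<close> and the moduli of continuity of u_x and \<rho> are known before the
  second characteristic is placed. Half of \<open>c\<close> pays for the errors: c/4 for the term
  \<rho>^2 / 2 and c/4 for comparing u_x^2 / 2 at two intermediate points.\<close>

definition chi :: "int \<Rightarrow> real \<Rightarrow> complex" where
  "chi k x = cis (2 * pi * of_int k * x)"

text \<open>Complex integrands are needed because characters, partial sums and their conjugates are
  themselves paired with \<open>chi\<close>, whereas \<open>fourier_coeff\<close> takes real
  functions.\<close>

definition cfourier :: "(real \<Rightarrow> complex) \<Rightarrow> int \<Rightarrow> complex" where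
  "cfourier h k = (LBINT x:{0..1}. h x * chi (- k) x)"

lemma fourier_coeff_eq_cfourier: "fourier_coeff f k = cfourier (\<lambda>x. of_real (f x)) k"
  unfolding fourier_coeff_def cfourier_def chi_def cis_conv_exp
  by (simp add: mult_ac)

lemma chi_0 [simp]: "chi 0 x = 1"
  by (simp add: chi_def)

lemma norm_chi [simp]: "cmod (chi k x) = 1"
  by (simp add: chi_def)

lemma chi_mult: "chi j x * chi k x = chi (j + k) x"
  by (simp add: chi_def cis_mult algebra_simps)

lemma cnj_chi: "cnj (chi k x) = chi (- k) x"
  by (simp add: chi_def cis_cnj)

lemma chi_periodic [simp]: "chi k (x + 1) = chi k x"
proof -
  have "chi k (x + 1) = chi k x * cis (2 * pi * of_int k)"
    by (simp add: chi_def cis_mult algebra_simps)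
  also have "cis (2 * pi * of_int k) = 1"
    using cis_multiple_2pi[of "of_int k"] by simp
  finally show ?thesis by simp
qed

lemma chi_1_eq [simp]: "chi k 1 = 1"
  using chi_periodic[of k 0] by (simp add: chi_def)

lemma chi_at_0 [simp]: "chi k 0 = 1"
  by (simp add: chi_def)

lemma has_vector_derivative_chi:
  "(chi k has_vector_derivative (2 * pi * \<i> * of_int k) * chi k x) (at x within A)"
  unfolding chi_def has_vector_derivative_def
  by (rule derivative_eq_intros refl | simp add: scaleR_conv_of_real algebra_simps)+

lemma continuous_on_chi [continuous_intros]: "continuous_on A (chi k)"
  unfolding chi_def by (intro continuous_intros)

lemma borel_chi [measurable]: "chi k \<in> borel_measurable borel"
  by (intro borel_measurable_continuous_onI continuous_on_chi)

lemma continuous_set_integrable: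
  fixes h :: "real \<Rightarrow> 'a::{banach, second_countable_topology}"
  assumes "continuous_on UNIV h"
  shows "set_integrable lborel {a..b} h"
  by (intro borel_integrable_atLeastAtMost' continuous_on_subset[OF assms]) auto

lemma set_integral_FTC:
  fixes F :: "real \<Rightarrow> 'a::euclidean_space"
  assumes "\<And>x. (F has_vector_derivative f x) (at x)" and "continuous_on UNIV f" and "a \<le> b"
  shows "(LBINT x:{a..b}. f x) = F b - F a"
  unfolding set_lebesgue_integral_def
  by (intro integral_FTC_atLeastAtMost assms continuous_on_subset[OF assms(2)]
        has_vector_derivative_at_within[OF assms(1)]) auto

lemma set_integrable_mult_bounded:
  fixes g h :: "real \<Rightarrow> 'a::{real_normed_field, banach, second_countable_topology}"
  assumes g: "set_integrable lborel {0..1} g" and h: "continuous_on UNIV h"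
  shows "set_integrable lborel {0..1} (\<lambda>x. h x * g x)"
proof -
  have "bounded (h ` {0..1})"
    by (intro compact_imp_bounded compact_continuous_image continuous_on_subset[OF h]) auto
  then obtain M where M: "\<And>x. x \<in> {0..1} \<Longrightarrow> norm (h x) \<le> M"
    unfolding bounded_iff by (metis imageI)
  have hm: "h \<in> borel_measurable borel"
    using h by (intro borel_measurable_continuous_onI)
  have gm: "(\<lambda>x. indicator {0..1} x *\<^sub>R g x) \<in> borel_measurable lborel"
    using g unfolding set_integrable_def by (rule borel_measurable_integrable)
  have "integrable lborel (\<lambda>x. h x * (indicator {0..1} x *\<^sub>R g x))"
  proof (rule Bochner_Integration.integrable_bound)
    show "integrable lborel (\<lambda>x. M *\<^sub>R (indicator {0..1} x *\<^sub>R g x))"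
      using g unfolding set_integrable_def by (intro integrable_scaleR_right) auto
    show "(\<lambda>x. h x * indicator {0..1} x *\<^sub>R g x) \<in> borel_measurable lborel"
      using hm gm by (intro borel_measurable_times) auto
    show "AE x in lborel. norm (h x * indicator {0..1} x *\<^sub>R g x) \<le> norm (M *\<^sub>R indicator {0..1} x *\<^sub>R g x)"
    proof (intro AE_I2)
      fix x
      show "norm (h x * indicator {0..1} x *\<^sub>R g x) \<le> norm (M *\<^sub>R indicator {0..1} x *\<^sub>R g x)"
      proof (cases "x \<in> {0..1}")
        case True
        then show ?thesis using M[OF True]
          by (simp add: norm_mult mult_right_mono order_trans[OF _ abs_ge_self])
      qed simp
    qed
  qed
  then show ?thesis unfolding set_integrable_def
    by (simp add: mult_scaleR_right[symmetric] del: mult_scaleR_right mult_scaleR_left)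
qed

lemma set_integral_norm_le:
  fixes h :: "real \<Rightarrow> 'a::{banach, second_countable_topology}"
  assumes "set_integrable lborel {0..1} h" "set_integrable lborel {0..1} g"
    "\<And>x. x \<in> {0..1} \<Longrightarrow> norm (h x) \<le> g x"
  shows "norm (LBINT x:{0..1}. h x) \<le> (LBINT x:{0..1}. g x)"
proof -
  have "norm (LBINT x:{0..1}. h x) \<le> (LINT x|lborel. norm (indicator {0..1} x *\<^sub>R h x))"
    unfolding set_lebesgue_integral_def by (rule integral_norm_bound)
  also have "\<dots> \<le> (LINT x|lborel. indicator {0..1} x *\<^sub>R g x)"
    using assms unfolding set_integrable_def
    by (intro integral_mono integrable_norm) (auto simp: indicator_def)
  finally show ?thesis unfolding set_lebesgue_integral_def .
qed

lemma set_integral_norm_le_const: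
  fixes h :: "real \<Rightarrow> 'a::{banach, second_countable_topology}"
  assumes "set_integrable lborel {0..1} h"
    "\<And>x. x \<in> {0..1} \<Longrightarrow> norm (h x) \<le> C"
  shows "norm (LBINT x:{0..1}. h x) \<le> C"
proof -
  have "norm (LBINT x:{0..1}. h x) \<le> (LBINT x:{0..1::real}. C)"
    by (rule set_integral_norm_le[OF assms(1) continuous_set_integrable[OF continuous_on_const] assms(2)])
  then show ?thesis by (simp add: set_lebesgue_integral_def)
qed

lemma integral_chi: "(LBINT x:{0..1}. chi k x) = (if k = 0 then 1 else 0)"
proof (cases "k = 0")
  case True
  then show ?thesis by (simp add: set_lebesgue_integral_def)
next
  case False
  have "(LBINT x:{0..1}. (2 * pi * \<i> * of_int k) * chi k x) = chi k 1 - chi k 0"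
    by (intro set_integral_FTC has_vector_derivative_chi continuous_intros) auto
  with False show ?thesis by (simp add: chi_def)
qed

lemma cfourier_chi: "cfourier (chi j) k = (if j = k then 1 else 0)"
  by (simp add: cfourier_def chi_mult integral_chi)

lemma cfourier_integrable:
  assumes "set_integrable lborel {0..1} h"
  shows "set_integrable lborel {0..1} (\<lambda>x. h x * chi k x)"
  using set_integrable_mult_bounded[OF assms continuous_on_chi] by (simp add: mult.commute)

lemma cfourier_add: "set_integrable lborel {0..1} f \<Longrightarrow> set_integrable lborel {0..1} g \<Longrightarrow>
   cfourier (\<lambda>x. f x + g x) k = cfourier f k + cfourier g k"
  unfolding cfourier_def ring_distribs by (intro set_integral_add(2) cfourier_integrable)

lemma cfourier_diff: "set_integrable lborel {0..1} f \<Longrightarrow> set_integrable lborel {0..1} g \<Longrightarrow>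
   cfourier (\<lambda>x. f x - g x) k = cfourier f k - cfourier g k"
  unfolding cfourier_def left_diff_distrib by (intro set_integral_diff(2) cfourier_integrable)

lemma cfourier_cmult: "cfourier (\<lambda>x. c * f x) k = c * cfourier f k"
  unfolding cfourier_def mult.assoc by simp

text \<open>The product \<open>h x * chi (- k) x\<close> takes equal values at 0 and 1, so the
  integral of its derivative over the period vanishes.\<close>

lemma cfourier_deriv:
  assumes "\<And>x. (h has_vector_derivative h' x) (at x)" "continuous_on UNIV h'" "h 1 = h 0"
  shows "cfourier h' k = 2 * pi * \<i> * of_int k * cfourier h k"
proof -
  let ?c = "2 * pi * \<i> * of_int (- k)"
  have ch: "continuous_on UNIV h"
    using assms(1) by (meson has_vector_derivative_continuous continuous_at_imp_continuous_on)
  have "(LBINT x:{0..1}. h x * (?c * chi (- k) x) + h' x * chi (- k) x) = h 1 * chi (- k) 1 - h 0 * chi (- k) 0"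
    by (intro set_integral_FTC[where F = "\<lambda>x. h x * chi (- k) x"] has_vector_derivative_mult assms
        has_vector_derivative_chi continuous_intros ch) auto
  also have "\<dots> = 0" using assms(3) by simp
  also have "(LBINT x:{0..1}. h x * (?c * chi (- k) x) + h' x * chi (- k) x)
     = (LBINT x:{0..1}. h x * (?c * chi (- k) x)) + (LBINT x:{0..1}. h' x * chi (- k) x)"
    by (intro set_integral_add(2) continuous_set_integrable continuous_intros ch assms)
  also have "(LBINT x:{0..1}. h x * (?c * chi (- k) x)) = ?c * cfourier h k"
    unfolding cfourier_def by (subst set_integral_mult_right[symmetric]) (simp only: mult_ac)
  finally show ?thesis unfolding cfourier_def by (simp add: add_eq_0_iff)
qed

section \<open>Uniqueness of the Fourier coefficients of continuous functions\<close>

text \<open>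
  For \<open>A = 1 - cos (2 * pi * \<eta>)\<close> the kernel \<open>(A + cos (2 * pi * (x - x0))) ^ n\<close> grows exponentially
  near \<open>x0\<close> and stays bounded outside the \<open>\<eta>\<close>-neighbourhood of \<open>x0\<close>.
\<close>

lemma trig_kernel_lower_bound:
  fixes g :: "real \<Rightarrow> real"
  assumes g: "continuous_on UNIV g" and x0: "0 < x0" "x0 < 1" and pos: "g x0 > 0"
  obtains A where "(\<lambda>n. (LBINT x:{0..1}. g x * (A + cos (2 * pi * (x - x0))) ^ n)) \<noteq> (\<lambda>n. 0)"
proof -
  define m where "m = g x0 / 2"
  have m: "m > 0" using pos by (simp add: m_def)
  have "isCont g x0" using g by (simp add: continuous_on_eq_continuous_at)
  then obtain d where d: "d > 0" "\<And>x. dist x x0 < d \<Longrightarrow> dist (g x) (g x0) < m"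
    unfolding continuous_at_eps_delta using m by blast
  \<comment> \<open>Halving \<open>d\<close> keeps the closed neighbourhood inside the ball given by
    continuity; the other bounds keep it inside [0,1] and force \<eta> to be at most 1/2, the range
    where cos (2 pi r) decreases in r.\<close>
  define \<eta> where "\<eta> = min (d / 2) (min x0 (1 - x0))"
  have \<eta>: "0 < \<eta>" "\<eta> < d" "\<eta> \<le> x0" "\<eta> \<le> 1 - x0" "\<eta> \<le> 1/2"
    using d(1) x0 by (auto simp: \<eta>_def min_def)
  \<comment> \<open>\<open>c\<close> makes the kernel equal to 1 at distance \<eta> from
    \<open>x0\<close>; \<open>q\<close> is its value at distance \<eta>/2, hence greater than
    1.\<close>
  define c where "c = cos (2 * pi * \<eta>)"
  define T where "T = (\<lambda>x. (1 - c) + cos (2 * pi * (x - x0)))"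
  define q where "q = 1 + cos (pi * \<eta>) - c"
  have c1: "c < 1"
    using cos_monotone_0_pi[of 0 "2 * pi * \<eta>"] \<eta> by (simp add: c_def)
  have q1: "q > 1"
    using cos_monotone_0_pi[of "pi * \<eta>" "2 * pi * \<eta>"] \<eta> by (simp add: c_def q_def)
  have near: "T x \<ge> 1 + cos (2 * pi * r) - c" if "\<bar>x - x0\<bar> \<le> r" "r \<le> 1/2" for x r
  proof -
    have "cos (2 * pi * r) \<le> cos (2 * pi * \<bar>x - x0\<bar>)"
      using that by (intro cos_monotone_0_pi_le) auto
    also have "\<dots> = cos \<bar>2 * pi * (x - x0)\<bar>" by (simp add: abs_mult)
    finally show ?thesis by (simp add: T_def)
  qed
  \<comment> \<open>The upper bound on the distance reflects periodicity: near distance 1 the cosine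
    is back at its maximum. Distances above 1/2 are reflected.\<close>
  have far: "\<bar>T x\<bar> \<le> 1" if "\<eta> \<le> \<bar>x - x0\<bar>" "\<bar>x - x0\<bar> \<le> 1 - \<eta>" for x
  proof -
    have "cos (2 * pi * (x - x0)) = cos \<bar>2 * pi * (x - x0)\<bar>" by simp
    also have "\<dots> = cos (2 * pi * \<bar>x - x0\<bar>)" by (simp add: abs_mult)
    also have "\<dots> \<le> c"
    proof (cases "\<bar>x - x0\<bar> \<le> 1/2")
      case True
      then show ?thesis unfolding c_def using that \<eta> by (intro cos_monotone_0_pi_le) auto
    next
      case False
      have "cos (2 * pi * \<bar>x - x0\<bar>) = cos (2 * pi - 2 * pi * \<bar>x - x0\<bar>)" by (simp add: cos_diff)
      also have "2 * pi - 2 * pi * \<bar>x - x0\<bar> = 2 * pi * (1 - \<bar>x - x0\<bar>)" by (simp add: algebra_simps)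
      also have "cos (2 * pi * (1 - \<bar>x - x0\<bar>)) \<le> c"
        unfolding c_def using that \<eta> False by (intro cos_monotone_0_pi_le) (auto simp: mult_left_le)
      finally show ?thesis .
    qed
    finally have "cos (2 * pi * (x - x0)) \<le> c" .
    moreover have "cos (2 * pi * (x - x0)) \<ge> -1" by simp
    ultimately show ?thesis using c1 unfolding T_def by linarith
  qed
  have "bounded (g ` {0..1})"
    by (intro compact_imp_bounded compact_continuous_image continuous_on_subset[OF g]) auto
  then obtain M where M: "\<And>x. x \<in> {0..1} \<Longrightarrow> \<bar>g x\<bar> \<le> M"
    unfolding bounded_iff by (metis imageI real_norm_def)
  have M0: "M \<ge> 0" using M[of 0] by auto
  define J where "J = {x0 - \<eta>/2 .. x0 + \<eta>/2}"
  have JI: "J \<subseteq> {0..1}" using \<eta> by (auto simp: J_def)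
  have Tc: "continuous_on UNIV T" unfolding T_def by (intro continuous_intros)
  \<comment> \<open>One bound serves three regions: on \<open>J\<close> the integrand is at least
    \<open>m * q ^ n\<close>, on the rest of the \<eta>-neighbourhood it is nonnegative, and
    elsewhere it is at least \<open>- M\<close>.\<close>
  have lower: "m * q ^ n * indicator J x - M \<le> g x * T x ^ n" if x: "x \<in> {0..1}" for x n
  proof (cases "\<bar>x - x0\<bar> \<le> \<eta>")
    case True
    then have "dist x x0 < d" using \<eta> by (simp add: dist_real_def)
    then have gm: "g x \<ge> m" using d(2)[of x] by (auto simp: dist_real_def m_def abs_if split: if_splits)
    have T1: "T x \<ge> 1" using near[OF True] \<eta> by (simp add: c_def)
    show ?thesis
    proof (cases "x \<in> J")
      case True
      then have "\<bar>x - x0\<bar> \<le> \<eta> / 2" unfolding J_def atLeastAtMost_iff by linarith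
      then have "T x \<ge> q" using near[of x "\<eta>/2"] \<eta> by (simp add: q_def)
      then have "m * q ^ n \<le> g x * T x ^ n"
        using gm m q1 by (intro mult_mono power_mono) auto
      then show ?thesis using True M0 by simp
    next
      case False
      have "0 \<le> g x * T x ^ n" using gm m T1 by simp
      then show ?thesis using False M0 by simp
    qed
  next
    case False
    then have "x \<notin> J" using \<eta> by (auto simp: J_def abs_if split: if_splits)
    moreover have "\<bar>g x * T x ^ n\<bar> \<le> M * 1"
      unfolding abs_mult power_abs using M[OF x] far[of x] False x \<eta> M0
      by (intro mult_mono power_le_one) (simp_all add: abs_if split: if_splits)
    ultimately show ?thesis by (simp add: abs_le_iff)
  qed
  have int: "(LBINT x:{0..1}. g x * T x ^ n) \<ge> m * q ^ n * \<eta> - M" for n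
  proof -
    have J1: "set_integrable lborel {0..1::real} (indicator J :: real \<Rightarrow> real)"
      unfolding set_integrable_def using JI
      by (auto simp: indicator_inter_arith[symmetric] J_def Int_atLeastAtMost intro!: integrable_real_indicator emeasure_compact_finite)
    have J2: "(LBINT x:{0..1::real}. indicator J x :: real) = \<eta>"
      unfolding set_lebesgue_integral_def using JI \<eta>
      by (simp add: indicator_inter_arith[symmetric] Int_absorb1) (simp add: J_def)
    have "(LBINT x:{0..1}. m * q ^ n * indicator J x - M) = m * q ^ n * \<eta> - M"
      by (subst set_integral_diff(2))
        (auto simp: J1 J2 intro!: continuous_set_integrable continuous_intros, simp add: set_lebesgue_integral_def)
    moreover have "(LBINT x:{0..1}. m * q ^ n * indicator J x - M) \<le> (LBINT x:{0..1}. g x * T x ^ n)"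
      using lower by (intro set_integral_mono set_integral_diff set_integrable_mult_right J1
          continuous_set_integrable continuous_intros g Tc) auto
    ultimately show ?thesis by simp
  qed
  obtain n where "M / (m * \<eta>) < q ^ n" using real_arch_pow[OF q1] by blast
  then have "M < m * q ^ n * \<eta>" using m \<eta> by (simp add: field_simps)
  then have "(LBINT x:{0..1}. g x * T x ^ n) \<noteq> 0" using int[of n] by linarith
  then show ?thesis using that[of "1 - c"] unfolding T_def by metis
qed

lemma periodic_frac:
  fixes h :: "real \<Rightarrow> 'a"
  assumes per: "\<And>x. h (x + 1) = h x" shows "h x = h (frac x)"
proof -
  have nat: "h (y + real n) = h y" for y n
  proof (induction n)
    case (Suc n) then show ?case using per[of "y + real n"] by (simp add: add_ac)
  qed simp
  have "h (y + of_int k) = h y" for y k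
  proof (cases "k \<ge> 0")
    case True then show ?thesis using nat[of y "nat k"] by simp
  next
    case False then show ?thesis using nat[of "y + of_int k" "nat (- k)"] by simp
  qed
  from this[of "frac x" "\<lfloor>x\<rfloor>"] show ?thesis by (simp add: frac_def)
qed

text \<open>Vanishing coefficients make \<open>h\<close> orthogonal to every trigonometric
  polynomial, in particular to the powers of a kernel concentrating at \<open>x0\<close>. This is
  incompatible with a nonzero value of \<open>h\<close> there.\<close>

lemma cfourier_eq_0_imp_eq_0:
  fixes h :: "real \<Rightarrow> complex"
  assumes h: "continuous_on UNIV h" and per: "\<And>x. h (x + 1) = h x" and z: "\<And>k. cfourier h k = 0"
  shows "h x = 0"
proof -
  have kernel: "(LBINT x:{0..1}. h x * of_real (A + cos (2 * pi * (x - x0))) ^ n * chi k x) = 0" for A x0 n k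
  proof (induction n arbitrary: k)
    case 0
    show ?case using z[of "- k"] by (simp add: cfourier_def)
  next
    case (Suc n)
    define I where "I = (\<lambda>j x. h x * of_real (A + cos (2 * pi * (x - x0))) ^ n * chi j x)"
    define B where "B = cis (- (2 * pi * x0)) / 2"
    define B' where "B' = cis (2 * pi * x0) / 2"
    have Ii: "set_integrable lborel {0..1} (I j)" for j
      unfolding I_def by (intro continuous_set_integrable continuous_intros h)
    \<comment> \<open>A cosine factor shifts the frequency by one in both directions, which is why
      the induction carries \<open>chi k\<close> with arbitrary \<open>k\<close>.\<close>
    have dec: "of_real (cos (2 * pi * (x - x0))) = B * chi 1 x + B' * chi (-1) x" for x
      unfolding B_def B'_def chi_def
      by (simp add: cis_mult complex_eq_iff algebra_simps cos_diff sin_diff add_divide_distrib[symmetric])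
    have "h x * of_real (A + cos (2 * pi * (x - x0))) ^ Suc n * chi k x
       = of_real A * I k x + (B * I (k + 1) x + B' * I (k - 1) x)" for x
    proof -
      have "chi (k + 1) x = chi 1 x * chi k x" "chi (k - 1) x = chi (-1) x * chi k x"
        by (simp_all add: chi_mult add.commute)
      then have "h x * P * (of_real A + (B * chi 1 x + B' * chi (-1) x)) * chi k x
         = of_real A * (h x * P * chi k x)
           + (B * (h x * P * chi (k + 1) x) + B' * (h x * P * chi (k - 1) x))" for P
        by (simp only:) (simp add: ring_distribs mult_ac)
      from this[of "of_real (A + cos (2 * pi * (x - x0))) ^ n"] show ?thesis
        unfolding I_def dec[symmetric] of_real_add[symmetric] power_Suc by (simp only: mult_ac)
    qed
    then have "(LBINT x:{0..1}. h x * of_real (A + cos (2 * pi * (x - x0))) ^ Suc n * chi k x)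
       = (LBINT x:{0..1}. of_real A * I k x + (B * I (k + 1) x + B' * I (k - 1) x))"
      by simp
    also have "\<dots> = of_real A * (LBINT x:{0..1}. I k x)
        + (B * (LBINT x:{0..1}. I (k + 1) x) + B' * (LBINT x:{0..1}. I (k - 1) x))"
      by (subst set_integral_add(2); (subst set_integral_add(2))?; (intro set_integral_add set_integrable_mult_right Ii)?; simp)
    also have "\<dots> = 0" using Suc.IH unfolding I_def by simp
    finally show ?case .
  qed
  have zero: "h x0 = 0" if x0: "0 < x0" "x0 < 1" for x0
  proof (rule ccontr)
    assume nz: "h x0 \<noteq> 0"
    \<comment> \<open>Multiplying by this conjugate turns the value at \<open>x0\<close> into
      |h(x0)|^2, so the real part is a real function that is positive there.\<close>
    define w where "w = cnj (h x0)"
    define g where "g = (\<lambda>x. Re (w * h x))"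
    have g: "continuous_on UNIV g" unfolding g_def by (intro continuous_intros h)
    have "g x0 > 0" using nz
      by (auto simp: g_def w_def complex_eq_iff not_sum_squares_lt_zero sum_squares_gt_zero_iff)
    then obtain A where A: "(\<lambda>n. (LBINT x:{0..1}. g x * (A + cos (2 * pi * (x - x0))) ^ n)) \<noteq> (\<lambda>n. 0)"
      using trig_kernel_lower_bound[OF g x0] by metis
    have "(LBINT x:{0..1}. g x * (A + cos (2 * pi * (x - x0))) ^ n) = 0" for n
    proof -
      let ?F = "\<lambda>x. w * (h x * of_real (A + cos (2 * pi * (x - x0))) ^ n)"
      have "set_integrable lborel {0..1} ?F"
        by (intro continuous_set_integrable continuous_intros h)
      then have "(LBINT x:{0..1}. Re (?F x)) = Re (LBINT x:{0..1}. ?F x)"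
        unfolding set_integrable_def set_lebesgue_integral_def
        using Bochner_Integration.integral_Re[of lborel "\<lambda>x. indicator {0..1} x *\<^sub>R ?F x"] by simp
      also have "(LBINT x:{0..1}. ?F x) = 0"
        using kernel[of A x0 n 0] by simp
      also have "(\<lambda>x. Re (?F x)) = (\<lambda>x. g x * (A + cos (2 * pi * (x - x0))) ^ n)"
        by (auto simp: g_def of_real_power[symmetric] simp del: of_real_power of_real_add intro!: ext)
           (simp add: algebra_simps)
      finally show ?thesis by simp
    qed
    with A show False by auto
  qed
  \<comment> \<open>The kernel argument needs an interior point of [0,1]; the endpoints follow by
    continuity.\<close>
  have "h y = 0" if "y \<in> {0..1}" for y
  proof -
    have "closed {x. h x = 0}" using h
      by (intro closed_Collect_eq continuous_intros) auto
    moreover have "{0<..<1} \<subseteq> {x. h x = 0}" using zero by auto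
    ultimately have "closure {0<..<1::real} \<subseteq> {x. h x = 0}" by (rule closure_minimal[rotated])
    then show ?thesis using that by auto
  qed
  moreover have "h x = h (frac x)" by (rule periodic_frac[where h = h, OF per])
  ultimately show ?thesis using frac_lt_1[of x] frac_ge_0[of x] by (auto simp: less_imp_le)
qed

section \<open>Square-summable coefficients and Fourier series\<close>

lemma infsum_Cauchy_Schwarz:
  fixes a b :: "'i \<Rightarrow> real"
  assumes a: "(\<lambda>k. (a k)\<^sup>2) summable_on UNIV" and b: "(\<lambda>k. (b k)\<^sup>2) summable_on UNIV"
  shows "(\<lambda>k. \<bar>a k * b k\<bar>) summable_on UNIV"
    and "(\<Sum>\<^sub>\<infinity>k. \<bar>a k * b k\<bar>) \<le> sqrt (\<Sum>\<^sub>\<infinity>k. (a k)\<^sup>2) * sqrt (\<Sum>\<^sub>\<infinity>k. (b k)\<^sup>2)"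
proof -
  have fin: "(\<Sum>k\<in>X. \<bar>a k * b k\<bar>) \<le> sqrt (\<Sum>\<^sub>\<infinity>k. (a k)\<^sup>2) * sqrt (\<Sum>\<^sub>\<infinity>k. (b k)\<^sup>2)" if "finite X" for X
  proof -
    have "(\<Sum>k\<in>X. \<bar>a k * b k\<bar>) \<le> L2_set a X * L2_set b X"
      unfolding abs_mult by (rule L2_set_mult_ineq)
    also have "\<dots> \<le> sqrt (\<Sum>\<^sub>\<infinity>k. (a k)\<^sup>2) * sqrt (\<Sum>\<^sub>\<infinity>k. (b k)\<^sup>2)"
      unfolding L2_set_def
      by (intro mult_mono real_sqrt_le_mono finite_sum_le_infsum a b that)
         (auto intro!: sum_nonneg infsum_nonneg)
    finally show ?thesis .
  qed
  show s: "(\<lambda>k. \<bar>a k * b k\<bar>) summable_on UNIV"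
    by (intro nonneg_bdd_above_summable_on bdd_aboveI2[OF fin]) auto
  show "(\<Sum>\<^sub>\<infinity>k. \<bar>a k * b k\<bar>) \<le> sqrt (\<Sum>\<^sub>\<infinity>k. (a k)\<^sup>2) * sqrt (\<Sum>\<^sub>\<infinity>k. (b k)\<^sup>2)"
    by (intro infsum_le_finite_sums s fin)
qed

definition l2 :: "('i \<Rightarrow> complex) \<Rightarrow> bool" where
  "l2 c \<longleftrightarrow> (\<lambda>k. (cmod (c k))\<^sup>2) summable_on UNIV"

definition l2_norm :: "('i \<Rightarrow> complex) \<Rightarrow> real" where
  "l2_norm c = sqrt (\<Sum>\<^sub>\<infinity>k. (cmod (c k))\<^sup>2)"

lemma l2_norm_nonneg [simp]: "0 \<le> l2_norm c"
  by (simp add: l2_norm_def infsum_nonneg)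

lemma l2_norm_square: "(l2_norm c)\<^sup>2 = (\<Sum>\<^sub>\<infinity>k. (cmod (c k))\<^sup>2)"
  by (simp add: l2_norm_def infsum_nonneg)

lemma l2_comparison:
  assumes "l2 d" and "\<And>k. cmod (c k) \<le> C * cmod (d k)"
  shows "l2 c" and "0 \<le> C \<Longrightarrow> l2_norm c \<le> C * l2_norm d"
proof -
  have le: "(cmod (c k))\<^sup>2 \<le> C\<^sup>2 * (cmod (d k))\<^sup>2" for k
    using power_mono[OF assms(2), of k 2] by (simp add: power_mult_distrib)
  have s: "(\<lambda>k. C\<^sup>2 * (cmod (d k))\<^sup>2) summable_on UNIV"
    using assms(1) unfolding l2_def by (rule summable_on_cmult_right)
  show c: "l2 c" unfolding l2_def
    by (rule summable_on_comparison_test[OF s]) (auto simp: le)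
  assume "0 \<le> C"
  have "(\<Sum>\<^sub>\<infinity>k. (cmod (c k))\<^sup>2) \<le> (\<Sum>\<^sub>\<infinity>k. C\<^sup>2 * (cmod (d k))\<^sup>2)"
    using c s le unfolding l2_def by (intro infsum_mono) auto
  also have "\<dots> = C\<^sup>2 * (\<Sum>\<^sub>\<infinity>k. (cmod (d k))\<^sup>2)" by (rule infsum_cmult_right')
  finally show "l2_norm c \<le> C * l2_norm d" using \<open>0 \<le> C\<close>
    unfolding l2_norm_def by (metis real_sqrt_le_mono real_sqrt_mult real_sqrt_abs abs_of_nonneg)
qed

lemma cmod_add_square_le: "(cmod (x + y))\<^sup>2 \<le> 2 * (cmod x)\<^sup>2 + 2 * (cmod y)\<^sup>2"
proof -
  have "(cmod (x + y))\<^sup>2 \<le> (cmod x + cmod y)\<^sup>2"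
    by (intro power_mono norm_triangle_ineq) auto
  also have "\<dots> \<le> 2 * (cmod x)\<^sup>2 + 2 * (cmod y)\<^sup>2"
    using zero_le_power2[of "cmod x - cmod y"] by (simp add: power2_eq_square algebra_simps)
  finally show ?thesis .
qed

lemma cmod_add_scaleR_square:
  "(cmod (x + h *\<^sub>R y))\<^sup>2 = (cmod x)\<^sup>2 + (2 * h * (x \<bullet> y) + h\<^sup>2 * (cmod y)\<^sup>2)"
  unfolding cmod_power2 inner_complex_def by (simp add: power2_eq_square algebra_simps)

lemma l2_add:
  assumes "l2 c" "l2 d"
  shows "l2 (\<lambda>k. c k + d k)" and "(l2_norm (\<lambda>k. c k + d k))\<^sup>2 \<le> 2 * (l2_norm c)\<^sup>2 + 2 * (l2_norm d)\<^sup>2"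
proof -
  have s: "(\<lambda>k. 2 * (cmod (c k))\<^sup>2 + 2 * (cmod (d k))\<^sup>2) summable_on UNIV"
    using assms unfolding l2_def by (intro summable_on_add summable_on_cmult_right)
  show l: "l2 (\<lambda>k. c k + d k)" unfolding l2_def
    by (rule summable_on_comparison_test[OF s]) (auto simp: cmod_add_square_le)
  have "(l2_norm (\<lambda>k. c k + d k))\<^sup>2 \<le> (\<Sum>\<^sub>\<infinity>k. 2 * (cmod (c k))\<^sup>2 + 2 * (cmod (d k))\<^sup>2)"
    unfolding l2_norm_square using l s unfolding l2_def by (intro infsum_mono cmod_add_square_le) auto
  also have "\<dots> = 2 * (l2_norm c)\<^sup>2 + 2 * (l2_norm d)\<^sup>2"
    unfolding l2_norm_square using assms unfolding l2_def
    by (subst infsum_add) (auto intro!: summable_on_cmult_right simp: infsum_cmult_right')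
  finally show "(l2_norm (\<lambda>k. c k + d k))\<^sup>2 \<le> 2 * (l2_norm c)\<^sup>2 + 2 * (l2_norm d)\<^sup>2" .
qed

lemma l2_cmult: "l2 c \<Longrightarrow> l2 (\<lambda>k. z * c k)"
  by (rule l2_comparison(1)[where C = "cmod z"]) (auto simp: norm_mult)

lemma l2_diff: "l2 c \<Longrightarrow> l2 d \<Longrightarrow> l2 (\<lambda>k. c k - d k)"
  using l2_add(1)[of c "\<lambda>k. - 1 * d k"] l2_cmult[of d "-1"] by simp

lemma cmod_le_l2_norm: "l2 c \<Longrightarrow> cmod (c k) \<le> l2_norm c"
  using finite_sum_le_infsum[of "\<lambda>k. (cmod (c k))\<^sup>2" UNIV "{k}"]
  unfolding l2_def l2_norm_def by (auto intro!: real_le_rsqrt)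

lemma l2_inner:
  assumes "l2 c" "l2 d"
  shows "(\<lambda>k. c k \<bullet> d k) summable_on UNIV" and "\<bar>\<Sum>\<^sub>\<infinity>k. c k \<bullet> d k\<bar> \<le> l2_norm c * l2_norm d"
proof -
  note cs = infsum_Cauchy_Schwarz[of "\<lambda>k. cmod (c k)" "\<lambda>k. cmod (d k)"]
  have s: "(\<lambda>k. cmod (c k) * cmod (d k)) summable_on UNIV"
    and le: "(\<Sum>\<^sub>\<infinity>k. cmod (c k) * cmod (d k)) \<le> l2_norm c * l2_norm d"
    using cs assms unfolding l2_def l2_norm_def by auto
  have ab: "(\<lambda>k. norm (c k \<bullet> d k)) summable_on UNIV"
    by (rule summable_on_comparison_test[OF s]) (auto simp: Cauchy_Schwarz_ineq2)
  then show "(\<lambda>k. c k \<bullet> d k) summable_on UNIV" by (rule abs_summable_summable)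
  have "\<bar>\<Sum>\<^sub>\<infinity>k. c k \<bullet> d k\<bar> \<le> (\<Sum>\<^sub>\<infinity>k. norm (c k \<bullet> d k))"
    using norm_infsum_bound[OF ab] by simp
  also have "\<dots> \<le> (\<Sum>\<^sub>\<infinity>k. cmod (c k) * cmod (d k))"
    by (intro infsum_mono ab s) (simp add: Cauchy_Schwarz_ineq2)
  finally show "\<bar>\<Sum>\<^sub>\<infinity>k. c k \<bullet> d k\<bar> \<le> l2_norm c * l2_norm d" using le by simp
qed

text \<open>Write c(\<tau>) = c(t) + (\<tau> - t) (c' + d(\<tau>)) with d(\<tau>) tending to 0 in
  l2. Expanding the square leaves the cross term with c', and Cauchy-Schwarz controls the rest. The
  set \<open>A\<close> allows one-sided derivatives, as needed at time 0.\<close>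

lemma l2_norm_square_has_derivative:
  fixes c :: "real \<Rightarrow> 'i \<Rightarrow> complex"
  assumes c: "\<And>\<tau>. \<tau> \<in> A \<Longrightarrow> l2 (c \<tau>)" and c': "l2 c'" and t: "t \<in> A"
    and lim: "((\<lambda>\<tau>. l2_norm (\<lambda>k. (c \<tau> k - c t k) / of_real (\<tau> - t) - c' k)) \<longlongrightarrow> 0) (at t within A)"
  shows "((\<lambda>\<tau>. (l2_norm (c \<tau>))\<^sup>2) has_real_derivative 2 * (\<Sum>\<^sub>\<infinity>k. c t k \<bullet> c' k)) (at t within A)"
proof -
  define d where "d = (\<lambda>\<tau> k. (c \<tau> k - c t k) / of_real (\<tau> - t) - c' k)"
  define D where "D = 2 * (\<Sum>\<^sub>\<infinity>k. c t k \<bullet> c' k)"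
  have bound: "\<bar>((l2_norm (c \<tau>))\<^sup>2 - (l2_norm (c t))\<^sup>2) / (\<tau> - t) - D\<bar>
      \<le> 2 * (l2_norm (c t) * l2_norm (d \<tau>)) + \<bar>\<tau> - t\<bar> * (2 * (l2_norm c')\<^sup>2 + 2 * (l2_norm (d \<tau>))\<^sup>2)"
    if \<tau>: "\<tau> \<in> A" "\<tau> \<noteq> t" for \<tau>
  proof -
    let ?h = "\<tau> - t"
    have d: "l2 (d \<tau>)"
      unfolding d_def divide_inverse
      using l2_diff[OF l2_cmult[OF l2_diff[OF c[OF \<tau>(1)] c[OF t]], of "inverse (of_real ?h)"] c']
      by (simp add: mult.commute)
    let ?e = "\<lambda>k. c' k + d \<tau> k"
    have e: "l2 ?e" by (rule l2_add(1)[OF c' d])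
    have ct: "c \<tau> k = c t k + ?h *\<^sub>R ?e k" for k
      using \<tau>(2) unfolding d_def by (simp add: scaleR_conv_of_real)
    have ptw: "(cmod (c \<tau> k))\<^sup>2 = (cmod (c t k))\<^sup>2 + (2 * ?h * (c t k \<bullet> c' k)
        + (2 * ?h * (c t k \<bullet> d \<tau> k) + ?h\<^sup>2 * (cmod (?e k))\<^sup>2))" for k
      unfolding ct[of k] cmod_add_scaleR_square inner_add_right by (simp add: algebra_simps)
    have "((\<lambda>k. (cmod (c \<tau> k))\<^sup>2) has_sum ((l2_norm (c t))\<^sup>2 + (2 * ?h * (\<Sum>\<^sub>\<infinity>k. c t k \<bullet> c' k)
        + (2 * ?h * (\<Sum>\<^sub>\<infinity>k. c t k \<bullet> d \<tau> k) + ?h\<^sup>2 * (l2_norm ?e)\<^sup>2)))) UNIV"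
      unfolding ptw l2_norm_square
      by (rule has_sum_add has_sum_cmult_right has_sum_infsum l2_inner(1)[OF c[OF t] c']
          l2_inner(1)[OF c[OF t] d] c[OF t, unfolded l2_def] e[unfolded l2_def])+
    then have "(l2_norm (c \<tau>))\<^sup>2 = (l2_norm (c t))\<^sup>2 + (?h * D + (2 * ?h * (\<Sum>\<^sub>\<infinity>k. c t k \<bullet> d \<tau> k) + ?h\<^sup>2 * (l2_norm ?e)\<^sup>2))"
      unfolding l2_norm_square[of "c \<tau>"] D_def by (simp add: infsumI)
    then have "((l2_norm (c \<tau>))\<^sup>2 - (l2_norm (c t))\<^sup>2) / ?h - D = 2 * (\<Sum>\<^sub>\<infinity>k. c t k \<bullet> d \<tau> k) + ?h * (l2_norm ?e)\<^sup>2"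
      using \<tau>(2) by (simp add: field_simps power2_eq_square)
    also have "\<bar>\<dots>\<bar> \<le> 2 * \<bar>\<Sum>\<^sub>\<infinity>k. c t k \<bullet> d \<tau> k\<bar> + \<bar>?h\<bar> * (l2_norm ?e)\<^sup>2"
      by (rule order_trans[OF abs_triangle_ineq]) (simp add: abs_mult)
    also have "\<dots> \<le> 2 * (l2_norm (c t) * l2_norm (d \<tau>)) + \<bar>?h\<bar> * (2 * (l2_norm c')\<^sup>2 + 2 * (l2_norm (d \<tau>))\<^sup>2)"
      by (intro add_mono mult_left_mono l2_inner(2)[OF c[OF t] d] l2_add(2)[OF c' d]) auto
    finally show ?thesis .
  qed
  have h: "((\<lambda>\<tau>. \<tau>) \<longlongrightarrow> t) (at t within A)" by (rule tendsto_ident_at)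
  have "((\<lambda>\<tau>. 2 * (l2_norm (c t) * l2_norm (d \<tau>)) + \<bar>\<tau> - t\<bar> * (2 * (l2_norm c')\<^sup>2 + 2 * (l2_norm (d \<tau>))\<^sup>2))
      \<longlongrightarrow> 2 * (l2_norm (c t) * 0) + \<bar>t - t\<bar> * (2 * (l2_norm c')\<^sup>2 + 2 * 0\<^sup>2)) (at t within A)"
    using lim by (intro tendsto_intros h) (simp_all add: d_def)
  then have bound_lim: "((\<lambda>\<tau>. 2 * (l2_norm (c t) * l2_norm (d \<tau>)) + \<bar>\<tau> - t\<bar> * (2 * (l2_norm c')\<^sup>2 + 2 * (l2_norm (d \<tau>))\<^sup>2))
      \<longlongrightarrow> 0) (at t within A)" by simp
  have "((\<lambda>\<tau>. ((l2_norm (c \<tau>))\<^sup>2 - (l2_norm (c t))\<^sup>2) / (\<tau> - t) - D) \<longlongrightarrow> 0) (at t within A)"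
    by (intro Lim_null_comparison[OF _ bound_lim]) (auto simp: eventually_at_filter bound)
  then show ?thesis
    unfolding has_field_derivative_iff D_def[symmetric] by (rule LIM_zero_cancel)
qed

section \<open>Absolutely convergent Fourier series\<close>

abbreviation abs_summable :: "(int \<Rightarrow> complex) \<Rightarrow> bool" where
  "abs_summable c \<equiv> (\<lambda>k. cmod (c k)) summable_on UNIV"

definition fourier_sum :: "(int \<Rightarrow> complex) \<Rightarrow> real \<Rightarrow> complex" where
  "fourier_sum c x = (\<Sum>\<^sub>\<infinity>k. c k * chi k x)"

text \<open>The bound does not depend on \<open>x\<close>: it gives uniform convergence of the
  partial sums, and for empty \<open>X\<close> it bounds the sum itself.\<close>

lemma fourier_sum_tail:
  assumes c: "abs_summable c" and X: "finite X"
  shows "cmod (fourier_sum c x - (\<Sum>k\<in>X. c k * chi k x)) \<le> (\<Sum>\<^sub>\<infinity>k. cmod (c k)) - (\<Sum>k\<in>X. cmod (c k))"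
proof -
  have ab: "(\<lambda>k. cmod (c k * chi k x)) summable_on UNIV" using c by (simp add: norm_mult)
  have s: "(\<lambda>k. c k * chi k x) summable_on UNIV" by (rule abs_summable_summable[OF ab])
  have "fourier_sum c x = (\<Sum>k\<in>X. c k * chi k x) + (\<Sum>\<^sub>\<infinity>k\<in>-X. c k * chi k x)"
    unfolding fourier_sum_def using X infsum_Un_disjoint[of "\<lambda>k. c k * chi k x" X "- X"] summable_on_subset_banach[OF s]
    by simp
  then have "cmod (fourier_sum c x - (\<Sum>k\<in>X. c k * chi k x)) = cmod (\<Sum>\<^sub>\<infinity>k\<in>-X. c k * chi k x)" by simp
  also have "\<dots> \<le> (\<Sum>\<^sub>\<infinity>k\<in>-X. cmod (c k))"
    using norm_infsum_bound[of "\<lambda>k. c k * chi k x" "- X"] summable_on_subset_banach[OF ab, of "- X"]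
    by (simp add: norm_mult)
  finally have le: "cmod (fourier_sum c x - (\<Sum>k\<in>X. c k * chi k x)) \<le> (\<Sum>\<^sub>\<infinity>k\<in>-X. cmod (c k))" .
  have "(\<Sum>\<^sub>\<infinity>k. cmod (c k)) = (\<Sum>k\<in>X. cmod (c k)) + (\<Sum>\<^sub>\<infinity>k\<in>-X. cmod (c k))"
    using X infsum_Un_disjoint[of "\<lambda>k. cmod (c k)" X "- X"] summable_on_subset_banach[OF c]
    by (simp add: Compl_partition)
  with le show ?thesis by simp
qed

lemma fourier_sum_uniform_limit:
  assumes c: "abs_summable c"
  shows "uniform_limit UNIV (\<lambda>X x. \<Sum>k\<in>X. c k * chi k x) (fourier_sum c) (finite_subsets_at_top UNIV)"
proof (rule uniform_limitI)
  fix e :: real assume e: "e > 0"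
  have "((\<lambda>X. (\<Sum>k\<in>X. cmod (c k))) \<longlongrightarrow> (\<Sum>\<^sub>\<infinity>k. cmod (c k))) (finite_subsets_at_top UNIV)"
    using has_sum_infsum[OF c] unfolding has_sum_def .
  then have "\<forall>\<^sub>F X in finite_subsets_at_top UNIV. dist (\<Sum>k\<in>X. cmod (c k)) (\<Sum>\<^sub>\<infinity>k. cmod (c k)) < e"
    using e by (rule tendstoD)
  moreover have "\<forall>\<^sub>F X in finite_subsets_at_top (UNIV :: int set). finite X"
    by (rule eventually_finite_subsets_at_top_weakI) auto
  ultimately show "\<forall>\<^sub>F X in finite_subsets_at_top UNIV. \<forall>x\<in>UNIV. dist (\<Sum>k\<in>X. c k * chi k x) (fourier_sum c x) < e"
  proof eventually_elim
    case (elim X)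
    show ?case
    proof
      fix x
      have "dist (\<Sum>k\<in>X. c k * chi k x) (fourier_sum c x) = cmod (fourier_sum c x - (\<Sum>k\<in>X. c k * chi k x))"
        by (simp add: dist_norm norm_minus_commute)
      also have "\<dots> \<le> (\<Sum>\<^sub>\<infinity>k. cmod (c k)) - (\<Sum>k\<in>X. cmod (c k))" by (rule fourier_sum_tail[OF c elim(2)])
      also have "\<dots> < e" using elim(1) by (auto simp: dist_real_def)
      finally show "dist (\<Sum>k\<in>X. c k * chi k x) (fourier_sum c x) < e" .
    qed
  qed
qed

lemma continuous_on_fourier_sum:
  assumes "abs_summable c" shows "continuous_on A (fourier_sum c)"
proof (rule continuous_on_subset[OF _ subset_UNIV], rule uniform_limit_theorem[OF _ fourier_sum_uniform_limit[OF assms]])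
  show "\<forall>\<^sub>F X in finite_subsets_at_top UNIV. continuous_on UNIV (\<lambda>x. \<Sum>k\<in>X. c k * chi k x)"
    by (intro always_eventually allI continuous_intros)
qed simp

lemma fourier_sum_periodic: "fourier_sum c (x + 1) = fourier_sum c x"
  by (simp add: fourier_sum_def)

lemma norm_fourier_sum_le: "abs_summable c \<Longrightarrow> cmod (fourier_sum c x) \<le> (\<Sum>\<^sub>\<infinity>k. cmod (c k))"
  using fourier_sum_tail[of c "{}"] by simp

lemma fourier_sum_has_sum:
  assumes "abs_summable c"
  shows "((\<lambda>k. c k * chi k x) has_sum fourier_sum c x) UNIV"
  unfolding fourier_sum_def using assms
  by (intro has_sum_infsum, intro abs_summable_summable[where f = "\<lambda>k. c k * chi k x"]) (simp add: norm_mult)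

lemma fourier_sum_add:
  assumes "abs_summable c" "abs_summable d"
  shows "fourier_sum (\<lambda>k. c k + d k) x = fourier_sum c x + fourier_sum d x"
  using infsumI[OF has_sum_add[OF fourier_sum_has_sum[OF assms(1), of x] fourier_sum_has_sum[OF assms(2), of x]]]
  by (simp add: fourier_sum_def ring_distribs)

lemma fourier_sum_cmult: "fourier_sum (\<lambda>k. z * c k) x = z * fourier_sum c x"
  unfolding fourier_sum_def mult.assoc by (rule infsum_cmult_right')

lemma uniform_limit_set_integral:
  fixes f :: "'i \<Rightarrow> real \<Rightarrow> complex"
  assumes f: "uniform_limit {0..1} f h F" and fc: "\<And>i. continuous_on UNIV (f i)"
    and h: "continuous_on UNIV h" and g: "set_integrable lborel {0..1} g"
  shows "((\<lambda>i. LBINT x:{0..1}. f i x * g x) \<longlongrightarrow> (LBINT x:{0..1}. h x * g x)) F"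
proof (rule tendstoI)
  fix e :: real assume e: "e > 0"
  define G where "G = (LBINT x:{0..1}. cmod (g x))"
  have gn: "set_integrable lborel {0..1} (\<lambda>x. cmod (g x))"
    using g integrable_norm[of lborel "\<lambda>x. indicator {0..1} x *\<^sub>R g x"]
    unfolding set_integrable_def by simp
  have G: "G \<ge> 0" unfolding G_def set_lebesgue_integral_def by (intro integral_nonneg_AE) auto
  have "\<forall>\<^sub>F i in F. \<forall>x\<in>{0..1}. dist (f i x) (h x) < e / (G + 1)"
    using f e G by (auto simp: uniform_limit_iff)
  then show "\<forall>\<^sub>F i in F. dist (LBINT x:{0..1}. f i x * g x) (LBINT x:{0..1}. h x * g x) < e"
  proof eventually_elim
    case (elim i)
    have "dist (LBINT x:{0..1}. f i x * g x) (LBINT x:{0..1}. h x * g x)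
       = cmod (LBINT x:{0..1}. (f i x - h x) * g x)"
      unfolding dist_norm left_diff_distrib
      by (subst set_integral_diff(2)) (auto intro!: set_integrable_mult_bounded g fc h)
    also have "\<dots> \<le> (LBINT x:{0..1}. e / (G + 1) * cmod (g x))"
    proof (rule set_integral_norm_le)
      show "complex_set_integrable lborel {0..1} (\<lambda>x. (f i x - h x) * g x)"
        by (intro set_integrable_mult_bounded g continuous_intros fc h)
      show "set_integrable lborel {0..1} (\<lambda>x. e / (G + 1) * cmod (g x))"
        using gn by simp
      show "cmod ((f i x - h x) * g x) \<le> e / (G + 1) * cmod (g x)" if "x \<in> {0..1}" for x
        using elim that unfolding norm_mult dist_norm by (intro mult_right_mono) (auto intro: less_imp_le)
    qed
    also have "\<dots> = e * (G / (G + 1))" by (simp add: G_def)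
    also have "\<dots> < e * 1" using e G by (intro mult_strict_left_mono) auto
    finally show ?case by simp
  qed
qed

lemma set_integral_finite_sum:
  fixes f :: "'i \<Rightarrow> 'b \<Rightarrow> 'a::{banach, second_countable_topology}"
  assumes "\<And>k. k \<in> X \<Longrightarrow> set_integrable M A (f k)"
  shows "(LINT x:A|M. \<Sum>k\<in>X. f k x) = (\<Sum>k\<in>X. LINT x:A|M. f k x)"
  using assms unfolding set_lebesgue_integral_def set_integrable_def scaleR_sum_right
  by (intro Bochner_Integration.integral_sum)

lemma trig_poly_pairing:
  assumes "set_integrable lborel {0..1} g"
  shows "(LBINT x:{0..1}. (\<Sum>k\<in>X. c k * chi k x) * g x) = (\<Sum>k\<in>X. c k * cfourier g (- k))"
proof -
  have "(LBINT x:{0..1}. (\<Sum>k\<in>X. c k * chi k x) * g x) = (LBINT x:{0..1}. \<Sum>k\<in>X. c k * (g x * chi k x))"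
    unfolding sum_distrib_right by (intro arg_cong[where f = "set_lebesgue_integral lborel {0..1}"] ext sum.cong) auto
  also have "\<dots> = (\<Sum>k\<in>X. LBINT x:{0..1}. c k * (g x * chi k x))"
    by (rule set_integral_finite_sum, rule set_integrable_mult_right, rule cfourier_integrable[OF assms])
  also have "\<dots> = (\<Sum>k\<in>X. c k * cfourier g (- k))"
    unfolding cfourier_def by (intro sum.cong refl) simp
  finally show ?thesis .
qed

text \<open>Uniform convergence allows termwise integration even against a merely integrable
  \<open>g\<close>. The index \<open>- k\<close> arises because \<open>cfourier\<close> integrates
  against the conjugate character.\<close>

lemma fourier_sum_pairing:
  assumes c: "abs_summable c" and g: "set_integrable lborel {0..1} g"
  shows "((\<lambda>k. c k * cfourier g (- k)) has_sum (LBINT x:{0..1}. fourier_sum c x * g x)) UNIV"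
proof -
  have "((\<lambda>X. LBINT x:{0..1}. (\<Sum>k\<in>X. c k * chi k x) * g x) \<longlongrightarrow> (LBINT x:{0..1}. fourier_sum c x * g x))
          (finite_subsets_at_top UNIV)"
    by (intro uniform_limit_set_integral uniform_limit_on_subset[OF fourier_sum_uniform_limit[OF c]]
        continuous_on_fourier_sum[OF c] g continuous_intros) auto
  then show ?thesis unfolding has_sum_def trig_poly_pairing[OF g] .
qed

lemma cfourier_fourier_sum:
  assumes "abs_summable c" shows "cfourier (fourier_sum c) k = c k"
proof -
  have "((\<lambda>j. c j * cfourier (chi (- k)) (- j)) has_sum cfourier (fourier_sum c) k) UNIV"
    unfolding cfourier_def[of "fourier_sum c"]
    by (intro fourier_sum_pairing assms continuous_set_integrable continuous_intros)
  then have "((\<lambda>j. if j = k then c j else 0) has_sum cfourier (fourier_sum c) k) UNIV"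
    by (simp add: cfourier_chi if_distrib eq_commute[of k] cong: if_cong)
  moreover have "((\<lambda>j. if j = k then c j else 0) has_sum c k) UNIV"
    by (subst has_sum_cong_neutral[where T = "{k}" and g = c]) (auto intro: has_sum_finiteI)
  ultimately show ?thesis by (rule has_sum_unique)
qed

text \<open>The sum of the series has the same coefficients as \<open>h\<close>, so the uniqueness
  result applies to the difference.\<close>

lemma fourier_series:
  assumes h: "continuous_on UNIV h" and per: "\<And>x. h (x + 1) = h x"
    and c: "abs_summable (cfourier h)"
  shows "fourier_sum (cfourier h) = h"
proof
  fix x
  have "h x - fourier_sum (cfourier h) x = 0"
    by (rule cfourier_eq_0_imp_eq_0[where h = "\<lambda>x. h x - fourier_sum (cfourier h) x"])
       (simp_all add: cfourier_diff[OF continuous_set_integrable continuous_set_integrable] cfourier_fourier_sum[OF c] continuous_on_fourier_sum[OF c]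
          per fourier_sum_periodic h continuous_on_diff)
  then show "fourier_sum (cfourier h) x = h x" by simp
qed

lemma fourier_sum_has_vector_derivative:
  assumes c: "abs_summable c" and d: "abs_summable (\<lambda>k. of_int k * c k)"
  shows "(fourier_sum c has_vector_derivative fourier_sum (\<lambda>k. 2 * pi * \<i> * of_int k * c k) x) (at x)"
proof -
  define d where "d = (\<lambda>k. 2 * pi * \<i> * of_int k * c k)"
  have dab: "abs_summable d"
    using summable_on_cmult_right[OF d, of "2 * pi"] by (simp add: d_def norm_mult mult_ac)
  \<comment> \<open>Symmetric blocks turn the net of finite index sets into a sequence, as
    \<open>has_derivative_sequence\<close> requires.\<close>
  define X where "X = (\<lambda>n. {- int n..int n})"
  have X: "filterlim X (finite_subsets_at_top UNIV) sequentially"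
    unfolding filterlim_finite_subsets_at_top
  proof safe
    fix Y :: "int set" assume Y: "finite Y"
    define N where "N = Max (abs ` Y)"
    have N: "\<forall>k\<in>Y. \<bar>k\<bar> \<le> N" using Y by (auto simp: N_def)
    show "\<forall>\<^sub>F n in sequentially. finite (X n) \<and> Y \<subseteq> X n \<and> X n \<subseteq> UNIV"
      using eventually_ge_at_top[of "nat N"]
    proof eventually_elim
      case (elim n)
      then show ?case using N by (force simp: X_def abs_le_iff)
    qed
  qed
  have "\<exists>g. \<forall>x\<in>UNIV. (\<lambda>n. \<Sum>k\<in>X n. c k * chi k x) \<longlonglongrightarrow> g x \<and>
      (g has_derivative (\<lambda>h. h *\<^sub>R fourier_sum d x)) (at x within UNIV)"
  proof (rule has_derivative_sequence[where f' = "\<lambda>n x h. h *\<^sub>R (\<Sum>k\<in>X n. d k * chi k x)" and ?x0.0 = 0])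
    show "((\<lambda>x. \<Sum>k\<in>X n. c k * chi k x) has_derivative (\<lambda>h. h *\<^sub>R (\<Sum>k\<in>X n. d k * chi k x))) (at x within UNIV)" for n x
      unfolding has_vector_derivative_def[symmetric]
      by (intro has_vector_derivative_sum)
         (auto intro!: derivative_eq_intros has_vector_derivative_chi simp: d_def mult_ac)
    show "(\<lambda>n. \<Sum>k\<in>X n. c k * chi k 0) \<longlonglongrightarrow> fourier_sum c 0"
      using filterlim_compose[OF fourier_sum_has_sum[OF c, of 0, unfolded has_sum_def] X] by simp
    fix e :: real assume "e > 0"
    with fourier_sum_uniform_limit[OF dab]
    have "\<forall>\<^sub>F Y in finite_subsets_at_top UNIV. \<forall>x\<in>UNIV. dist (\<Sum>k\<in>Y. d k * chi k x) (fourier_sum d x) < e"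
      by (auto simp: uniform_limit_iff)
    from eventually_compose_filterlim[OF this X]
    show "\<forall>\<^sub>F n in sequentially. \<forall>x\<in>UNIV. \<forall>h. cmod (h *\<^sub>R (\<Sum>k\<in>X n. d k * chi k x) - h *\<^sub>R fourier_sum d x) \<le> e * norm h"
    proof eventually_elim
      case (elim n)
      show ?case
      proof (intro ballI allI)
        fix x h
        have "cmod (h *\<^sub>R (\<Sum>k\<in>X n. d k * chi k x) - h *\<^sub>R fourier_sum d x) = norm h * dist (\<Sum>k\<in>X n. d k * chi k x) (fourier_sum d x)"
          unfolding dist_norm scaleR_diff_right[symmetric] by simp
        also have "\<dots> \<le> norm h * e" using elim by (intro mult_left_mono) (auto intro: less_imp_le)
        finally show "cmod (h *\<^sub>R (\<Sum>k\<in>X n. d k * chi k x) - h *\<^sub>R fourier_sum d x) \<le> e * norm h"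
          by (simp add: mult.commute)
      qed
    qed
  qed auto
  then obtain g where g: "\<And>x. (\<lambda>n. \<Sum>k\<in>X n. c k * chi k x) \<longlonglongrightarrow> g x"
      "\<And>x. (g has_vector_derivative fourier_sum d x) (at x)"
    unfolding has_vector_derivative_def by auto
  have "g = fourier_sum c"
    using g(1) filterlim_compose[OF fourier_sum_has_sum[OF c, unfolded has_sum_def] X]
    by (intro ext LIMSEQ_unique[of "\<lambda>n. \<Sum>k\<in>X n. c k * chi k x" for x]) auto
  then show ?thesis using g(2) unfolding d_def by simp
qed

lemma summable_inverse_square_int: "(\<lambda>k::int. 1 / (1 + (real_of_int k)\<^sup>2)) summable_on UNIV"
proof -
  have nat: "(\<lambda>n::nat. 1 / (1 + (real n)\<^sup>2)) summable_on UNIV"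
  proof (rule summable_nonneg_imp_summable_on)
    show "summable (\<lambda>n::nat. 1 / (1 + (real n)\<^sup>2))"
      by (rule summable_comparison_test'[OF inverse_power_summable[of 2], where N = 1])
         (auto simp: field_simps add_nonneg_eq_0_iff add_pos_nonneg)
  qed auto
  have "(\<lambda>k::int. 1 / (1 + (real_of_int k)\<^sup>2)) summable_on (range int \<union> uminus ` range int)"
  proof (rule summable_on_union)
    show "(\<lambda>k::int. 1 / (1 + (real_of_int k)\<^sup>2)) summable_on range int"
      by (subst summable_on_reindex) (use nat in \<open>auto simp: o_def inj_def\<close>)
    show "(\<lambda>k::int. 1 / (1 + (real_of_int k)\<^sup>2)) summable_on uminus ` range int"
      unfolding image_image by (subst summable_on_reindex) (use nat in \<open>auto simp: o_def inj_def\<close>)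
  qed
  also have "range int \<union> uminus ` range int = UNIV"
  proof (intro UNIV_eq_I[symmetric])
    fix k :: int show "k \<in> range int \<union> uminus ` range int"
      by (cases k rule: int_cases2) auto
  qed
  finally show ?thesis .
qed

section \<open>Sobolev spaces and weak derivatives\<close>

abbreviation fhat :: "(real \<Rightarrow> real) \<Rightarrow> int \<Rightarrow> complex" where
  "fhat \<equiv> fourier_coeff"

lemma set_integrable_of_real:
  fixes f :: "'b \<Rightarrow> real"
  assumes "set_integrable M A f" shows "set_integrable M A (\<lambda>x. complex_of_real (f x))"
  using integrable_of_real[OF assms[unfolded set_integrable_def], where 'a = complex]
  unfolding set_integrable_def by (simp add: scaleR_conv_of_real)

lemma sobolevD:
  assumes "f \<in> sobolev r"
  shows "f (x + 1) = f x" and "f \<in> borel_measurable borel"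
    and "set_integrable lborel {0..1} (\<lambda>x. (f x)\<^sup>2)"
    and "(\<lambda>k. (1 + (of_int k)\<^sup>2) powr r * (cmod (fhat f k))\<^sup>2) summable_on UNIV"
    and "1/2 < r \<Longrightarrow> continuous_on UNIV f"
  using assms unfolding sobolev_def periodic1_def by auto

lemma sobolev_integrable:
  assumes "f \<in> sobolev r"
  shows "set_integrable lborel {0..1} f"
    and "set_integrable lborel {0..1} (\<lambda>x. complex_of_real (f x))"
proof -
  note [measurable] = sobolevD(2)[OF assms]
  have "set_integrable lborel {0..1::real} (\<lambda>x. 1 + (f x)\<^sup>2)"
    by (intro set_integral_add continuous_set_integrable continuous_on_const sobolevD(3)[OF assms])
  moreover have ab: "\<bar>f x\<bar> \<le> \<bar>1 + (f x)\<^sup>2\<bar>" for x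
  proof -
    have "0 \<le> (\<bar>f x\<bar> - 1)\<^sup>2" by simp
    then have "2 * \<bar>f x\<bar> \<le> 1 + (f x)\<^sup>2" by (simp add: power2_eq_square algebra_simps)
    then show ?thesis by linarith
  qed
  ultimately show "set_integrable lborel {0..1} f" "set_integrable lborel {0..1} (\<lambda>x. complex_of_real (f x))"
    by (auto intro!: set_integrable_bound[where g = "\<lambda>x. complex_of_real (f x)"]
         set_integrable_bound[where g = f] simp: set_borel_measurable_def)
qed

lemma fourier_coeff_diff:
  assumes "set_integrable lborel {0..1} (\<lambda>x. complex_of_real (f x))"
    "set_integrable lborel {0..1} (\<lambda>x. complex_of_real (g x))"
  shows "fhat (\<lambda>x. f x - g x) k = fhat f k - fhat g k"
  using cfourier_diff[OF assms] by (simp add: fourier_coeff_eq_cfourier)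

lemma fourier_coeff_cmult: "fhat (\<lambda>x. c * f x) k = of_real c * fhat f k"
  by (simp add: fourier_coeff_eq_cfourier cfourier_cmult)

text \<open>Half of the exponent goes into the coefficient, so that the Sobolev norm is the
  \<open>l2_norm\<close> of this sequence and norm estimates become comparisons of
  sequences.\<close>

definition weighted_coeff :: "real \<Rightarrow> (real \<Rightarrow> real) \<Rightarrow> int \<Rightarrow> complex" where
  "weighted_coeff r f k = of_real ((1 + (of_int k)\<^sup>2) powr (r / 2)) * fhat f k"

lemma cmod_weighted_coeff_square: "(cmod (weighted_coeff r f k))\<^sup>2 = (1 + (of_int k)\<^sup>2) powr r * (cmod (fhat f k))\<^sup>2"
proof -
  have "((1 + (real_of_int k)\<^sup>2) powr (r / 2))\<^sup>2 = (1 + (of_int k)\<^sup>2) powr r"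
    by (simp add: power2_eq_square powr_add[symmetric])
  then show ?thesis by (simp add: weighted_coeff_def norm_mult power_mult_distrib)
qed

lemma sobolev_norm_eq: "sobolev_norm r f = l2_norm (weighted_coeff r f)"
  by (simp add: sobolev_norm_def l2_norm_def cmod_weighted_coeff_square)

lemma l2_weighted_coeff: "f \<in> sobolev r \<Longrightarrow> l2 (weighted_coeff r f)"
  using sobolevD(4) by (simp add: l2_def cmod_weighted_coeff_square)

lemma sobolev_norm_nonneg [simp]: "0 \<le> sobolev_norm r f"
  by (simp add: sobolev_norm_eq)

lemma cmod_fhat_le_weighted_coeff: "0 \<le> r \<Longrightarrow> cmod (fhat f k) \<le> cmod (weighted_coeff r f k)"
  unfolding weighted_coeff_def norm_mult
  using ge_one_powr_ge_zero[of "1 + (real_of_int k)\<^sup>2" "r/2"] by (simp add: mult_right_le_one_le mult_le_cancel_right1)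

lemma sobolev_mono:
  assumes "f \<in> sobolev s" "r \<le> s"
  shows "f \<in> sobolev r" and "sobolev_norm r f \<le> sobolev_norm s f"
proof -
  have le: "cmod (weighted_coeff r f k) \<le> 1 * cmod (weighted_coeff s f k)" for k
    unfolding weighted_coeff_def norm_mult using assms(2)
    by (simp add: mult_right_mono powr_mono)
  note l = l2_comparison[OF l2_weighted_coeff[OF assms(1)] le]
  show "f \<in> sobolev r"
    using l(1) assms unfolding sobolev_def l2_def cmod_weighted_coeff_square by auto
  show "sobolev_norm r f \<le> sobolev_norm s f"
    using l(2) by (simp add: sobolev_norm_eq)
qed

lemma sobolev_cmult:
  assumes "f \<in> sobolev r" shows "(\<lambda>x. c * f x) \<in> sobolev r"
proof -
  have "l2 (weighted_coeff r (\<lambda>x. c * f x))"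
    using l2_cmult[OF l2_weighted_coeff[OF assms], of "of_real c"]
    by (simp add: weighted_coeff_def[abs_def] fourier_coeff_cmult mult_ac)
  then show ?thesis
    using assms unfolding sobolev_def l2_def cmod_weighted_coeff_square periodic1_def
    by (auto simp: power_mult_distrib intro!: continuous_intros)
qed

lemma weighted_coeff_diff:
  assumes "f \<in> sobolev r" "g \<in> sobolev r'"
  shows "weighted_coeff q (\<lambda>x. f x - g x) k = weighted_coeff q f k - weighted_coeff q g k"
  using sobolev_integrable(2)[OF assms(1)] sobolev_integrable(2)[OF assms(2)]
  by (simp add: weighted_coeff_def fourier_coeff_diff right_diff_distrib)

lemma sobolev_diff:
  assumes f: "f \<in> sobolev r" and g: "g \<in> sobolev r" shows "(\<lambda>x. f x - g x) \<in> sobolev r"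
proof -
  note [measurable] = sobolevD(2)[OF f] sobolevD(2)[OF g]
  have "l2 (weighted_coeff r (\<lambda>x. f x - g x))"
    using l2_diff[OF l2_weighted_coeff[OF f] l2_weighted_coeff[OF g]] weighted_coeff_diff[OF f g] by (simp add: l2_def)
  moreover have "set_integrable lborel {0..1} (\<lambda>x. (f x - g x)\<^sup>2)"
  proof (rule set_integrable_bound)
    show "set_integrable lborel {0..1} (\<lambda>x. 2 * (f x)\<^sup>2 + 2 * (g x)\<^sup>2)"
      using sobolevD(3)[OF f] sobolevD(3)[OF g] by (intro set_integral_add) auto
    have "(f x - g x)\<^sup>2 \<le> 2 * (f x)\<^sup>2 + 2 * (g x)\<^sup>2" for x
      using zero_le_power2[of "f x + g x"] by (simp add: power2_eq_square algebra_simps)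
    then show "AE x in lborel. x \<in> {0..1} \<longrightarrow> norm ((f x - g x)\<^sup>2) \<le> norm (2 * (f x)\<^sup>2 + 2 * (g x)\<^sup>2)"
      by (intro AE_I2) (simp add: abs_of_nonneg)
  qed (simp add: set_borel_measurable_def)
  ultimately show ?thesis
    using sobolevD(1,5)[OF f] sobolevD(1,5)[OF g] unfolding sobolev_def l2_def cmod_weighted_coeff_square periodic1_def
    by (auto intro!: continuous_intros)
qed

text \<open>The constant of the embedding of H^1 into the absolutely convergent Fourier series,
  hence into the bounded functions: the l2 norm of (1 + k^2)^(-1/2).\<close>

definition embedding_const :: real where
  "embedding_const = sqrt (\<Sum>\<^sub>\<infinity>k::int. 1 / (1 + (of_int k)\<^sup>2))"

lemma embedding_const_nonneg: "0 \<le> embedding_const"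
  by (simp add: embedding_const_def infsum_nonneg)

text \<open>Cauchy-Schwarz, after splitting off the square-summable factor 1 / sqrt (1 +
  k^2).\<close>

lemma weighted_l2_imp_abs_summable:
  assumes "l2 w" and w: "\<And>k. cmod (w k) = sqrt (1 + (of_int k)\<^sup>2) * cmod (c k)"
  shows "abs_summable c" and "(\<Sum>\<^sub>\<infinity>k. cmod (c k)) \<le> embedding_const * l2_norm w"
proof -
  have nz: "1 + (real_of_int k)\<^sup>2 > 0" for k by (simp add: add_pos_nonneg)
  have eq: "\<bar>(1 / sqrt (1 + (of_int k)\<^sup>2)) * cmod (w k)\<bar> = cmod (c k)" for k
    using nz[of k] by (simp add: w)
  have sq: "(1 / sqrt (1 + (real_of_int k)\<^sup>2))\<^sup>2 = 1 / (1 + (of_int k)\<^sup>2)" for k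
    using nz[of k] by (simp add: power_divide)
  have 1: "(\<lambda>k. (1 / sqrt (1 + (real_of_int k)\<^sup>2))\<^sup>2) summable_on UNIV"
    unfolding sq by (rule summable_inverse_square_int)
  note cs = infsum_Cauchy_Schwarz[OF 1 assms(1)[unfolded l2_def], unfolded eq]
  show "abs_summable c" by (rule cs(1))
  show "(\<Sum>\<^sub>\<infinity>k. cmod (c k)) \<le> embedding_const * l2_norm w"
    using cs(2) by (simp add: embedding_const_def l2_norm_def sq)
qed

lemma cmod_weighted_coeff_1: "cmod (weighted_coeff 1 f k) = sqrt (1 + (of_int k)\<^sup>2) * cmod (fhat f k)"
  unfolding weighted_coeff_def norm_mult norm_of_real by (simp add: powr_half_sqrt)

lemma cmod_weighted_coeff_2: "cmod (weighted_coeff 2 f k) = (1 + (of_int k)\<^sup>2) * cmod (fhat f k)"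
  unfolding weighted_coeff_def norm_mult norm_of_real by simp

lemma cmod_weighted_coeff_0: "cmod (weighted_coeff 0 f k) = cmod (fhat f k)"
  by (simp add: weighted_coeff_def add_nonneg_eq_0_iff)

lemma sobolev_1_abs_summable:
  assumes "f \<in> sobolev 1"
  shows "abs_summable (fhat f)" and "(\<Sum>\<^sub>\<infinity>k. cmod (fhat f k)) \<le> embedding_const * sobolev_norm 1 f"
  using weighted_l2_imp_abs_summable[OF l2_weighted_coeff[OF assms] cmod_weighted_coeff_1] by (simp_all add: sobolev_norm_eq)

lemma fourier_sum_fhat:
  assumes "continuous_on UNIV f" "periodic1 f" "abs_summable (fhat f)"
  shows "fourier_sum (fhat f) x = of_real (f x)"
proof -
  have eq: "fhat f = cfourier (\<lambda>x. of_real (f x))" by (rule ext) (rule fourier_coeff_eq_cfourier)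
  show ?thesis
    using assms unfolding eq periodic1_def
    by (subst fourier_series) (auto intro!: continuous_intros)
qed

lemma sobolev_1_fourier_sum:
  assumes "f \<in> sobolev 1" shows "fourier_sum (fhat f) x = of_real (f x)"
  using sobolevD(1,5)[OF assms] sobolev_1_abs_summable(1)[OF assms] by (intro fourier_sum_fhat) (auto simp: periodic1_def)

lemma sobolev_1_sup:
  assumes "f \<in> sobolev 1" shows "\<bar>f x\<bar> \<le> embedding_const * sobolev_norm 1 f"
proof -
  have "\<bar>f x\<bar> = cmod (fourier_sum (fhat f) x)" by (simp add: sobolev_1_fourier_sum[OF assms])
  also have "\<dots> \<le> (\<Sum>\<^sub>\<infinity>k. cmod (fhat f k))" by (rule norm_fourier_sum_le[OF sobolev_1_abs_summable(1)[OF assms]])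
  also note sobolev_1_abs_summable(2)[OF assms]
  finally show ?thesis .
qed

lemma fhat_deriv:
  assumes "\<And>x. (f has_real_derivative f' x) (at x)" "continuous_on UNIV f'" "periodic1 f"
  shows "fhat f' k = 2 * pi * \<i> * of_int k * fhat f k"
  unfolding fourier_coeff_eq_cfourier
proof (rule cfourier_deriv)
  show "((\<lambda>x. complex_of_real (f x)) has_vector_derivative complex_of_real (f' x)) (at x)" for x
    using assms(1)[of x] by (rule has_vector_derivative_of_real)
  show "complex_of_real (f 1) = complex_of_real (f 0)"
    using assms(3) unfolding periodic1_def by (metis add_0)
qed (intro continuous_intros assms)

text \<open>One of the two powers of |k| provided by order 2 pays for the derivative, the other for
  absolute summability, so the Fourier series may be differentiated term by term.\<close>

lemma sobolev_2_deriv: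
  assumes f: "f \<in> sobolev 2"
  shows "(f has_real_derivative deriv f x) (at x)" and "continuous_on UNIV (deriv f)"
    and "deriv f \<in> sobolev 1" and "fhat (deriv f) k = 2 * pi * \<i> * of_int k * fhat f k"
    and "sobolev_norm 1 (deriv f) \<le> 2 * pi * sobolev_norm 2 f"
proof -
  define d where "d = (\<lambda>k. 2 * pi * \<i> * of_int k * fhat f k)"
  define w where "w = (\<lambda>k. of_real (sqrt (1 + (of_int k)\<^sup>2)) * d k)"
  have f1: "f \<in> sobolev 1" by (rule sobolev_mono(1)[OF f]) simp
  have kle: "\<bar>real_of_int k\<bar> \<le> sqrt (1 + (of_int k)\<^sup>2)" for k
    by (rule real_le_rsqrt) simp
  have wle: "cmod (w k) \<le> 2 * pi * cmod (weighted_coeff 2 f k)" for k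
  proof -
    have "cmod (w k) = 2 * pi * (sqrt (1 + (of_int k)\<^sup>2) * \<bar>of_int k\<bar> * cmod (fhat f k))"
      by (simp add: w_def d_def norm_mult)
    also have "\<dots> \<le> 2 * pi * (sqrt (1 + (of_int k)\<^sup>2) * sqrt (1 + (of_int k)\<^sup>2) * cmod (fhat f k))"
      by (intro mult_left_mono mult_right_mono kle) auto
    also have "\<dots> = 2 * pi * cmod (weighted_coeff 2 f k)"
      by (simp add: cmod_weighted_coeff_2 add_nonneg_nonneg)
    finally show ?thesis .
  qed
  note lw = l2_comparison[OF l2_weighted_coeff[OF f] wle]
  have d: "abs_summable d"
    by (rule weighted_l2_imp_abs_summable(1)[OF lw(1)]) (simp add: w_def norm_mult)
  have kd: "abs_summable (\<lambda>k. of_int k * fhat f k)"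
    using summable_on_cmult_right[OF d, of "1 / (2 * pi)"] by (simp add: d_def norm_mult)
  have vd: "((\<lambda>x. complex_of_real (f x)) has_vector_derivative fourier_sum d x) (at x)" for x
    using fourier_sum_has_vector_derivative[OF sobolev_1_abs_summable(1)[OF f1] kd, of x]
    unfolding d_def ext[OF sobolev_1_fourier_sum[OF f1]] .
  have re: "(f has_real_derivative Re (fourier_sum d x)) (at x)" for x
    using bounded_linear.has_vector_derivative[OF bounded_linear_Re vd[of x]]
    by (simp add: has_real_derivative_iff_has_vector_derivative)
  have im: "Im (fourier_sum d x) = 0" for x
    using vector_derivative_unique_at[OF bounded_linear.has_vector_derivative[OF bounded_linear_Im vd[of x]], of 0]
    by simp
  have de: "deriv f x = Re (fourier_sum d x)" for x
    using re by (rule DERIV_imp_deriv)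
  show DD: "(f has_real_derivative deriv f x) (at x)" for x using re by (simp add: de)
  show dc: "continuous_on UNIV (deriv f)"
    unfolding de[abs_def] by (intro continuous_intros continuous_on_fourier_sum d)
  have "periodic1 f" using sobolevD(1)[OF f] by (simp add: periodic1_def)
  then show fd: "fhat (deriv f) k = 2 * pi * \<i> * of_int k * fhat f k" for k
    using fhat_deriv[OF DD dc] by blast
  have ww: "cmod (weighted_coeff 1 (deriv f) k) = cmod (w k)" for k
    by (simp add: cmod_weighted_coeff_1 w_def norm_mult fd d_def)
  have "continuous_on UNIV (\<lambda>x. (deriv f x)\<^sup>2)" by (intro continuous_intros dc)
  moreover have "l2 (weighted_coeff 1 (deriv f))" using lw(1) unfolding l2_def ww .
  moreover have "deriv f \<in> borel_measurable borel" by (rule borel_measurable_continuous_onI[OF dc])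
  moreover have "deriv f (x + 1) = deriv f x" for x by (simp add: de fourier_sum_periodic)
  ultimately show "deriv f \<in> sobolev 1"
    unfolding sobolev_def periodic1_def l2_def cmod_weighted_coeff_square
    by (simp add: dc continuous_set_integrable)
  show "sobolev_norm 1 (deriv f) \<le> 2 * pi * sobolev_norm 2 f"
    using lw(2) unfolding sobolev_norm_eq l2_norm_def ww by simp
qed

text \<open>Together with its analogue for \<open>C1_sobolev\<close>, this reduces the regularity
  index to the lowest case s = 2.\<close>

lemma C0_sobolev_mono:
  assumes "C0_sobolev s T v" "r \<le> s" shows "C0_sobolev r T v"
  unfolding C0_sobolev_def
proof (intro conjI ballI)
  have v: "\<And>t. t \<in> time_interval T \<Longrightarrow> v t \<in> sobolev s"
    and lim: "\<And>t. t \<in> time_interval T \<Longrightarrow>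
      ((\<lambda>\<tau>. sobolev_norm s (\<lambda>x. v \<tau> x - v t x)) \<longlongrightarrow> 0) (at t within time_interval T)"
    using assms(1) unfolding C0_sobolev_def by auto
  fix t assume t: "t \<in> time_interval T"
  show "v t \<in> sobolev r" using sobolev_mono(1)[OF v[OF t] assms(2)] .
  show "((\<lambda>\<tau>. sobolev_norm r (\<lambda>x. v \<tau> x - v t x)) \<longlongrightarrow> 0) (at t within time_interval T)"
    by (rule Lim_null_comparison[OF _ lim[OF t]])
       (auto simp: eventually_at_filter intro!: always_eventually sobolev_mono(2)[OF _ assms(2)] sobolev_diff v t)
qed

lemma C1_sobolev_mono:
  assumes "C1_sobolev s T v v'" "r \<le> s" shows "C1_sobolev r T v v'"
  unfolding C1_sobolev_def
proof (intro conjI ballI)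
  have v: "\<And>t. t \<in> time_interval T \<Longrightarrow> v t \<in> sobolev s" and v': "\<And>t. t \<in> time_interval T \<Longrightarrow> v' t \<in> sobolev s"
    and lim: "\<And>t. t \<in> time_interval T \<Longrightarrow>
      ((\<lambda>\<tau>. sobolev_norm s (\<lambda>x. (v \<tau> x - v t x) / (\<tau> - t) - v' t x)) \<longlongrightarrow> 0) (at t within time_interval T)"
    using assms(1) unfolding C1_sobolev_def C0_sobolev_def by auto
  show "C0_sobolev r T v" "C0_sobolev r T v'"
    using C0_sobolev_mono[OF _ assms(2)] assms(1) unfolding C1_sobolev_def by auto
  fix t assume t: "t \<in> time_interval T"
  have "(\<lambda>x. (v \<tau> x - v t x) / (\<tau> - t) - v' t x) \<in> sobolev s" if "\<tau> \<in> time_interval T" for \<tau>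
    using sobolev_diff[OF sobolev_cmult[OF sobolev_diff[OF v[OF that] v[OF t]], of "1 / (\<tau> - t)"] v'[OF t]] by simp
  then show "((\<lambda>\<tau>. sobolev_norm r (\<lambda>x. (v \<tau> x - v t x) / (\<tau> - t) - v' t x)) \<longlongrightarrow> 0) (at t within time_interval T)"
    by (intro Lim_null_comparison[OF _ lim[OF t]])
       (auto simp: eventually_at_filter intro!: always_eventually sobolev_mono(2)[OF _ assms(2)])
qed

section \<open>Weak derivatives on the Fourier side\<close>

text \<open>The test functions are real, so the character is split into cosine and sine and each
  part is tested separately.\<close>

lemma has_weak_deriv_fhat:
  assumes "has_weak_deriv f g" shows "fhat g k = 2 * pi * \<i> * of_int k * fhat f k"
proof -
  have int: "set_integrable lborel {0..1} f" "set_integrable lborel {0..1} g"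
    and test: "\<And>\<phi> \<phi>'. periodic1 \<phi> \<Longrightarrow> (\<And>x. (\<phi> has_real_derivative \<phi>' x) (at x)) \<Longrightarrow> continuous_on UNIV \<phi>' \<Longrightarrow>
          (LBINT x:{0..1}. f x * \<phi>' x) = - (LBINT x:{0..1}. g x * \<phi> x)"
    using assms unfolding has_weak_deriv_def by auto
  let ?K = "2 * pi * of_int k"
  have per: "cos (?K * (x + 1)) = cos (?K * x)" "sin (?K * (x + 1)) = sin (?K * x)" for x
    using arg_cong[OF chi_periodic[of k x], of Re] arg_cong[OF chi_periodic[of k x], of Im] by (simp_all add: chi_def)
  have fc: "fhat h k = of_real (LBINT x:{0..1}. h x * cos (?K * x)) - \<i> * of_real (LBINT x:{0..1}. h x * sin (?K * x))"
    if h: "set_integrable lborel {0..1} h" for h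
  proof -
    have hc: "set_integrable lborel {0..1} (\<lambda>x. h x * cos (?K * x))" "set_integrable lborel {0..1} (\<lambda>x. h x * sin (?K * x))"
      unfolding mult.commute[of "h _"]
      by (intro set_integrable_mult_bounded[OF h] continuous_intros)+
    have hcc: "set_integrable lborel {0..1} (\<lambda>x. complex_of_real (h x * cos (?K * x)))" "set_integrable lborel {0..1} (\<lambda>x. complex_of_real (h x * sin (?K * x)))"
      by (intro set_integrable_of_real hc)+
    have "fhat h k = (LBINT x:{0..1}. complex_of_real (h x * cos (?K * x)) - \<i> * complex_of_real (h x * sin (?K * x)))"
      unfolding fourier_coeff_eq_cfourier cfourier_def chi_def
      by (intro arg_cong[where f = "set_lebesgue_integral lborel {0..1}"] ext) (simp add: complex_eq_iff)
    also have "\<dots> = (LBINT x:{0..1}. complex_of_real (h x * cos (?K * x))) - \<i> * (LBINT x:{0..1}. complex_of_real (h x * sin (?K * x)))"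
      using hcc by (subst set_integral_diff(2)) auto
    finally show ?thesis by (simp only: set_integral_complex_of_real)
  qed
  have c: "(LBINT x:{0..1}. f x * (- ?K * sin (?K * x))) = - (LBINT x:{0..1}. g x * cos (?K * x))"
    by (intro test) (auto simp: periodic1_def per intro!: derivative_eq_intros continuous_intros)
  have s: "(LBINT x:{0..1}. f x * (?K * cos (?K * x))) = - (LBINT x:{0..1}. g x * sin (?K * x))"
    by (intro test) (auto simp: periodic1_def per intro!: derivative_eq_intros continuous_intros)
  have "(LBINT x:{0..1}. f x * (- ?K * sin (?K * x))) = - ?K * (LBINT x:{0..1}. f x * sin (?K * x))"
    by (subst set_integral_mult_right[symmetric]) (simp only: mult_ac)
  with c have c': "(LBINT x:{0..1}. g x * cos (?K * x)) = ?K * (LBINT x:{0..1}. f x * sin (?K * x))" by simp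
  have "(LBINT x:{0..1}. f x * (?K * cos (?K * x))) = ?K * (LBINT x:{0..1}. f x * cos (?K * x))"
    by (subst set_integral_mult_right[symmetric]) (simp only: mult_ac)
  with s have s': "(LBINT x:{0..1}. g x * sin (?K * x)) = - (?K * (LBINT x:{0..1}. f x * cos (?K * x)))" by simp
  show ?thesis
    unfolding fc[OF int(1)] fc[OF int(2)] c' s' by (simp add: complex_eq_iff)
qed

text \<open>If \<phi> is a test function, then so is U \<phi>, since \<open>U\<close> is periodic
  and continuously differentiable; testing \<open>f\<close> with it gives the product rule.\<close>

lemma has_weak_deriv_mult:
  assumes w: "has_weak_deriv f g" and U: "\<And>x. (U has_real_derivative U' x) (at x)"
    and U': "continuous_on UNIV U'" and per: "periodic1 U" "periodic1 U'"
  shows "has_weak_deriv (\<lambda>x. U x * f x) (\<lambda>x. U x * g x + U' x * f x)"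
proof -
  have int: "set_integrable lborel {0..1} f" "set_integrable lborel {0..1} g"
    and meas [measurable]: "f \<in> borel_measurable borel" "g \<in> borel_measurable borel"
    and pfg: "periodic1 f" "periodic1 g"
    and test: "\<And>\<phi> \<phi>'. periodic1 \<phi> \<Longrightarrow> (\<And>x. (\<phi> has_real_derivative \<phi>' x) (at x)) \<Longrightarrow> continuous_on UNIV \<phi>' \<Longrightarrow>
          (LBINT x:{0..1}. f x * \<phi>' x) = - (LBINT x:{0..1}. g x * \<phi> x)"
    using w unfolding has_weak_deriv_def by auto
  have Uc: "continuous_on UNIV U"
    using U by (meson DERIV_isCont continuous_at_imp_continuous_on)
  have [measurable]: "U \<in> borel_measurable borel" "U' \<in> borel_measurable borel"
    using Uc U' by (auto intro: borel_measurable_continuous_onI)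
  have key: "(LBINT x:{0..1}. U x * f x * \<phi>' x) = - (LBINT x:{0..1}. (U x * g x + U' x * f x) * \<phi> x)"
    if \<phi>: "periodic1 \<phi>" "\<And>x. (\<phi> has_real_derivative \<phi>' x) (at x)" "continuous_on UNIV \<phi>'" for \<phi> \<phi>'
  proof -
    have \<phi>c: "continuous_on UNIV \<phi>"
      using \<phi>(2) by (meson DERIV_isCont continuous_at_imp_continuous_on)
    have t: "(LBINT x:{0..1}. f x * (U' x * \<phi> x + \<phi>' x * U x)) = - (LBINT x:{0..1}. g x * (U x * \<phi> x))"
      using \<phi> per by (intro test DERIV_mult U continuous_intros U' Uc \<phi>c) (auto simp: periodic1_def)
    note mi = set_integrable_mult_bounded[OF int(1)] set_integrable_mult_bounded[OF int(2)]
    have i1: "set_integrable lborel {0..1} (\<lambda>x. (U' x * \<phi> x) * f x)" "set_integrable lborel {0..1} (\<lambda>x. (\<phi>' x * U x) * f x)"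
      "set_integrable lborel {0..1} (\<lambda>x. (U x * \<phi> x) * g x)"
      by (intro mi continuous_intros U' Uc \<phi>c \<phi>)+
    have "(LBINT x:{0..1}. f x * (U' x * \<phi> x + \<phi>' x * U x)) = (LBINT x:{0..1}. (U' x * \<phi> x) * f x + (\<phi>' x * U x) * f x)"
      by (simp add: algebra_simps)
    also have "\<dots> = (LBINT x:{0..1}. (U' x * \<phi> x) * f x) + (LBINT x:{0..1}. (\<phi>' x * U x) * f x)"
      by (rule set_integral_add(2)[OF i1(1,2)])
    finally have 1: "(LBINT x:{0..1}. (U' x * \<phi> x) * f x) + (LBINT x:{0..1}. (\<phi>' x * U x) * f x) = - (LBINT x:{0..1}. (U x * \<phi> x) * g x)"
      using t by (simp add: mult_ac)
    have "(LBINT x:{0..1}. (U x * g x + U' x * f x) * \<phi> x) = (LBINT x:{0..1}. (U x * \<phi> x) * g x + (U' x * \<phi> x) * f x)"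
      by (simp add: algebra_simps)
    also have "\<dots> = (LBINT x:{0..1}. (U x * \<phi> x) * g x) + (LBINT x:{0..1}. (U' x * \<phi> x) * f x)"
      by (rule set_integral_add(2)[OF i1(3,1)])
    finally show ?thesis using 1 by (simp add: mult_ac)
  qed
  have "set_integrable lborel {0..1} (\<lambda>x. U x * f x)" "set_integrable lborel {0..1} (\<lambda>x. U x * g x + U' x * f x)"
    by (intro set_integrable_mult_bounded Uc int,
        rule set_integral_add(1)[OF set_integrable_mult_bounded[OF int(2) Uc] set_integrable_mult_bounded[OF int(1) U']])
  moreover have "periodic1 (\<lambda>x. U x * f x)" "periodic1 (\<lambda>x. U x * g x + U' x * f x)"
    using pfg per by (auto simp: periodic1_def)
  ultimately show ?thesis
    unfolding has_weak_deriv_def by (intro conjI allI impI key) auto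
qed

section \<open>Trigonometric polynomials and Bessel's inequality\<close>

lemma cfourier_trig_poly:
  assumes "finite X" shows "cfourier (\<lambda>x. \<Sum>j\<in>X. c j * chi j x) k = (if k \<in> X then c k else 0)"
proof -
  have "cfourier (\<lambda>x. \<Sum>j\<in>X. c j * chi j x) k = (\<Sum>j\<in>X. c j * cfourier (chi (- k)) (- j))"
    unfolding cfourier_def[of "\<lambda>x. \<Sum>j\<in>X. c j * chi j x"] by (intro trig_poly_pairing continuous_set_integrable continuous_on_chi)
  also have "\<dots> = (\<Sum>j\<in>X. if k = j then c j else 0)"
    by (intro sum.cong) (auto simp: cfourier_chi)
  finally show ?thesis using assms by (simp add: sum.delta)
qed

lemma cfourier_cnj: "cfourier (\<lambda>x. cnj (h x)) k = cnj (cfourier h (- k))"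
proof -
  have "cnj (cfourier h (- k)) = (LBINT x. cnj (indicator {0..1} x *\<^sub>R (h x * chi k x)))"
    unfolding cfourier_def set_lebesgue_integral_def minus_minus by (rule Bochner_Integration.integral_cnj[symmetric])
  also have "\<dots> = cfourier (\<lambda>x. cnj (h x)) k"
    unfolding cfourier_def set_lebesgue_integral_def by (simp add: cnj_chi scaleR_conv_of_real)
  finally show ?thesis by simp
qed

lemma fhat_cnj: "cnj (fhat f k) = fhat f (- k)"
  using cfourier_cnj[of "\<lambda>x. of_real (f x)" "- k"] by (simp add: fourier_coeff_eq_cfourier)

lemma trig_poly_parseval:
  assumes "finite X"
  shows "(LBINT x:{0..1}. (cmod (\<Sum>k\<in>X. c k * chi k x))\<^sup>2) = (\<Sum>k\<in>X. (cmod (c k))\<^sup>2)"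
proof -
  let ?S = "\<lambda>x. \<Sum>k\<in>X. c k * chi k x"
  have "of_real (LBINT x:{0..1}. (cmod (?S x))\<^sup>2) = (LBINT x:{0..1}. ?S x * cnj (?S x))"
    unfolding set_integral_complex_of_real[symmetric] complex_norm_square by simp
  also have "\<dots> = (\<Sum>k\<in>X. c k * cfourier (\<lambda>x. cnj (?S x)) (- k))"
    by (intro trig_poly_pairing continuous_set_integrable continuous_intros)
  also have "\<dots> = (\<Sum>k\<in>X. c k * cnj (c k))"
    unfolding cfourier_cnj using assms by (intro sum.cong refl) (simp add: cfourier_trig_poly)
  also have "\<dots> = of_real (\<Sum>k\<in>X. (cmod (c k))\<^sup>2)"
    by (simp only: of_real_sum complex_norm_square)
  finally show ?thesis by (simp only: of_real_eq_iff)
qed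

text \<open>For a partial sum S, the square sum N of its coefficients is both the integral of |S|^2
  and that of S times the conjugate of g. The bound 2 |S| |g| \<le> |S|^2 + |g|^2 then lets half of
  N be absorbed on the left.\<close>

lemma bessel:
  assumes g: "continuous_on UNIV g" shows "l2 (cfourier g)"
  unfolding l2_def
proof (intro nonneg_bdd_above_summable_on bdd_aboveI2)
  fix X :: "int set" assume "X \<in> {F. F \<subseteq> UNIV \<and> finite F}"
  then have X: "finite X" by simp
  let ?S = "\<lambda>x. \<Sum>k\<in>X. cfourier g k * chi k x"
  define N where "N = (\<Sum>k\<in>X. (cmod (cfourier g k))\<^sup>2)"
  have Sc: "continuous_on UNIV ?S" by (intro continuous_intros)
  have "of_real N = (\<Sum>k\<in>X. cfourier g k * cfourier (\<lambda>x. cnj (g x)) (- k))"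
    unfolding N_def of_real_sum complex_norm_square cfourier_cnj by simp
  also have "\<dots> = (LBINT x:{0..1}. ?S x * cnj (g x))"
    by (rule trig_poly_pairing[symmetric]) (intro continuous_set_integrable continuous_intros g)
  finally have "cmod (of_real N) = cmod (LBINT x:{0..1}. ?S x * cnj (g x))" by (rule arg_cong)
  also have "\<dots> \<le> (LBINT x:{0..1}. ((cmod (?S x))\<^sup>2 + (cmod (g x))\<^sup>2) / 2)"
  proof (rule set_integral_norm_le)
    show "cmod (?S x * cnj (g x)) \<le> ((cmod (?S x))\<^sup>2 + (cmod (g x))\<^sup>2) / 2" for x
      using zero_le_power2[of "cmod (?S x) - cmod (g x)"]
      unfolding norm_mult complex_mod_cnj by (simp add: power2_eq_square algebra_simps)
  qed (intro continuous_set_integrable continuous_intros Sc g | simp)+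
  also have "\<dots> = (N + (LBINT x:{0..1}. (cmod (g x))\<^sup>2)) / 2"
    unfolding N_def trig_poly_parseval[OF X, symmetric]
    by (simp add: set_integral_add(2)[OF continuous_set_integrable continuous_set_integrable] continuous_intros Sc g)
  finally show "N \<le> (LBINT x:{0..1}. (cmod (g x))\<^sup>2)"
    by (simp add: N_def[symmetric])
qed auto

section \<open>Inverting the nonlocal operator\<close>

text \<open>Zero mean over the period is what makes an antiderivative periodic; the free constant is
  spent on prescribing its mean \<open>m\<close>.\<close>

lemma periodic_antiderivative:
  fixes g :: "real \<Rightarrow> real"
  assumes g: "continuous_on UNIV g" "periodic1 g" "(LBINT x:{0..1}. g x) = 0"
  obtains G where "\<And>x. (G has_real_derivative g x) (at x)" "periodic1 G" "(LBINT x:{0..1}. G x) = m"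
proof -
  obtain F where F: "\<And>x. (F has_vector_derivative g x) (at x)"
    using einterval_antiderivative[of "-\<infinity>" "\<infinity>" g] g(1) by (auto simp: continuous_on_eq_continuous_at)
  have Fr: "(F has_real_derivative g x) (at x)" for x
    using F by (simp add: has_real_derivative_iff_has_vector_derivative)
  have Fc: "continuous_on UNIV F"
    using Fr by (meson DERIV_isCont continuous_at_imp_continuous_on)
  have "F 1 - F 0 = 0" using set_integral_FTC[OF F g(1), of 0 1] g(3) by simp
  moreover have "F (x + 1) - F x = F (0 + 1) - F 0" for x
  proof (rule DERIV_isconst_all[where f = "\<lambda>x. F (x + 1) - F x"])
    show "\<forall>x. ((\<lambda>x. F (x + 1) - F x) has_real_derivative 0) (at x)"
    proof
      fix x
      have "((\<lambda>x. F (x + 1)) has_real_derivative g (x + 1)) (at x)"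
        by (rule DERIV_shift[THEN iffD1, OF Fr])
      from DERIV_diff[OF this Fr[of x]] show "((\<lambda>x. F (x + 1) - F x) has_real_derivative 0) (at x)"
        using g(2) by (simp add: periodic1_def)
    qed
  qed
  ultimately have per: "F (x + 1) = F x" for x by simp
  define I where "I = (LBINT x:{0..1}. F x)"
  show ?thesis
  proof (rule that[of "\<lambda>x. F x + (m - I)"])
    show "((\<lambda>x. F x + (m - I)) has_real_derivative g x) (at x)" for x
      using Fr by (auto intro!: derivative_eq_intros)
    show "periodic1 (\<lambda>x. F x + (m - I))" using per by (simp add: periodic1_def)
    show "(LBINT x:{0..1}. F x + (m - I)) = m"
      using set_integral_add(2)[OF continuous_set_integrable[OF Fc] continuous_set_integrable[OF continuous_on_const[of UNIV "m - I"]], of 0 1]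
      by (simp add: I_def[symmetric]) (simp add: set_lebesgue_integral_def)
  qed
qed

lemma has_weak_deriv_classical:
  assumes "\<And>x. (f has_real_derivative g x) (at x)" "continuous_on UNIV g" "periodic1 f" "periodic1 g"
  shows "has_weak_deriv f g"
proof -
  have fc: "continuous_on UNIV f"
    using assms(1) by (meson DERIV_isCont continuous_at_imp_continuous_on)
  have "(LBINT x:{0..1}. f x * \<phi>' x) = - (LBINT x:{0..1}. g x * \<phi> x)"
    if \<phi>: "periodic1 \<phi>" "\<forall>x. (\<phi> has_real_derivative \<phi>' x) (at x)" "continuous_on UNIV \<phi>'" for \<phi> \<phi>'
  proof -
    have \<phi>c: "continuous_on UNIV \<phi>"
      using \<phi>(2) by (meson DERIV_isCont continuous_at_imp_continuous_on)
    have "(LBINT x:{0..1}. g x * \<phi> x + \<phi>' x * f x) = f 1 * \<phi> 1 - f 0 * \<phi> 0"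
      using \<phi>(2) assms(1) unfolding has_real_derivative_iff_has_vector_derivative[symmetric]
      by (intro set_integral_FTC[where F = "\<lambda>x. f x * \<phi> x"] continuous_intros assms fc \<phi> \<phi>c)
         (auto simp: has_real_derivative_iff_has_vector_derivative[symmetric] intro!: DERIV_mult)
    also have "\<dots> = 0" using \<phi>(1) assms(3) unfolding periodic1_def by (metis add_0 diff_self)
    also have "(LBINT x:{0..1}. g x * \<phi> x + \<phi>' x * f x) = (LBINT x:{0..1}. g x * \<phi> x) + (LBINT x:{0..1}. \<phi>' x * f x)"
      by (intro set_integral_add(2) continuous_set_integrable continuous_intros assms fc \<phi> \<phi>c)
    finally show ?thesis by (simp add: mult.commute)
  qed
  then show ?thesis
    using assms fc unfolding has_weak_deriv_def
    by (auto intro: continuous_set_integrable borel_measurable_continuous_onI)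
qed

lemma circle_mean_fhat: "of_real (circle_mean f) = fhat f 0"
  by (simp add: circle_mean_def fourier_coeff_eq_cfourier cfourier_def set_integral_complex_of_real)

lemma fhat_const_diff:
  assumes "continuous_on UNIV f"
  shows "fhat (\<lambda>x. m - f x) k = (if k = 0 then of_real m else 0) - fhat f k"
proof -
  have "fhat (\<lambda>x. m) k = (if k = 0 then of_real m else 0)"
    using cfourier_cmult[of "of_real m" "\<lambda>_. 1" k] cfourier_chi[of 0 k]
    by (auto simp: fourier_coeff_eq_cfourier chi_0[abs_def])
  then show ?thesis
    using assms by (subst fourier_coeff_diff) (auto intro!: continuous_set_integrable continuous_intros)
qed

text \<open>For continuous \<open>f\<close> the inverse is classical:
  \<open>circle_mean f - f x\<close> is integrated twice. The first antiderivative gets mean 0, so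
  that the second is periodic too; the second gets mean \<open>circle_mean f\<close>, as taking
  means in the equation forces. The bulk of the proof shows that the result satisfies the definite
  description, uniqueness included.\<close>

lemma mu_dxx_inv_deriv:
  assumes f: "continuous_on UNIV f" "periodic1 f"
  obtains w where "\<And>x. (w has_real_derivative deriv (mu_dxx_inv f) x) (at x)" "periodic1 w"
    "\<And>x. (deriv (mu_dxx_inv f) has_real_derivative circle_mean f - f x) (at x)"
    "periodic1 (deriv (mu_dxx_inv f))"
proof -
  let ?m = "circle_mean f"
  define g where "g = (\<lambda>x. ?m - f x)"
  have gc: "continuous_on UNIV g" unfolding g_def by (intro continuous_intros f)
  have gp: "periodic1 g" using f(2) by (simp add: g_def periodic1_def)
  have gm: "(LBINT x:{0..1}. g x) = 0"
    unfolding g_def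
    by (subst set_integral_diff(2)) (auto intro!: continuous_set_integrable continuous_intros f simp: circle_mean_def, simp add: set_lebesgue_integral_def)
  obtain G where G: "\<And>x. (G has_real_derivative g x) (at x)" "periodic1 G" "(LBINT x:{0..1}. G x) = 0"
    using periodic_antiderivative[OF gc gp gm] by metis
  have Gc: "continuous_on UNIV G"
    using G(1) by (meson DERIV_isCont continuous_at_imp_continuous_on)
  obtain w where w: "\<And>x. (w has_real_derivative G x) (at x)" "periodic1 w" "(LBINT x:{0..1}. w x) = ?m"
    using periodic_antiderivative[OF Gc G(2,3)] by metis
  have wc: "continuous_on UNIV w"
    using w(1) by (meson DERIV_isCont continuous_at_imp_continuous_on)
  have dw: "deriv w = G" using w(1) by (auto intro!: ext DERIV_imp_deriv)
  have gh: "fhat g k = - (of_real (4 * pi\<^sup>2 * (of_int k)\<^sup>2) * fhat w k)" for k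
    unfolding fhat_deriv[OF G(1) gc G(2)] fhat_deriv[OF w(1) Gc w(2)]
    by (simp add: power2_eq_square algebra_simps)
  have "l2 (fhat g)"
    using bessel[of "\<lambda>x. of_real (g x)"] gc fourier_coeff_eq_cfourier[of g, abs_def] by (simp add: l2_def fourier_coeff_eq_cfourier continuous_intros)
  \<comment> \<open>The coefficients of \<open>g\<close> control those of \<open>w\<close> except at
    index 0, which is added as a one-point sequence.\<close>
  have pt: "l2 (\<lambda>k. if k = 0 then fhat w 0 else 0)"
    unfolding l2_def by (subst summable_on_cong_neutral[where T = "{0}" and g = "\<lambda>k. (cmod (fhat w 0))\<^sup>2"]) auto
  have "cmod (weighted_coeff 2 w k) \<le> 1 * cmod (fhat g k + (if k = 0 then fhat w 0 else 0))" for k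
  proof (cases "k = 0")
    case True then show ?thesis by (simp add: gh cmod_weighted_coeff_2)
  next
    case False
    then have "1 \<le> \<bar>of_int k :: real\<bar>" by linarith
    then have k1: "1 \<le> (real_of_int k)\<^sup>2" by (simp add: abs_le_square_iff[of 1 "real_of_int k", simplified])
    have "1 \<le> pi" using pi_gt3 by simp
    then have "1 * 1 \<le> pi * pi" by (intro mult_mono) auto
    then have "4 * (real_of_int k)\<^sup>2 * 1 \<le> 4 * (real_of_int k)\<^sup>2 * (pi * pi)" by (intro mult_left_mono) auto
    then have "1 + (real_of_int k)\<^sup>2 \<le> 4 * pi\<^sup>2 * (of_int k)\<^sup>2"
      using k1 by (simp add: power2_eq_square mult_ac)
    then have "(1 + (real_of_int k)\<^sup>2) * cmod (fhat w k) \<le> (4 * pi\<^sup>2 * (of_int k)\<^sup>2) * cmod (fhat w k)"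
      by (intro mult_right_mono) auto
    then show ?thesis using False unfolding gh cmod_weighted_coeff_2 by (simp add: norm_mult norm_power)
  qed
  from l2_comparison(1)[OF l2_add(1)[OF \<open>l2 (fhat g)\<close> pt] this] have "l2 (weighted_coeff 2 w)" .
  moreover have "set_integrable lborel {0..1} (\<lambda>x. (w x)\<^sup>2)"
    by (intro continuous_set_integrable continuous_intros wc)
  ultimately have w2: "w \<in> sobolev 2"
    using w(2) wc unfolding sobolev_def l2_def cmod_weighted_coeff_square
    by (auto intro: borel_measurable_continuous_onI)
  have mw: "circle_mean w = ?m" using w(3) by (simp add: circle_mean_def)
  have "mu_dxx_inv f = w"
    unfolding mu_dxx_inv_def
  proof (rule the_equality)
    show "w \<in> sobolev 2 \<and> (\<exists>w\<^sub>x\<^sub>x. has_weak_deriv (deriv w) w\<^sub>x\<^sub>x \<and> (AE x in lborel. circle_mean w - w\<^sub>x\<^sub>x x = f x))"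
      using w2 has_weak_deriv_classical[OF G(1) gc G(2) gp] by (auto simp: dw mw g_def intro!: exI[of _ g])
    \<comment> \<open>The equation fixes every nonzero-index coefficient of a candidate. At index 0
      the second derivative contributes nothing, and what remains determines the mean.\<close>
    fix w' assume "w' \<in> sobolev 2 \<and> (\<exists>w\<^sub>x\<^sub>x. has_weak_deriv (deriv w') w\<^sub>x\<^sub>x \<and> (AE x in lborel. circle_mean w' - w\<^sub>x\<^sub>x x = f x))"
    then obtain h where w': "w' \<in> sobolev 2" and h: "has_weak_deriv (deriv w') h"
      and ae: "AE x in lborel. circle_mean w' - h x = f x" by blast
    have hi: "set_integrable lborel {0..1} h" and hm [measurable]: "h \<in> borel_measurable borel"
      using h unfolding has_weak_deriv_def by auto
    have [measurable]: "f \<in> borel_measurable borel" by (rule borel_measurable_continuous_onI[OF f(1)])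
    let ?m' = "circle_mean w'"
    have "fhat h k = fhat (\<lambda>x. ?m' - f x) k" for k
      unfolding fourier_coeff_eq_cfourier cfourier_def
    proof (rule set_lebesgue_integral_cong_AE)
      show "AE x\<in>{0..1} in lborel. complex_of_real (h x) * chi (- k) x = complex_of_real (?m' - f x) * chi (- k) x"
        using ae
      proof eventually_elim
        case (elim x)
        then have hx: "h x = ?m' - f x" by simp
        show ?case unfolding hx by simp
      qed
    qed measurable
    then have hh: "(if k = 0 then of_real ?m' else 0) - fhat f k = - (of_real (4 * pi\<^sup>2 * (of_int k)\<^sup>2) * fhat w' k)" for k
      using has_weak_deriv_fhat[OF h, of k] sobolev_2_deriv(4)[OF w', of k] fhat_const_diff[OF f(1), of ?m' k]
      by (simp add: power2_eq_square algebra_simps)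
    have gh': "(if k = 0 then of_real ?m else 0) - fhat f k = - (of_real (4 * pi\<^sup>2 * (of_int k)\<^sup>2) * fhat w k)" for k
      using gh[of k] fhat_const_diff[OF f(1), of ?m k] by (simp add: g_def)
    have "?m' = ?m" 
    proof -
      have "complex_of_real ?m' = of_real ?m" using hh[of 0] gh'[of 0] by simp
      then show ?thesis by (simp only: of_real_eq_iff)
    qed
    have eq: "fhat w' k = fhat w k" for k
    proof (cases "k = 0")
      case True
      then show ?thesis using \<open>?m' = ?m\<close> mw by (simp add: circle_mean_fhat[symmetric])
    next
      case False
      then show ?thesis using hh[of k] gh'[of k] by simp
    qed
    show "w' = w"
    proof
      fix x
      have 1: "v \<in> sobolev 2 \<Longrightarrow> v \<in> sobolev 1" for v by (rule sobolev_mono(1)[of _ 2]) auto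
      have "complex_of_real (w' x) = of_real (w x)"
        using sobolev_1_fourier_sum[OF 1[OF w'], of x] sobolev_1_fourier_sum[OF 1[OF w2], of x] eq by (simp add: fourier_sum_def)
      then show "w' x = w x" by (simp only: of_real_eq_iff)
    qed
  qed
  then show ?thesis using that[of w] w G by (simp add: dw g_def)
qed

section \<open>Parseval pairings and the transport term\<close>

text \<open>Only \<open>f\<close> needs an absolutely convergent series. Since \<open>g\<close> is
  real, its coefficient at \<open>- k\<close> is the conjugate of that at \<open>k\<close>, which
  brings the pairing into this form.\<close>

lemma fhat_pairing:
  assumes f: "f \<in> sobolev 1" and g: "set_integrable lborel {0..1} g"
  shows "((\<lambda>k. cnj (fhat f k) * fhat g k) has_sum of_real (LBINT x:{0..1}. f x * g x)) UNIV"
proof -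
  have "((\<lambda>k. fhat f k * cfourier (\<lambda>x. of_real (g x)) (- k)) has_sum (LBINT x:{0..1}. of_real (f x * g x))) UNIV"
    using fourier_sum_pairing[OF sobolev_1_abs_summable(1)[OF f] set_integrable_of_real[OF g]] by (simp add: sobolev_1_fourier_sum[OF f])
  then have "((\<lambda>k. cnj (fhat f k * fhat g (- k))) has_sum cnj (of_real (LBINT x:{0..1}. f x * g x))) UNIV"
    unfolding has_sum_cnj_iff by (simp only: fourier_coeff_eq_cfourier[symmetric] set_integral_complex_of_real)
  then show ?thesis by (simp add: fhat_cnj[of g])
qed

lemma sobolev_1_parseval:
  assumes f: "f \<in> sobolev 1"
  shows "(l2_norm (fhat f))\<^sup>2 = (LBINT x:{0..1}. (f x)\<^sup>2)"
proof -
  have "((\<lambda>k. cnj (fhat f k) * fhat f k) has_sum of_real (LBINT x:{0..1}. f x * f x)) UNIV"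
    by (rule fhat_pairing[OF f sobolev_integrable(1)[OF f]])
  then have "((\<lambda>k. (cmod (fhat f k))\<^sup>2) has_sum (LBINT x:{0..1}. (f x)\<^sup>2)) UNIV"
    using has_sum_Re by (fastforce simp: mult.commute[of "cnj _"] complex_norm_square[symmetric] power2_eq_square)
  then show ?thesis unfolding l2_norm_square by (rule infsumI)
qed

text \<open>
  Formally this is the integration by parts \<open>\<integral> f (U f)\<^sub>x = 1/2 \<integral> U\<^sub>x f\<^sup>2\<close>.  As \<open>f\<close> is only of class
  \<open>H\<^sup>1\<close>, it is carried out for the partial sums of the Fourier series of \<open>f\<close>.
\<close>

lemma transport_pairing:
  assumes f: "f \<in> sobolev 1" and U: "\<And>x. (U has_real_derivative U' x) (at x)"
    and U': "continuous_on UNIV U'" and per: "periodic1 U"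
  shows "((\<lambda>k. cnj (fhat f k) * (2 * pi * \<i> * of_int k * fhat (\<lambda>x. U x * f x) k))
           has_sum of_real (1/2 * (LBINT x:{0..1}. U' x * (f x)\<^sup>2))) UNIV"
proof -
  have fc: "continuous_on UNIV f" using sobolevD(5)[OF f] by simp
  have Uc: "continuous_on UNIV U"
    using U by (meson DERIV_isCont continuous_at_imp_continuous_on)
  define c where "c = fhat f"
  define d where "d = (\<lambda>k. 2 * pi * \<i> * of_int k * c k)"
  have c: "abs_summable c" unfolding c_def by (rule sobolev_1_abs_summable(1)[OF f])
  have fs: "fourier_sum c x = of_real (f x)" for x unfolding c_def by (rule sobolev_1_fourier_sum[OF f])
  have "l2 d"
  proof (rule l2_comparison(1)[OF l2_weighted_coeff[OF f]])
    fix k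
    have "\<bar>real_of_int k\<bar> * cmod (c k) \<le> sqrt (1 + (of_int k)\<^sup>2) * cmod (c k)"
      by (intro mult_right_mono real_le_rsqrt) auto
    then show "cmod (d k) \<le> (2 * pi) * cmod (weighted_coeff 1 f k)"
      by (simp add: d_def cmod_weighted_coeff_1 norm_mult c_def)
  qed
  define L where "L = (\<Sum>\<^sub>\<infinity>k. (cmod (d k))\<^sup>2)"
  define A where "A = (\<Sum>\<^sub>\<infinity>k. cmod (c k))"
  have "bounded (U ` {0..1})" "bounded (U' ` {0..1})"
    by (auto intro!: compact_imp_bounded compact_continuous_image continuous_on_subset[OF Uc] continuous_on_subset[OF U'])
  then obtain M M' where M: "\<And>x. x \<in> {0..1} \<Longrightarrow> \<bar>U x\<bar> \<le> M" and M': "\<And>x. x \<in> {0..1} \<Longrightarrow> \<bar>U' x\<bar> \<le> M'"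
    unfolding bounded_iff by (metis imageI real_norm_def)
  have M0: "0 \<le> M" "0 \<le> M'" using M[of 0] M'[of 0] by auto
  define tail where "tail = (\<lambda>X. A - (\<Sum>k\<in>X. cmod (c k)))"
  define J where "J = (LBINT x:{0..1}. U' x * (f x)\<^sup>2)"
  \<comment> \<open>Up to sign and conjugation these are the terms of the claim; the index
    \<open>- k\<close> is the one produced by \<open>trig_poly_pairing\<close>. The final
    conjugation restores the stated form.\<close>
  define T where "T = (\<lambda>k. d k * cfourier (\<lambda>x. of_real (U x * f x)) (- k))"
  \<comment> \<open>Integration by parts is exact for the partial sum \<open>S\<close>. Replacing
    \<open>S\<close> by \<open>f\<close> next to \<open>S'\<close> costs little because f - S is
    uniformly small, of size \<open>tail X\<close>, while \<open>S'\<close> is bounded in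
    L^2.\<close>
  have est: "cmod (sum T X - of_real (- 1/2 * J)) \<le> tail X * (M * ((1 + L) / 2) + M' * A)" if X: "finite X" for X
  proof -
    define S where "S = (\<lambda>x. \<Sum>k\<in>X. c k * chi k x)"
    define S' where "S' = (\<lambda>x. \<Sum>k\<in>X. d k * chi k x)"
    have Sc: "continuous_on UNIV S" "continuous_on UNIV S'"
      unfolding S_def S'_def by (intro continuous_intros)+
    have dS: "(S has_vector_derivative S' x) (at x)" for x
      unfolding S_def S'_def
      by (intro has_vector_derivative_sum)
         (auto intro!: derivative_eq_intros has_vector_derivative_chi simp: d_def mult_ac)
    have Stail: "cmod (of_real (f x) - S x) \<le> tail X" for x
      using fourier_sum_tail[OF c X, of x] by (simp add: fs S_def tail_def A_def)
    have t0: "0 \<le> tail X" using Stail[of 0] norm_ge_zero order_trans by blast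
    have SA: "cmod (S x) \<le> A" for x
    proof -
      have "cmod (S x) \<le> (\<Sum>k\<in>X. cmod (c k))" unfolding S_def by (rule order_trans[OF norm_sum]) (simp add: norm_mult)
      also have "\<dots> \<le> A" unfolding A_def by (intro finite_sum_le_infsum c X) auto
      finally show ?thesis .
    qed
    have fA: "cmod (of_real (f x)) \<le> A" for x
      using norm_fourier_sum_le[OF c, of x] by (simp only: fs A_def)
    have A0: "0 \<le> A" using SA[of 0] norm_ge_zero order_trans by blast
    have dU: "((\<lambda>x. complex_of_real (U x)) has_vector_derivative of_real (U' x)) (at x)" for x
      using U by (rule has_vector_derivative_of_real)
    have S1: "S 1 = S 0" by (simp add: S_def)
    have U1: "U 1 = U 0" using per unfolding periodic1_def by (metis add_0)
    have "(LBINT x:{0..1}. of_real (U x) * (S x * S' x + S' x * S x) + of_real (U' x) * (S x * S x)) =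
        of_real (U 1) * (S 1 * S 1) - of_real (U 0) * (S 0 * S 0)"
      by (intro set_integral_FTC[where F = "\<lambda>x. of_real (U x) * (S x * S x)"] has_vector_derivative_mult dU dS continuous_intros Uc U' Sc) auto
    also have "\<dots> = 0" using S1 U1 by simp
    also have "(LBINT x:{0..1}. of_real (U x) * (S x * S' x + S' x * S x) + of_real (U' x) * (S x * S x))
        = (LBINT x:{0..1}. 2 * (S' x * (of_real (U x) * S x))) + (LBINT x:{0..1}. of_real (U' x) * (S x * S x))"
      by (subst set_integral_add(2)[symmetric]) (auto intro!: continuous_set_integrable continuous_intros Uc U' Sc simp: algebra_simps)
    finally have ibp: "(LBINT x:{0..1}. S' x * (of_real (U x) * S x)) = - 1/2 * (LBINT x:{0..1}. of_real (U' x) * (S x * S x))"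
      by (simp add: add_eq_0_iff)
    have TX: "sum T X = (LBINT x:{0..1}. S' x * of_real (U x * f x))"
      unfolding T_def S'_def
      by (rule trig_poly_pairing[symmetric]) (intro continuous_set_integrable continuous_intros Uc fc)
    have alg: "t - j = q - 1/2 * r" if "t = p + q" "j = - 1/2 * l" "K - l = r" "p = - 1/2 * K" for t p q j l K r :: complex
      using that(1,2,4) unfolding that(3)[symmetric] by (simp add: field_simps)
    have e1: "sum T X = (LBINT x:{0..1}. S' x * (of_real (U x) * S x)) + (LBINT x:{0..1}. S' x * (of_real (U x) * (of_real (f x) - S x)))"
      unfolding TX by (subst set_integral_add(2)[symmetric]) (auto intro!: continuous_set_integrable continuous_intros Uc fc Sc simp: algebra_simps)
    have e2: "of_real (- 1/2 * J) = - 1/2 * (LBINT x:{0..1}. complex_of_real (U' x * (f x)\<^sup>2))"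
      unfolding J_def set_integral_complex_of_real by simp
    have e3: "(LBINT x:{0..1}. of_real (U' x) * (S x * S x)) - (LBINT x:{0..1}. complex_of_real (U' x * (f x)\<^sup>2))
       = (LBINT x:{0..1}. of_real (U' x) * ((S x - of_real (f x)) * (S x + of_real (f x))))"
      by (subst set_integral_diff(2)[symmetric]) (auto intro!: continuous_set_integrable continuous_intros U' fc Sc simp: algebra_simps power2_eq_square)
    have eq: "sum T X - of_real (- 1/2 * J) = (LBINT x:{0..1}. S' x * (of_real (U x) * (of_real (f x) - S x)))
       - 1/2 * (LBINT x:{0..1}. of_real (U' x) * ((S x - of_real (f x)) * (S x + of_real (f x))))"
      by (rule alg[OF e1 e2 e3 ibp])
    have b1: "cmod (LBINT x:{0..1}. S' x * (of_real (U x) * (of_real (f x) - S x))) \<le> (LBINT x:{0..1}. (M * tail X / 2) * (1 + (cmod (S' x))\<^sup>2))"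
    proof (rule set_integral_norm_le)
      fix x :: real assume x: "x \<in> {0..1}"
      have "cmod (S' x * (of_real (U x) * (of_real (f x) - S x))) \<le> cmod (S' x) * (M * tail X)"
        unfolding norm_mult using M[OF x] M0 Stail[of x] by (intro mult_left_mono mult_mono) auto
      \<comment> \<open>No uniform bound on |S'| is at hand, only one on the integral of |S'|^2;
        hence |S'| \<le> (1 + |S'|^2) / 2.\<close>
      also have "\<dots> \<le> ((1 + (cmod (S' x))\<^sup>2) / 2) * (M * tail X)"
        using zero_le_power2[of "cmod (S' x) - 1"] M0 t0 by (intro mult_right_mono) (auto simp: power2_eq_square algebra_simps)
      finally show "cmod (S' x * (of_real (U x) * (of_real (f x) - S x))) \<le> (M * tail X / 2) * (1 + (cmod (S' x))\<^sup>2)"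
        by (simp add: algebra_simps)
    qed (intro continuous_set_integrable continuous_intros Uc fc Sc)+
    have "(LBINT x:{0..1}. (M * tail X / 2) * (1 + (cmod (S' x))\<^sup>2)) = (M * tail X / 2) * (1 + (\<Sum>k\<in>X. (cmod (d k))\<^sup>2))"
    proof -
      have "(LBINT x:{0..1}. 1 + (cmod (S' x))\<^sup>2) = (LBINT x:{0..1::real}. 1) + (LBINT x:{0..1}. (cmod (S' x))\<^sup>2)"
        by (intro set_integral_add(2) continuous_set_integrable continuous_intros Sc)
      also have "(LBINT x:{0..1}. (cmod (S' x))\<^sup>2) = (\<Sum>k\<in>X. (cmod (d k))\<^sup>2)"
        unfolding S'_def by (rule trig_poly_parseval[OF X])
      also have "(LBINT x:{0..1::real}. 1) = (1::real)" by (simp add: set_lebesgue_integral_def)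
      finally show ?thesis by simp
    qed
    also have "\<dots> \<le> (M * tail X / 2) * (1 + L)"
      using \<open>l2 d\<close> M0 t0 X unfolding L_def l2_def by (intro mult_left_mono add_left_mono finite_sum_le_infsum) auto
    finally have b1': "cmod (LBINT x:{0..1}. S' x * (of_real (U x) * (of_real (f x) - S x))) \<le> (M * tail X / 2) * (1 + L)"
      using b1 by linarith
    have b2: "cmod (LBINT x:{0..1}. of_real (U' x) * ((S x - of_real (f x)) * (S x + of_real (f x)))) \<le> M' * (tail X * (2 * A))"
    proof (rule set_integral_norm_le_const)
      fix x :: real assume x: "x \<in> {0..1}"
      have "cmod (S x + of_real (f x)) \<le> 2 * A"
        using norm_triangle_ineq[of "S x" "of_real (f x)"] SA[of x] fA[of x] by linarith
      then show "cmod (of_real (U' x) * ((S x - of_real (f x)) * (S x + of_real (f x)))) \<le> M' * (tail X * (2 * A))"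
        unfolding norm_mult using M'[OF x] M0 t0 A0 Stail[of x]
        by (intro mult_mono) (auto simp: norm_minus_commute)
    qed (intro continuous_set_integrable continuous_intros U' fc Sc)
    have "cmod (sum T X - of_real (- 1/2 * J)) \<le> (M * tail X / 2) * (1 + L) + 1/2 * (M' * (tail X * (2 * A)))"
      unfolding eq by (rule order_trans[OF norm_triangle_ineq4]) (use b1' b2 in \<open>simp add: norm_divide\<close>)
    also have "\<dots> = tail X * (M * ((1 + L) / 2) + M' * A)" by (simp add: field_simps)
    finally show ?thesis .
  qed
  have tail0: "(tail \<longlongrightarrow> A - A) (finite_subsets_at_top UNIV)"
    unfolding tail_def A_def using has_sum_infsum[OF c] unfolding has_sum_def by (intro tendsto_intros)
  have "((\<lambda>X. tail X * (M * ((1 + L) / 2) + M' * A)) \<longlongrightarrow> (A - A) * (M * ((1 + L) / 2) + M' * A)) (finite_subsets_at_top UNIV)"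
    by (intro tendsto_intros tail0)
  then have sobolev_limits: "((\<lambda>X. tail X * (M * ((1 + L) / 2) + M' * A)) \<longlongrightarrow> 0) (finite_subsets_at_top UNIV)" by simp
  have "((\<lambda>X. sum T X - of_real (- 1/2 * J)) \<longlongrightarrow> 0) (finite_subsets_at_top UNIV)"
    by (rule Lim_null_comparison[OF _ sobolev_limits]) (intro eventually_finite_subsets_at_top_weakI est)
  then have "(T has_sum of_real (- 1/2 * J)) UNIV"
    unfolding has_sum_def by (rule LIM_zero_cancel)
  then have "((\<lambda>k. - cnj (T k)) has_sum - cnj (of_real (- 1/2 * J))) UNIV"
    by (intro has_sum_uminusI) (simp only: has_sum_cnj_iff)
  moreover have "- cnj (T k) = cnj (fhat f k) * (2 * pi * \<i> * of_int k * fhat (\<lambda>x. U x * f x) k)" for k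
    unfolding T_def d_def c_def using fhat_cnj[of "\<lambda>x. U x * f x" "- k"]
    by (simp add: fourier_coeff_eq_cfourier)
  ultimately show ?thesis by (simp add: J_def)
qed

section \<open>Global solutions\<close>

text \<open>Division by zero makes the coefficient of index 0 vanish.\<close>

definition antideriv_coeff :: "(int \<Rightarrow> complex) \<Rightarrow> int \<Rightarrow> complex" where
  "antideriv_coeff c k = c k / (2 * pi * \<i> * of_int k)"

text \<open>For nonzero k, 2 pi |k| dominates sqrt (1 + k^2), so antidifferentiation gains a full
  order. An L^2 function such as the time derivative of \<rho> thus acquires a continuous
  antiderivative.\<close>

lemma abs_summable_antideriv_coeff:
  assumes "l2 c" shows "abs_summable (antideriv_coeff c)" and "(\<Sum>\<^sub>\<infinity>k. cmod (antideriv_coeff c k)) \<le> embedding_const * l2_norm c"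
proof -
  define b where "b = (\<lambda>k::int. of_real (1 / sqrt (1 + (of_int k)\<^sup>2)) * c k)"
  have nz: "1 + (real_of_int k)\<^sup>2 > 0" for k by (simp add: add_pos_nonneg)
  have w: "cmod (c k) = sqrt (1 + (of_int k)\<^sup>2) * cmod (b k)" for k
    using nz[of k] by (simp add: b_def norm_mult norm_divide)
  note b = weighted_l2_imp_abs_summable[OF assms w]
  have le: "cmod (antideriv_coeff c k) \<le> cmod (b k)" for k
  proof (cases "k = 0")
    case True then show ?thesis by (simp add: antideriv_coeff_def)
  next
    case False
    then have "1 \<le> \<bar>of_int k :: real\<bar>" by linarith
    then have k1: "1 \<le> (real_of_int k)\<^sup>2" by (simp add: abs_le_square_iff[of 1 "real_of_int k", simplified])
    have "sqrt (1 + (real_of_int k)\<^sup>2) \<le> sqrt ((2 * of_int k)\<^sup>2)"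
      using k1 by (intro real_sqrt_le_mono) (simp add: power_mult_distrib)
    also have "\<dots> = 2 * \<bar>of_int k\<bar>" unfolding real_sqrt_abs abs_mult by simp
    also have "\<dots> \<le> 2 * pi * \<bar>of_int k\<bar>" using pi_gt3 by (intro mult_right_mono) auto
    finally have "cmod (c k) / (2 * pi * \<bar>of_int k\<bar>) \<le> cmod (c k) / sqrt (1 + (of_int k)\<^sup>2)"
      using nz[of k] by (intro divide_left_mono) (auto intro!: mult_pos_pos simp: False)
    then show ?thesis by (simp add: antideriv_coeff_def b_def norm_mult norm_divide)
  qed
  show a: "abs_summable (antideriv_coeff c)" by (rule summable_on_comparison_test[OF b(1)]) (auto simp: le)
  have "(\<Sum>\<^sub>\<infinity>k. cmod (antideriv_coeff c k)) \<le> (\<Sum>\<^sub>\<infinity>k. cmod (b k))" by (intro infsum_mono a b(1) le)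
  also note b(2)
  finally show "(\<Sum>\<^sub>\<infinity>k. cmod (antideriv_coeff c k)) \<le> embedding_const * l2_norm c" .
qed

lemma fourier_sum_delta: "fourier_sum (\<lambda>k. if k = 0 then z else 0) x = z"
proof -
  have "((\<lambda>k. (if k = 0 then z else 0) * chi k x) has_sum z) UNIV"
    by (subst has_sum_cong_neutral[where T = "{0}" and g = "\<lambda>_. z"]) (auto intro: has_sum_finiteI)
  then show ?thesis unfolding fourier_sum_def by (rule infsumI)
qed

section \<open>From Sobolev-valued curves to functions of time and space\<close>

text \<open>The increment in time is controlled uniformly in \<open>x\<close>, and at the fixed time
  \<open>t\<close> continuity in \<open>x\<close> suffices; the triangle inequality joins the
  two.\<close>

lemma jointly_continuous:
  fixes v :: "real \<Rightarrow> real \<Rightarrow> real"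
  assumes cont: "\<And>t. t \<in> A \<Longrightarrow> continuous_on UNIV (v t)"
    and le: "\<And>t \<tau> x. t \<in> A \<Longrightarrow> \<tau> \<in> A \<Longrightarrow> \<bar>v \<tau> x - v t x\<bar> \<le> C * N \<tau> t" and C: "0 \<le> C"
    and lim: "\<And>t. t \<in> A \<Longrightarrow> ((\<lambda>\<tau>. N \<tau> t) \<longlongrightarrow> 0) (at t within A)"
  shows "continuous_on (A \<times> UNIV) (\<lambda>(t, x). v t x)"
  unfolding continuous_on_iff
proof (safe, clarsimp)
  fix t x e :: real assume t: "t \<in> A" and e: "0 < e"
  have "((\<lambda>\<tau>. C * N \<tau> t) \<longlongrightarrow> C * 0) (at t within A)" by (intro tendsto_intros lim t)
  then have "\<forall>\<^sub>F \<tau> in at t within A. C * N \<tau> t < e / 2" using e by (intro order_tendstoD(2)) auto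
  then obtain d1 where d1: "d1 > 0" "\<And>\<tau>. \<tau> \<in> A \<Longrightarrow> \<tau> \<noteq> t \<Longrightarrow> dist \<tau> t < d1 \<Longrightarrow> C * N \<tau> t < e / 2"
    unfolding eventually_at by auto
  have "isCont (v t) x" using cont[OF t] by (simp add: continuous_on_eq_continuous_at)
  then obtain d2 where d2: "d2 > 0" "\<And>y. dist y x < d2 \<Longrightarrow> dist (v t y) (v t x) < e / 2"
    using e half_gt_zero unfolding continuous_at_eps_delta by metis
  show "\<exists>d>0. \<forall>a\<in>A. \<forall>b. dist (a, b) (t, x) < d \<longrightarrow> dist (v a b) (v t x) < e"
  proof (intro exI[of _ "min d1 d2"] conjI ballI allI impI)
    fix a b assume a: "a \<in> A" and d: "dist (a, b) (t, x) < min d1 d2"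
    have da: "dist a t < d1" and db: "dist b x < d2"
      using d dist_fst_le[of "(a, b)" "(t, x)"] dist_snd_le[of "(a, b)" "(t, x)"] by auto
    have "dist (v a b) (v t b) \<le> e / 2"
    proof (cases "a = t")
      case False
      then show ?thesis using d1(2)[OF a False da] le[OF t a, of b] by (simp add: dist_real_def)
    qed (use e in simp)
    moreover have "dist (v t b) (v t x) < e / 2" by (rule d2(2)[OF db])
    ultimately show "dist (v a b) (v t x) < e"
      using dist_triangle[of "v a b" "v t x" "v t b"] by linarith
  qed (use d1 d2 in auto)
qed

lemma time_interval_infty: "time_interval \<infinity> = {0..}"
  by (auto simp: time_interval_def)

lemma constant_in_time:
  fixes f :: "real \<Rightarrow> real"
  assumes "\<And>t. 0 \<le> t \<Longrightarrow> (f has_real_derivative 0) (at t within {0..})" "0 \<le> t"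
  shows "f t = f 0"
  using has_field_derivative_zero_constant[of "{0..}" f] assms by force

lemma fhat_quotient:
  assumes f: "f \<in> sobolev r" and g: "g \<in> sobolev r" and h: "h \<in> sobolev r"
  shows "fhat (\<lambda>x. (f x - g x) / c - h x) k = (fhat f k - fhat g k) / of_real c - fhat h k"
proof -
  have "fhat (\<lambda>x. 1 / c * (f x - g x) - h x) k = fhat (\<lambda>x. 1 / c * (f x - g x)) k - fhat h k"
    by (intro fourier_coeff_diff sobolev_integrable[of _ r] sobolev_cmult sobolev_diff f g h)
  also have "fhat (\<lambda>x. 1 / c * (f x - g x)) k = of_real (1 / c) * (fhat f k - fhat g k)"
    unfolding fourier_coeff_cmult by (subst fourier_coeff_diff) (auto intro: sobolev_integrable f g)
  finally show ?thesis by simp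
qed

lemma inner_eq_Re_cnj: "x \<bullet> y = Re (cnj x * y)" for x y :: complex
  by (simp add: inner_complex_def)

text \<open>The situation to be refuted, with infinite lifespan and orders lowered to s = 2. One
  \<gamma> stands for both \<open>\<gamma>\<^sub>1\<close> and \<open>2 * \<gamma>\<^sub>2\<close>,
  so the two equations share their transport speed.\<close>

locale global_mu_HS =
  fixes \<gamma> :: real and u \<rho> u\<^sub>t \<rho>\<^sub>t :: "real \<Rightarrow> real \<Rightarrow> real"
  assumes C0u: "C0_sobolev 2 \<infinity> u" and C0r: "C0_sobolev 1 \<infinity> \<rho>"
    and C1u: "C1_sobolev 1 \<infinity> u u\<^sub>t" and C1r: "C1_sobolev 0 \<infinity> \<rho> \<rho>\<^sub>t"
    and eq_u: "\<And>t x. 0 \<le> t \<Longrightarrow> u\<^sub>t t x - (u t x + \<gamma>) * deriv (u t) x =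
              deriv (mu_dxx_inv (\<lambda>y. 2 * circle_mean (u t) * u t y
                + 1/2 * (deriv (u t) y)\<^sup>2 + 1/2 * (\<rho> t y)\<^sup>2)) x"
    and eq_r: "\<And>t. 0 \<le> t \<Longrightarrow> \<exists>\<rho>\<^sub>x. has_weak_deriv (\<rho> t) \<rho>\<^sub>x \<and>
              (AE x in lborel. \<rho>\<^sub>t t x - (u t x + \<gamma>) * \<rho>\<^sub>x x = deriv (u t) x * \<rho> t x)"
begin

definition v :: "real \<Rightarrow> real \<Rightarrow> real" where "v t = deriv (u t)"

definition src :: "real \<Rightarrow> real \<Rightarrow> real" where
  "src t y = 2 * circle_mean (u t) * u t y + 1/2 * (v t y)\<^sup>2 + 1/2 * (\<rho> t y)\<^sup>2"

definition w\<^sub>x :: "real \<Rightarrow> real \<Rightarrow> real" where "w\<^sub>x t = deriv (mu_dxx_inv (src t))"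

text \<open>Characteristics have velocity -U, because the transport terms are subtracted on the left
  of the equations.\<close>

definition U :: "real \<Rightarrow> real \<Rightarrow> real" where "U t x = u t x + \<gamma>"

lemma in_sobolev:
  assumes "0 \<le> t"
  shows "u t \<in> sobolev 2" "u t \<in> sobolev 1" "\<rho> t \<in> sobolev 1" "u\<^sub>t t \<in> sobolev 1" "\<rho>\<^sub>t t \<in> sobolev 0"
    "v t \<in> sobolev 1"
  using C0u C0r C1u C1r assms sobolev_2_deriv(3)[of "u t"]
  unfolding C1_sobolev_def C0_sobolev_def time_interval_infty v_def by auto

lemma sobolev_limits:
  assumes "0 \<le> t"
  shows "((\<lambda>\<tau>. sobolev_norm 2 (\<lambda>x. u \<tau> x - u t x)) \<longlongrightarrow> 0) (at t within {0..})"
    "((\<lambda>\<tau>. sobolev_norm 1 (\<lambda>x. \<rho> \<tau> x - \<rho> t x)) \<longlongrightarrow> 0) (at t within {0..})"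
    "((\<lambda>\<tau>. sobolev_norm 1 (\<lambda>x. (u \<tau> x - u t x) / (\<tau> - t) - u\<^sub>t t x)) \<longlongrightarrow> 0) (at t within {0..})"
    "((\<lambda>\<tau>. sobolev_norm 0 (\<lambda>x. (\<rho> \<tau> x - \<rho> t x) / (\<tau> - t) - \<rho>\<^sub>t t x)) \<longlongrightarrow> 0) (at t within {0..})"
  using C0u C0r C1u C1r assms unfolding C1_sobolev_def C0_sobolev_def time_interval_infty by auto

lemma periodic:
  assumes "0 \<le> t"
  shows "periodic1 (u t)" "periodic1 (\<rho> t)" "periodic1 (v t)" "periodic1 (U t)" "periodic1 (src t)"
  using sobolevD(1)[OF in_sobolev(1)[OF assms]] sobolevD(1)[OF in_sobolev(3)[OF assms]] sobolevD(1)[OF in_sobolev(6)[OF assms]]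
  unfolding periodic1_def U_def src_def by auto

lemma cont:
  assumes "0 \<le> t"
  shows "continuous_on UNIV (u t)" "continuous_on UNIV (\<rho> t)" "continuous_on UNIV (v t)"
    "continuous_on UNIV (U t)" "continuous_on UNIV (src t)"
proof -
  show c: "continuous_on UNIV (u t)" "continuous_on UNIV (\<rho> t)" "continuous_on UNIV (v t)"
    using sobolevD(5)[OF in_sobolev(1)[OF assms]] sobolevD(5)[OF in_sobolev(3)[OF assms]] sobolevD(5)[OF in_sobolev(6)[OF assms]]
    by auto
  show "continuous_on UNIV (U t)" "continuous_on UNIV (src t)"
    unfolding U_def[abs_def] src_def[abs_def] by (intro continuous_intros c)+
qed

lemma u_x: "0 \<le> t \<Longrightarrow> (u t has_real_derivative v t x) (at x)"
  using sobolev_2_deriv(1)[OF in_sobolev(1)] by (simp add: v_def)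

lemma U_x: "0 \<le> t \<Longrightarrow> (U t has_real_derivative v t x) (at x)"
  unfolding U_def[abs_def] using u_x by (auto intro!: derivative_eq_intros)

lemma u_t_eq: "0 \<le> t \<Longrightarrow> u\<^sub>t t x = U t x * v t x + w\<^sub>x t x"
  using eq_u[of t x] unfolding U_def w\<^sub>x_def v_def src_def[abs_def] by (simp add: algebra_simps)

text \<open>The source is continuous, so the nonlocal term is classically differentiable in x, and
  its derivative contains no second derivative of \<open>u\<close>. As the derivative of a periodic
  function the term itself has zero mean.\<close>

lemma w_x:
  assumes "0 \<le> t"
  shows "(w\<^sub>x t has_real_derivative circle_mean (src t) - src t x) (at x)" "periodic1 (w\<^sub>x t)"
    "continuous_on UNIV (w\<^sub>x t)" "fhat (w\<^sub>x t) 0 = 0"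
proof -
  obtain w where w: "\<And>x. (w has_real_derivative w\<^sub>x t x) (at x)" "periodic1 w"
    "\<And>x. (w\<^sub>x t has_real_derivative circle_mean (src t) - src t x) (at x)" "periodic1 (w\<^sub>x t)"
    using mu_dxx_inv_deriv[OF cont(5)[OF assms] periodic(5)[OF assms]] unfolding w\<^sub>x_def by metis
  show "(w\<^sub>x t has_real_derivative circle_mean (src t) - src t x) (at x)" "periodic1 (w\<^sub>x t)"
    by (rule w)+
  show c: "continuous_on UNIV (w\<^sub>x t)" using w(3) by (meson DERIV_isCont continuous_at_imp_continuous_on)
  show "fhat (w\<^sub>x t) 0 = 0" using fhat_deriv[OF w(1) c w(2), of 0] by simp
qed

text \<open>The embedding of H^1 into the bounded functions turns differentiability in the Sobolev
  norm into differentiability at each fixed \<open>x\<close>.\<close>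

lemma u_t:
  assumes t: "0 \<le> t" shows "((\<lambda>\<tau>. u \<tau> x) has_real_derivative u\<^sub>t t x) (at t within {0..})"
proof -
  have b: "((\<lambda>\<tau>. embedding_const * sobolev_norm 1 (\<lambda>x. (u \<tau> x - u t x) / (\<tau> - t) - u\<^sub>t t x)) \<longlongrightarrow> 0) (at t within {0..})"
    using tendsto_mult[OF tendsto_const sobolev_limits(3)[OF t], of embedding_const] by simp
  have "((\<lambda>\<tau>. (u \<tau> x - u t x) / (\<tau> - t) - u\<^sub>t t x) \<longlongrightarrow> 0) (at t within {0..})"
  proof (rule Lim_null_comparison[OF _ b])
    show "\<forall>\<^sub>F \<tau> in at t within {0..}. norm ((u \<tau> x - u t x) / (\<tau> - t) - u\<^sub>t t x) \<le> embedding_const * sobolev_norm 1 (\<lambda>x. (u \<tau> x - u t x) / (\<tau> - t) - u\<^sub>t t x)"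
      unfolding eventually_at_filter
    proof (intro always_eventually allI impI)
      fix \<tau> :: real assume "\<tau> \<in> {0..}"
      then have "(\<lambda>x. (u \<tau> x - u t x) / (\<tau> - t) - u\<^sub>t t x) \<in> sobolev 1"
        using sobolev_diff[OF sobolev_cmult[OF sobolev_diff[OF in_sobolev(2) in_sobolev(2)[OF t]], of \<tau> "1 / (\<tau> - t)"] in_sobolev(4)[OF t]] by simp
      from sobolev_1_sup[OF this] show "norm ((u \<tau> x - u t x) / (\<tau> - t) - u\<^sub>t t x) \<le> embedding_const * sobolev_norm 1 (\<lambda>x. (u \<tau> x - u t x) / (\<tau> - t) - u\<^sub>t t x)"
        by simp
    qed
  qed
  then show ?thesis unfolding has_field_derivative_iff by (rule LIM_zero_cancel)
qed

lemma joint_cont: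
  "continuous_on ({0..} \<times> UNIV) (\<lambda>(t, x). u t x)"
  "continuous_on ({0..} \<times> UNIV) (\<lambda>(t, x). v t x)"
  "continuous_on ({0..} \<times> UNIV) (\<lambda>(t, x). \<rho> t x)"
proof -
  have d2: "(\<lambda>x. u \<tau> x - u t x) \<in> sobolev 2" if "0 \<le> t" "0 \<le> \<tau>" for t \<tau>
    using that by (intro sobolev_diff in_sobolev)
  have d1: "\<bar>u \<tau> x - u t x\<bar> \<le> embedding_const * sobolev_norm 2 (\<lambda>x. u \<tau> x - u t x)" if "0 \<le> t" "0 \<le> \<tau>" for t \<tau> x
  proof -
    have "(\<lambda>x. u \<tau> x - u t x) \<in> sobolev 1" using that by (intro sobolev_diff in_sobolev)
    from sobolev_1_sup[OF this, of x] show ?thesis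
      using mult_left_mono[OF sobolev_mono(2)[OF d2[OF that], of 1] embedding_const_nonneg] by linarith
  qed
  have dv: "\<bar>v \<tau> x - v t x\<bar> \<le> (embedding_const * (2 * pi)) * sobolev_norm 2 (\<lambda>x. u \<tau> x - u t x)" if "0 \<le> t" "0 \<le> \<tau>" for t \<tau> x
  proof -
    have "deriv (\<lambda>x. u \<tau> x - u t x) = (\<lambda>x. v \<tau> x - v t x)"
      using u_x that by (intro ext DERIV_imp_deriv DERIV_diff) auto
    then show ?thesis
      using sobolev_1_sup[OF sobolev_2_deriv(3)[OF d2[OF that]], of x]
        mult_left_mono[OF sobolev_2_deriv(5)[OF d2[OF that]] embedding_const_nonneg] by (simp add: mult_ac)
  qed
  have dr: "\<bar>\<rho> \<tau> x - \<rho> t x\<bar> \<le> embedding_const * sobolev_norm 1 (\<lambda>x. \<rho> \<tau> x - \<rho> t x)" if "0 \<le> t" "0 \<le> \<tau>" for t \<tau> x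
  proof -
    have "(\<lambda>x. \<rho> \<tau> x - \<rho> t x) \<in> sobolev 1" using that by (intro sobolev_diff in_sobolev)
    from sobolev_1_sup[OF this, of x] show ?thesis .
  qed
  show "continuous_on ({0..} \<times> UNIV) (\<lambda>(t, x). u t x)"
    by (rule jointly_continuous[OF cont(1) d1 embedding_const_nonneg sobolev_limits(1)]) auto
  show "continuous_on ({0..} \<times> UNIV) (\<lambda>(t, x). v t x)"
    by (rule jointly_continuous[OF cont(3) dv _ sobolev_limits(1)]) (auto simp: embedding_const_nonneg)
  show "continuous_on ({0..} \<times> UNIV) (\<lambda>(t, x). \<rho> t x)"
    by (rule jointly_continuous[OF cont(2) dr embedding_const_nonneg sobolev_limits(2)]) auto
qed

text \<open>The second equation is the conservation law \<rho>_t = (U \<rho>)_x in weak form; on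
  coefficients it holds without exceptional null sets.\<close>

lemma fhat_rho_t:
  assumes "0 \<le> t" shows "fhat (\<rho>\<^sub>t t) k = 2 * pi * \<i> * of_int k * fhat (\<lambda>x. U t x * \<rho> t x) k"
proof -
  obtain r where r: "has_weak_deriv (\<rho> t) r" and ae: "AE x in lborel. \<rho>\<^sub>t t x - (u t x + \<gamma>) * r x = deriv (u t) x * \<rho> t x"
    using eq_r[OF assms] by blast
  have wd: "has_weak_deriv (\<lambda>x. U t x * \<rho> t x) (\<lambda>x. U t x * r x + v t x * \<rho> t x)"
    by (rule has_weak_deriv_mult[OF r U_x[OF assms] cont(3)[OF assms] periodic(4)[OF assms] periodic(3)[OF assms]])
  have [measurable]: "(\<lambda>x. U t x * r x + v t x * \<rho> t x) \<in> borel_measurable borel"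
    using wd unfolding has_weak_deriv_def by blast
  have [measurable]: "\<rho>\<^sub>t t \<in> borel_measurable borel" by (rule sobolevD(2)[OF in_sobolev(5)[OF assms]])
  have "fhat (\<rho>\<^sub>t t) k = fhat (\<lambda>x. U t x * r x + v t x * \<rho> t x) k"
    unfolding fourier_coeff_eq_cfourier cfourier_def
  proof (rule set_lebesgue_integral_cong_AE)
    show "AE x\<in>{0..1} in lborel. complex_of_real (\<rho>\<^sub>t t x) * chi (- k) x = complex_of_real (U t x * r x + v t x * \<rho> t x) * chi (- k) x"
      using ae
    proof eventually_elim
      case (elim x)
      then have hx: "\<rho>\<^sub>t t x = U t x * r x + v t x * \<rho> t x" by (simp add: U_def v_def)
      show ?case unfolding hx by simp
    qed
  qed measurable
  also have "\<dots> = 2 * pi * \<i> * of_int k * fhat (\<lambda>x. U t x * \<rho> t x) k" by (rule has_weak_deriv_fhat[OF wd])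
  finally show ?thesis .
qed

lemma fhat_u_t:
  assumes t: "0 \<le> t"
  shows "fhat (u\<^sub>t t) k = fhat (\<lambda>x. U t x * v t x) k + fhat (w\<^sub>x t) k"
proof -
  have "fhat (u\<^sub>t t) k = cfourier (\<lambda>x. of_real (U t x * v t x) + of_real (w\<^sub>x t x)) k"
    unfolding fourier_coeff_eq_cfourier u_t_eq[OF t] by simp
  also have "\<dots> = fhat (\<lambda>x. U t x * v t x) k + fhat (w\<^sub>x t) k"
    unfolding fourier_coeff_eq_cfourier using t
    by (intro cfourier_add continuous_set_integrable continuous_intros cont w_x)
  finally show ?thesis .
qed

section \<open>Conservation of mean and energy\<close>

text \<open>Both parts of \<open>u\<^sub>t\<close> are x-derivatives of periodic functions: U v is
  the derivative of U^2 / 2, and the nonlocal term is a derivative by construction. So the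
  coefficient of \<open>u\<^sub>t\<close> at index 0 vanishes.\<close>

lemma mean_const:
  assumes t: "0 \<le> t" shows "circle_mean (u t) = circle_mean (u 0)"
proof (rule constant_in_time[OF _ t])
  fix t :: real assume t: "0 \<le> t"
  have "fhat (u\<^sub>t t) 0 = 0"
  proof -
    have "((\<lambda>x. 1/2 * (U t x)\<^sup>2) has_real_derivative U t x * v t x) (at x)" for x
      using U_x[OF t] by (auto intro!: derivative_eq_intros)
    from fhat_deriv[OF this, of 0] have "fhat (\<lambda>x. U t x * v t x) 0 = 0"
      using periodic(4)[OF t] by (simp add: cont t continuous_intros periodic1_def)
    then show ?thesis using w_x(4)[OF t] by (simp add: fhat_u_t[OF t])
  qed
  have "((\<lambda>\<tau>. (circle_mean (u \<tau>) - circle_mean (u t)) / (\<tau> - t) - 0) \<longlongrightarrow> 0) (at t within {0..})"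
  proof (rule Lim_null_comparison[OF _ sobolev_limits(3)[OF t]])
    show "\<forall>\<^sub>F \<tau> in at t within {0..}. norm ((circle_mean (u \<tau>) - circle_mean (u t)) / (\<tau> - t) - 0)
        \<le> sobolev_norm 1 (\<lambda>x. (u \<tau> x - u t x) / (\<tau> - t) - u\<^sub>t t x)"
      unfolding eventually_at_filter
    proof (intro always_eventually allI impI)
      fix \<tau> :: real assume "\<tau> \<in> {0..}"
      then have \<tau>: "0 \<le> \<tau>" by simp
      let ?q = "\<lambda>x. (u \<tau> x - u t x) / (\<tau> - t) - u\<^sub>t t x"
      have q: "?q \<in> sobolev 1"
        using sobolev_diff[OF sobolev_cmult[OF sobolev_diff[OF in_sobolev(2)[OF \<tau>] in_sobolev(2)[OF t]], of "1 / (\<tau> - t)"] in_sobolev(4)[OF t]] by simp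
      have "of_real ((circle_mean (u \<tau>) - circle_mean (u t)) / (\<tau> - t)) = fhat ?q 0"
        unfolding fhat_quotient[OF in_sobolev(2)[OF \<tau>] in_sobolev(2)[OF t] in_sobolev(4)[OF t]] \<open>fhat (u\<^sub>t t) 0 = 0\<close>
        by (simp add: circle_mean_fhat)
      then have "\<bar>(circle_mean (u \<tau>) - circle_mean (u t)) / (\<tau> - t)\<bar> = cmod (fhat ?q 0)"
        by (metis norm_of_real)
      also have "\<dots> \<le> cmod (weighted_coeff 1 ?q 0)" by (rule cmod_fhat_le_weighted_coeff) simp
      also have "\<dots> \<le> sobolev_norm 1 ?q" unfolding sobolev_norm_eq by (rule cmod_le_l2_norm[OF l2_weighted_coeff[OF q]])
      finally show "norm ((circle_mean (u \<tau>) - circle_mean (u t)) / (\<tau> - t) - 0) \<le> sobolev_norm 1 ?q" by simp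
    qed
  qed
  then show "((\<lambda>t. circle_mean (u t)) has_real_derivative 0) (at t within {0..})"
    unfolding has_field_derivative_iff by (rule LIM_zero_cancel)
qed

definition energy :: "real \<Rightarrow> real" where
  "energy t = (LBINT x:{0..1}. (v t x)\<^sup>2 + (\<rho> t x)\<^sup>2)"

text \<open>Formally the rate is twice the integral of \<rho> (U \<rho>)_x, which
  \<open>transport_pairing\<close> evaluates with U_x = v.\<close>

lemma energy_rho_deriv:
  assumes t: "0 \<le> t"
  shows "((\<lambda>\<tau>. (l2_norm (fhat (\<rho> \<tau>)))\<^sup>2) has_real_derivative (LBINT x:{0..1}. v t x * (\<rho> t x)\<^sup>2)) (at t within {0..})"
proof -
  have l0: "l2 (fhat f)" if "f \<in> sobolev 0" for f
    using l2_weighted_coeff[OF that] by (simp add: l2_def cmod_weighted_coeff_0)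
  have r0: "0 \<le> \<tau> \<Longrightarrow> \<rho> \<tau> \<in> sobolev 0" for \<tau> by (rule sobolev_mono(1)[OF in_sobolev(3)]) auto
  have "((\<lambda>k. cnj (fhat (\<rho> t) k) * fhat (\<rho>\<^sub>t t) k) has_sum of_real (1/2 * (LBINT x:{0..1}. v t x * (\<rho> t x)\<^sup>2))) UNIV"
    unfolding fhat_rho_t[OF t]
    by (rule transport_pairing[OF in_sobolev(3)[OF t] U_x[OF t] cont(3)[OF t] periodic(4)[OF t]])
  from has_sum_Re[OF this]
  have ip: "(\<Sum>\<^sub>\<infinity>k. fhat (\<rho> t) k \<bullet> fhat (\<rho>\<^sub>t t) k) = 1/2 * (LBINT x:{0..1}. v t x * (\<rho> t x)\<^sup>2)"
    unfolding inner_eq_Re_cnj by (intro infsumI) simp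
  have "((\<lambda>\<tau>. l2_norm (\<lambda>k. (fhat (\<rho> \<tau>) k - fhat (\<rho> t) k) / of_real (\<tau> - t) - fhat (\<rho>\<^sub>t t) k)) \<longlongrightarrow> 0) (at t within {0..})"
  proof (rule Lim_transform_eventually[OF sobolev_limits(4)[OF t]])
    show "\<forall>\<^sub>F \<tau> in at t within {0..}. sobolev_norm 0 (\<lambda>x. (\<rho> \<tau> x - \<rho> t x) / (\<tau> - t) - \<rho>\<^sub>t t x)
       = l2_norm (\<lambda>k. (fhat (\<rho> \<tau>) k - fhat (\<rho> t) k) / of_real (\<tau> - t) - fhat (\<rho>\<^sub>t t) k)"
      unfolding eventually_at_filter
    proof (intro always_eventually allI impI)
      fix \<tau> :: real assume "\<tau> \<in> {0..}"
      then have \<tau>: "0 \<le> \<tau>" by simp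
      show "sobolev_norm 0 (\<lambda>x. (\<rho> \<tau> x - \<rho> t x) / (\<tau> - t) - \<rho>\<^sub>t t x)
         = l2_norm (\<lambda>k. (fhat (\<rho> \<tau>) k - fhat (\<rho> t) k) / of_real (\<tau> - t) - fhat (\<rho>\<^sub>t t) k)"
        unfolding sobolev_norm_eq l2_norm_def cmod_weighted_coeff_0 fhat_quotient[OF r0[OF \<tau>] r0[OF t] in_sobolev(5)[OF t]] ..
    qed
  qed
  then have "((\<lambda>\<tau>. (l2_norm (fhat (\<rho> \<tau>)))\<^sup>2) has_real_derivative 2 * (\<Sum>\<^sub>\<infinity>k. fhat (\<rho> t) k \<bullet> fhat (\<rho>\<^sub>t t) k)) (at t within {0..})"
    using t l0 r0 in_sobolev(5)[OF t] by (intro l2_norm_square_has_derivative) auto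
  then show ?thesis unfolding ip by simp
qed

text \<open>Formally v_t = (U v)_x + w_xx. Since \<open>u\<^sub>t\<close> has order 1, the
  multiplier \<open>D\<close> of the x-derivative maps its coefficients into l2, and the result
  serves as the time derivative of the coefficients of \<open>v\<close>. The transport part yields
  the cubic integral; the continuous part w_xx is paired directly.\<close>

lemma energy_v_deriv:
  assumes t: "0 \<le> t"
  shows "((\<lambda>\<tau>. (l2_norm (fhat (v \<tau>)))\<^sup>2) has_real_derivative
     (LBINT x:{0..1}. v t x * (v t x)\<^sup>2) + 2 * (LBINT x:{0..1}. v t x * (circle_mean (src t) - src t x))) (at t within {0..})"
proof -
  define D where "D = (\<lambda>h k. 2 * pi * \<i> * of_int k * fhat h k)"
  have Dle: "cmod (D h k) \<le> (2 * pi) * cmod (weighted_coeff 1 h k)" for h k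
  proof -
    have "\<bar>real_of_int k\<bar> * cmod (fhat h k) \<le> sqrt (1 + (of_int k)\<^sup>2) * cmod (fhat h k)"
      by (intro mult_right_mono real_le_rsqrt) auto
    then show ?thesis by (simp add: D_def cmod_weighted_coeff_1 norm_mult)
  qed
  have l2D: "l2 (D h)" "l2_norm (D h) \<le> 2 * pi * sobolev_norm 1 h" if "h \<in> sobolev 1" for h
    using l2_comparison[OF l2_weighted_coeff[OF that] Dle] by (simp_all add: sobolev_norm_eq)
  have fv: "fhat (v \<tau>) = D (u \<tau>)" if "0 \<le> \<tau>" for \<tau>
    unfolding D_def v_def using sobolev_2_deriv(4)[OF in_sobolev(1)[OF that]] by auto
  have wxx: "continuous_on UNIV (\<lambda>x. circle_mean (src t) - src t x)"
    by (intro continuous_intros cont t)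
  have D': "D (u\<^sub>t t) k = 2 * pi * \<i> * of_int k * fhat (\<lambda>x. U t x * v t x) k + fhat (\<lambda>x. circle_mean (src t) - src t x) k" for k
    unfolding D_def fhat_u_t[OF t] fhat_deriv[OF w_x(1)[OF t] wxx w_x(2)[OF t]] by (simp add: algebra_simps)
  have "((\<lambda>k. cnj (fhat (v t) k) * D (u\<^sub>t t) k) has_sum of_real (1/2 * (LBINT x:{0..1}. v t x * (v t x)\<^sup>2))
      + of_real (LBINT x:{0..1}. v t x * (circle_mean (src t) - src t x))) UNIV"
    unfolding D' distrib_left
    by (intro has_sum_add transport_pairing fhat_pairing in_sobolev t U_x cont periodic continuous_set_integrable wxx)
  from has_sum_Re[OF this]
  have ip: "(\<Sum>\<^sub>\<infinity>k. D (u t) k \<bullet> D (u\<^sub>t t) k) = 1/2 * (LBINT x:{0..1}. v t x * (v t x)\<^sup>2) + (LBINT x:{0..1}. v t x * (circle_mean (src t) - src t x))"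
    unfolding inner_eq_Re_cnj fv[OF t] by (intro infsumI) simp
  have "((\<lambda>\<tau>. l2_norm (\<lambda>k. (D (u \<tau>) k - D (u t) k) / of_real (\<tau> - t) - D (u\<^sub>t t) k)) \<longlongrightarrow> 0) (at t within {0..})"
  proof (rule Lim_null_comparison)
    show "((\<lambda>\<tau>. 2 * pi * sobolev_norm 1 (\<lambda>x. (u \<tau> x - u t x) / (\<tau> - t) - u\<^sub>t t x)) \<longlongrightarrow> 0) (at t within {0..})"
      using tendsto_mult[OF tendsto_const sobolev_limits(3)[OF t], of "2 * pi"] by simp
    show "\<forall>\<^sub>F \<tau> in at t within {0..}. norm (l2_norm (\<lambda>k. (D (u \<tau>) k - D (u t) k) / of_real (\<tau> - t) - D (u\<^sub>t t) k))
       \<le> 2 * pi * sobolev_norm 1 (\<lambda>x. (u \<tau> x - u t x) / (\<tau> - t) - u\<^sub>t t x)"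
      unfolding eventually_at_filter
    proof (intro always_eventually allI impI)
      fix \<tau> :: real assume "\<tau> \<in> {0..}"
      then have \<tau>: "0 \<le> \<tau>" by simp
      let ?q = "\<lambda>x. (u \<tau> x - u t x) / (\<tau> - t) - u\<^sub>t t x"
      have q: "?q \<in> sobolev 1"
        using sobolev_diff[OF sobolev_cmult[OF sobolev_diff[OF in_sobolev(2)[OF \<tau>] in_sobolev(2)[OF t]], of "1 / (\<tau> - t)"] in_sobolev(4)[OF t]] by simp
      have "(\<lambda>k. (D (u \<tau>) k - D (u t) k) / of_real (\<tau> - t) - D (u\<^sub>t t) k) = D ?q"
        unfolding D_def fhat_quotient[OF in_sobolev(2)[OF \<tau>] in_sobolev(2)[OF t] in_sobolev(4)[OF t]]
        by (intro ext) (simp add: right_diff_distrib)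
      then show "norm (l2_norm (\<lambda>k. (D (u \<tau>) k - D (u t) k) / of_real (\<tau> - t) - D (u\<^sub>t t) k)) \<le> 2 * pi * sobolev_norm 1 ?q"
        using l2D(2)[OF q] by simp
    qed
  qed
  then have "((\<lambda>\<tau>. (l2_norm (D (u \<tau>)))\<^sup>2) has_real_derivative 2 * (\<Sum>\<^sub>\<infinity>k. D (u t) k \<bullet> D (u\<^sub>t t) k)) (at t within {0..})"
    using t by (intro l2_norm_square_has_derivative l2D(1) in_sobolev) auto
  then have "((\<lambda>\<tau>. (l2_norm (D (u \<tau>)))\<^sup>2) has_real_derivative
     (LBINT x:{0..1}. v t x * (v t x)\<^sup>2) + 2 * (LBINT x:{0..1}. v t x * (circle_mean (src t) - src t x))) (at t within {0..})"
    unfolding ip by (simp add: distrib_left)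
  then show ?thesis
    by (rule has_field_derivative_transform_within[OF _ zero_less_one]) (use t fv in auto)
qed

lemma energy_eq: "0 \<le> t \<Longrightarrow> energy t = (l2_norm (fhat (v t)))\<^sup>2 + (l2_norm (fhat (\<rho> t)))\<^sup>2"
  unfolding energy_def
  by (subst set_integral_add(2)) (auto simp: sobolev_1_parseval in_sobolev intro!: continuous_set_integrable continuous_intros cont)

lemma energy_const:
  assumes t: "0 \<le> t" shows "energy t = energy 0"
proof -
  have "(l2_norm (fhat (v t)))\<^sup>2 + (l2_norm (fhat (\<rho> t)))\<^sup>2 = (l2_norm (fhat (v 0)))\<^sup>2 + (l2_norm (fhat (\<rho> 0)))\<^sup>2"
  proof (rule constant_in_time[where f = "\<lambda>t. (l2_norm (fhat (v t)))\<^sup>2 + (l2_norm (fhat (\<rho> t)))\<^sup>2", OF _ t])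
    fix t :: real assume t: "0 \<le> t"
    let ?m = "circle_mean (src t)" and ?\<mu> = "circle_mean (u t)"
    let ?A = "LBINT x:{0..1}. v t x * (v t x)\<^sup>2" and ?B = "LBINT x:{0..1}. v t x * (?m - src t x)"
    let ?C = "LBINT x:{0..1}. v t x * (\<rho> t x)\<^sup>2"
    \<comment> \<open>The total rate is twice the integral of this derivative: the cubic terms and
      the terms with \<rho>^2 cancel against those in \<open>src\<close>.\<close>
    have "((\<lambda>x. ?m * u t x - ?\<mu> * (u t x)\<^sup>2) has_real_derivative ?m * v t x - 2 * ?\<mu> * u t x * v t x) (at x)" for x
      using u_x[OF t] by (auto intro!: derivative_eq_intros)
    then have "(LBINT x:{0..1}. ?m * v t x - 2 * ?\<mu> * u t x * v t x) = (?m * u t 1 - ?\<mu> * (u t 1)\<^sup>2) - (?m * u t 0 - ?\<mu> * (u t 0)\<^sup>2)"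
      unfolding has_real_derivative_iff_has_vector_derivative
      by (intro set_integral_FTC[where F = "\<lambda>x. ?m * u t x - ?\<mu> * (u t x)\<^sup>2"] continuous_intros cont t) auto
    also have "\<dots> = 0" using periodic(1)[OF t] unfolding periodic1_def by (metis add_0 diff_self)
    also have "(LBINT x:{0..1}. ?m * v t x - 2 * ?\<mu> * u t x * v t x)
        = (LBINT x:{0..1}. (1/2 * (v t x * (v t x)\<^sup>2) + v t x * (?m - src t x)) + 1/2 * (v t x * (\<rho> t x)\<^sup>2))"
      by (intro arg_cong[where f = "set_lebesgue_integral lborel {0..1}"] ext) (simp add: src_def field_simps power2_eq_square)
    also have "\<dots> = (1/2 * ?A + ?B) + 1/2 * ?C"
      by (subst set_integral_add(2), (intro continuous_set_integrable continuous_intros cont t)+,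
          subst set_integral_add(2), (intro continuous_set_integrable continuous_intros cont t)+) simp
    finally have "(?A + 2 * ?B) + ?C = 0" by simp
    then show "((\<lambda>t. (l2_norm (fhat (v t)))\<^sup>2 + (l2_norm (fhat (\<rho> t)))\<^sup>2) has_real_derivative 0) (at t within {0..})"
      using DERIV_add[OF energy_v_deriv[OF t] energy_rho_deriv[OF t]] by simp
  qed
  then show ?thesis using t by (simp add: energy_eq)
qed

text \<open>By the two conservation laws this mean is the time-independent constant \<open>a\<close>
  of the theorem.\<close>

lemma src_mean:
  assumes t: "0 \<le> t"
  shows "circle_mean (src t) = 2 * (circle_mean (u 0))\<^sup>2 + 1/2 * energy 0"
proof -
  have "circle_mean (src t) = (LBINT x:{0..1}. 2 * circle_mean (u t) * u t x + 1/2 * ((v t x)\<^sup>2 + (\<rho> t x)\<^sup>2))"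
    unfolding circle_mean_def[of "src t"] src_def by (simp add: algebra_simps)
  also have "\<dots> = 2 * circle_mean (u t) * circle_mean (u t) + 1/2 * energy t"
    unfolding energy_def circle_mean_def[of "u t"]
    by (subst set_integral_add(2)) (auto intro!: continuous_set_integrable continuous_intros cont t)
  finally show ?thesis using mean_const[OF t] energy_const[OF t] by (simp add: power2_eq_square)
qed

section \<open>The potential of \<rho>\<close>

text \<open>
  A potential of \<open>\<rho>\<close>: up to a function of \<open>t\<close> alone, \<open>S\<^sub>t = U \<rho>\<close>, so the difference of \<open>S\<close> along two
  characteristics is conserved.  This replaces the pointwise equation for \<open>\<rho>\<close>, which holds only
  almost everywhere.
\<close>

definition S :: "real \<Rightarrow> real \<Rightarrow> real" where
  "S t x = Re (fhat (\<rho> t) 0) * x + Re (fourier_sum (antideriv_coeff (fhat (\<rho> t))) x)"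

lemma S_x:
  assumes t: "0 \<le> t" shows "(S t has_real_derivative \<rho> t x) (at x)"
proof -
  let ?c = "fhat (\<rho> t)"
  have l: "l2 ?c"
    using l2_weighted_coeff[OF sobolev_mono(1)[OF in_sobolev(3)[OF t], of 0]] by (simp add: l2_def cmod_weighted_coeff_0)
  have as: "abs_summable ?c" by (rule sobolev_1_abs_summable(1)[OF in_sobolev(3)[OF t]])
  have "abs_summable (\<lambda>k. of_int k * antideriv_coeff ?c k)"
  proof (rule summable_on_comparison_test[OF as])
    fix k
    have "cmod (?c k) * 1 \<le> cmod (?c k) * (2 * pi)" using pi_gt3 by (intro mult_left_mono) auto
    then show "cmod (of_int k * antideriv_coeff ?c k) \<le> cmod (?c k)"
      by (cases "k = 0") (auto simp: antideriv_coeff_def norm_mult norm_divide field_simps)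
  qed auto
  from fourier_sum_has_vector_derivative[OF abs_summable_antideriv_coeff(1)[OF l] this, of x]
  have vd: "(fourier_sum (antideriv_coeff ?c) has_vector_derivative fourier_sum (\<lambda>k. 2 * pi * \<i> * of_int k * antideriv_coeff ?c k) x) (at x)" .
  \<comment> \<open>\<open>antideriv_coeff\<close> discards the mean of \<rho>; \<open>e\<close>
    accounts for that loss, and the linear term of \<open>S\<close> restores it.\<close>
  define e where "e = (\<lambda>k::int. if k = 0 then - ?c 0 else 0)"
  have e: "abs_summable e"
    unfolding e_def by (subst summable_on_cong_neutral[where T = "{0}" and g = "\<lambda>k. cmod (?c 0)"]) auto
  have "fourier_sum (\<lambda>k. 2 * pi * \<i> * of_int k * antideriv_coeff ?c k) x = fourier_sum (\<lambda>k. ?c k + e k) x"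
    by (rule arg_cong[where f = "\<lambda>c. fourier_sum c x"]) (auto simp: antideriv_coeff_def e_def)
  also have "\<dots> = fourier_sum ?c x + fourier_sum e x" by (rule fourier_sum_add[OF as e])
  also have "fourier_sum ?c x = of_real (\<rho> t x)" by (rule sobolev_1_fourier_sum[OF in_sobolev(3)[OF t]])
  also have "fourier_sum e x = - ?c 0" unfolding e_def by (rule fourier_sum_delta)
  finally have "(fourier_sum (antideriv_coeff ?c) has_vector_derivative of_real (\<rho> t x) + - ?c 0) (at x)" using vd by simp
  from bounded_linear.has_vector_derivative[OF bounded_linear_Re this]
  have "((\<lambda>x. Re (fourier_sum (antideriv_coeff ?c) x)) has_real_derivative \<rho> t x - Re (?c 0)) (at x)"
    by (simp add: has_real_derivative_iff_has_vector_derivative)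
  from DERIV_add[OF DERIV_cmult_Id[of "Re (?c 0)"] this] show ?thesis unfolding S_def[abs_def] by simp
qed

text \<open>The coefficient of \<open>\<rho>\<^sub>t\<close> at index 0 vanishes, so only the
  periodic part of \<open>S\<close> moves. Its rate is the zero-mean antiderivative of
  \<open>\<rho>\<^sub>t\<close>, that is, U \<rho> minus its mean; the latter does not depend on
  \<open>x\<close>.\<close>

lemma S_t:
  assumes t: "0 \<le> t"
  shows "((\<lambda>\<tau>. S \<tau> x) has_real_derivative U t x * \<rho> t x - Re (fhat (\<lambda>x. U t x * \<rho> t x) 0)) (at t within {0..})"
proof -
  have l0: "l2 (fhat f)" if "f \<in> sobolev 0" for f
    using l2_weighted_coeff[OF that] by (simp add: l2_def cmod_weighted_coeff_0)
  have r0: "0 \<le> \<tau> \<Longrightarrow> \<rho> \<tau> \<in> sobolev 0" for \<tau> by (rule sobolev_mono(1)[OF in_sobolev(3)]) auto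
  let ?r = "fhat (\<rho>\<^sub>t t)" and ?p = "fhat (\<lambda>x. U t x * \<rho> t x)"
  define e where "e = (\<lambda>k::int. if k = 0 then ?p 0 else 0)"
  have e: "abs_summable e"
    unfolding e_def by (subst summable_on_cong_neutral[where T = "{0}" and g = "\<lambda>k. cmod (?p 0)"]) auto
  have fe: "fourier_sum e x = ?p 0" unfolding e_def by (rule fourier_sum_delta)
  have ar: "abs_summable (antideriv_coeff ?r)" by (rule abs_summable_antideriv_coeff(1)[OF l0[OF in_sobolev(5)[OF t]]])
  \<comment> \<open>Besides identifying the rate, this makes the coefficients of U \<rho> absolutely
    summable, so that its Fourier series represents it at every point.\<close>
  have pk: "?p = (\<lambda>k. antideriv_coeff ?r k + e k)"
    by (rule ext) (auto simp: antideriv_coeff_def fhat_rho_t[OF t] e_def)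
  have "abs_summable ?p"
    unfolding pk by (rule summable_on_comparison_test[OF summable_on_add[OF ar e]]) (auto simp: norm_triangle_ineq)
  then have "fourier_sum ?p x = of_real (U t x * \<rho> t x)"
    using periodic(2,4)[OF t] by (intro fourier_sum_fhat continuous_intros cont t) (auto simp: periodic1_def)
  moreover have "fourier_sum ?p x = fourier_sum (antideriv_coeff ?r) x + ?p 0"
    using fourier_sum_add[OF ar e, of x] unfolding pk[symmetric] fe .
  ultimately have fr: "Re (fourier_sum (antideriv_coeff ?r) x) = U t x * \<rho> t x - Re (?p 0)"
    by (metis Re_complex_of_real add_diff_cancel_right' minus_complex.sel(1))
  have r00: "?r 0 = 0" by (simp add: fhat_rho_t[OF t])
  \<comment> \<open>The error in the mean of \<rho> enters multiplied by \<open>x\<close>, the error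
    in the periodic part through the embedding constant.\<close>
  have lim: "((\<lambda>\<tau>. (\<bar>x\<bar> + embedding_const) * sobolev_norm 0 (\<lambda>x. (\<rho> \<tau> x - \<rho> t x) / (\<tau> - t) - \<rho>\<^sub>t t x)) \<longlongrightarrow> 0) (at t within {0..})"
    using tendsto_mult[OF tendsto_const sobolev_limits(4)[OF t], of "\<bar>x\<bar> + embedding_const"] by simp
  have "((\<lambda>\<tau>. (S \<tau> x - S t x) / (\<tau> - t) - (U t x * \<rho> t x - Re (?p 0))) \<longlongrightarrow> 0) (at t within {0..})"
  proof (rule Lim_null_comparison[OF _ lim])
    show "\<forall>\<^sub>F \<tau> in at t within {0..}. norm ((S \<tau> x - S t x) / (\<tau> - t) - (U t x * \<rho> t x - Re (?p 0)))
        \<le> (\<bar>x\<bar> + embedding_const) * sobolev_norm 0 (\<lambda>x. (\<rho> \<tau> x - \<rho> t x) / (\<tau> - t) - \<rho>\<^sub>t t x)"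
      unfolding eventually_at_filter
    proof (intro always_eventually allI impI)
      fix \<tau> :: real assume "\<tau> \<in> {0..}" "\<tau> \<noteq> t"
      then have \<tau>: "0 \<le> \<tau>" by simp
      let ?h = "\<tau> - t" and ?q = "\<lambda>x. (\<rho> \<tau> x - \<rho> t x) / (\<tau> - t) - \<rho>\<^sub>t t x"
      have q: "?q \<in> sobolev 0"
        using sobolev_diff[OF sobolev_cmult[OF sobolev_diff[OF r0[OF \<tau>] r0[OF t]], of "1 / ?h"] in_sobolev(5)[OF t]] by simp
      have fq: "fhat ?q k = (fhat (\<rho> \<tau>) k - fhat (\<rho> t) k) / of_real ?h - ?r k" for k
        by (rule fhat_quotient[OF r0[OF \<tau>] r0[OF t] in_sobolev(5)[OF t]])
      have a1: "abs_summable (antideriv_coeff (fhat (\<rho> \<tau>)))" "abs_summable (antideriv_coeff (fhat (\<rho> t)))" "abs_summable (antideriv_coeff (fhat ?q))"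
        by (intro abs_summable_antideriv_coeff(1) l0 r0 \<tau> t q)+
      have qx: "fhat (\<rho> \<tau>) k = fhat (\<rho> t) k + of_real ?h * (fhat ?q k + ?r k)" for k
        using \<open>\<tau> \<noteq> t\<close> unfolding fq by simp
      have sm: "abs_summable (\<lambda>k. of_real ?h * (antideriv_coeff (fhat ?q) k + antideriv_coeff ?r k))"
        unfolding norm_mult
        by (rule summable_on_cmult_right, rule summable_on_comparison_test[OF summable_on_add[OF a1(3) ar]])
           (auto simp: norm_triangle_ineq)
      have "fourier_sum (antideriv_coeff (fhat (\<rho> \<tau>))) x = fourier_sum (\<lambda>k. antideriv_coeff (fhat (\<rho> t)) k + of_real ?h * (antideriv_coeff (fhat ?q) k + antideriv_coeff ?r k)) x"
        by (rule arg_cong[where f = "\<lambda>c. fourier_sum c x"], rule ext) (simp add: antideriv_coeff_def qx add_divide_distrib[symmetric])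
      also have "\<dots> = fourier_sum (antideriv_coeff (fhat (\<rho> t))) x + of_real ?h * (fourier_sum (antideriv_coeff (fhat ?q)) x + fourier_sum (antideriv_coeff ?r) x)"
        by (subst fourier_sum_add[OF a1(2) sm]) (simp only: fourier_sum_cmult fourier_sum_add[OF a1(3) ar])
      finally have Re1: "Re (fourier_sum (antideriv_coeff (fhat (\<rho> \<tau>))) x) = Re (fourier_sum (antideriv_coeff (fhat (\<rho> t))) x) + ?h * (Re (fourier_sum (antideriv_coeff (fhat ?q)) x) + Re (fourier_sum (antideriv_coeff ?r) x))"
        by simp
      have Re2: "Re (fhat (\<rho> \<tau>) 0) = Re (fhat (\<rho> t) 0) + ?h * Re (fhat ?q 0)"
        unfolding qx[of 0] r00 by simp
      define b where "b = Re (fhat ?q 0)"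
      define d where "d = Re (fourier_sum (antideriv_coeff (fhat ?q)) x)"
      have eq0: "sobolev_norm 0 ?q = l2_norm (fhat ?q)" by (simp add: sobolev_norm_eq l2_norm_def cmod_weighted_coeff_0)
      have b: "\<bar>b\<bar> \<le> sobolev_norm 0 ?q"
        unfolding eq0 b_def by (rule order_trans[OF abs_Re_le_cmod cmod_le_l2_norm[OF l0[OF q]]])
      have d: "\<bar>d\<bar> \<le> embedding_const * sobolev_norm 0 ?q"
        unfolding eq0 d_def by (rule order_trans[OF abs_Re_le_cmod order_trans[OF norm_fourier_sum_le[OF a1(3)] abs_summable_antideriv_coeff(2)[OF l0[OF q]]]])
      have eq: "(S \<tau> x - S t x) / ?h - (U t x * \<rho> t x - Re (?p 0)) = b * x + d"
        unfolding S_def Re1 Re2 fr[symmetric] b_def[symmetric] d_def[symmetric] using \<open>\<tau> \<noteq> t\<close> by (simp add: field_simps)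
      have "\<bar>b * x\<bar> \<le> sobolev_norm 0 ?q * \<bar>x\<bar>" unfolding abs_mult by (intro mult_right_mono b) simp
      then have "\<bar>b * x + d\<bar> \<le> sobolev_norm 0 ?q * \<bar>x\<bar> + embedding_const * sobolev_norm 0 ?q"
        by (rule order_trans[OF abs_triangle_ineq add_mono[OF _ d]])
      then show "norm ((S \<tau> x - S t x) / ?h - (U t x * \<rho> t x - Re (?p 0))) \<le> (\<bar>x\<bar> + embedding_const) * sobolev_norm 0 ?q"
        unfolding eq by (simp add: distrib_left distrib_right mult.commute)
    qed
  qed
  then show ?thesis unfolding has_field_derivative_iff by (rule LIM_zero_cancel)
qed

end

section \<open>Characteristics and blow-up\<close>

lemma periodic1_integral_shift:
  fixes h :: "real \<Rightarrow> real"
  assumes h: "continuous_on UNIV h" "periodic1 h"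
  shows "(LBINT y:{0..1}. h (x + y)) = (LBINT y:{0..1}. h y)"
proof -
  obtain F where F: "\<And>x. (F has_vector_derivative h x) (at x)"
    using einterval_antiderivative[of "-\<infinity>" "\<infinity>" h] h(1) by (auto simp: continuous_on_eq_continuous_at)
  have sh: "((\<lambda>y. F (y + x)) has_vector_derivative h (y + x)) (at y)" for x y
    unfolding has_real_derivative_iff_has_vector_derivative[symmetric]
    by (rule DERIV_shift[THEN iffD1]) (simp add: F has_real_derivative_iff_has_vector_derivative)
  have "F (x + 1) - F x = F (0 + 1) - F 0"
  proof (rule DERIV_isconst_all[where f = "\<lambda>x. F (x + 1) - F x"])
    show "\<forall>x. ((\<lambda>x. F (x + 1) - F x) has_real_derivative 0) (at x)"
      using DERIV_diff[OF sh[of 1, folded has_real_derivative_iff_has_vector_derivative] F[folded has_real_derivative_iff_has_vector_derivative]] h(2)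
      by (simp add: periodic1_def)
  qed
  moreover have "(LBINT y:{0..1}. h (y + x)) = F (1 + x) - F (0 + x)"
    by (intro set_integral_FTC[where F = "\<lambda>y. F (y + x)"] sh continuous_on_compose2[OF h(1)] continuous_intros) auto
  moreover have "(LBINT y:{0..1}. h y) = F 1 - F 0"
    by (intro set_integral_FTC F h) auto
  ultimately show ?thesis by (simp add: add.commute)
qed

text \<open>
  Integrate \<open>(y - 1/2) f'(x + y)\<close> by parts; the constant \<open>sqrt 3 / 6\<close> is the \<open>L\<^sup>2\<close> norm of \<open>y - 1/2\<close>.
\<close>

lemma sup_deviation_from_mean:
  fixes f :: "real \<Rightarrow> real"
  assumes f: "\<And>x. (f has_real_derivative f' x) (at x)" and f': "continuous_on UNIV f'"
    and per: "periodic1 f" "periodic1 f'"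
  shows "\<bar>f x - circle_mean f\<bar> \<le> sqrt 3 / 6 * sqrt (LBINT y:{0..1}. (f' y)\<^sup>2)"
proof -
  have fc: "continuous_on UNIV f" using f by (meson DERIV_isCont continuous_at_imp_continuous_on)
  define h where "h = (\<lambda>y. f' (x + y))"
  define I where "I = f x - circle_mean f"
  define H where "H = (LBINT y:{0..1}. (f' y)\<^sup>2)"
  have fx: "continuous_on UNIV (\<lambda>y. f (x + y))"
    by (intro continuous_on_compose2[OF fc] continuous_intros) auto
  have hc: "continuous_on UNIV h"
    unfolding h_def by (intro continuous_on_compose2[OF f'] continuous_intros) auto
  have dfx: "((\<lambda>y. f (x + y)) has_real_derivative h y) (at y)" for y
    using DERIV_shift[THEN iffD1, OF f[of "y + x"]] by (simp add: h_def add.commute)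
  have "((\<lambda>y. (y - 1/2) * f (x + y)) has_vector_derivative f (x + y) + (y - 1/2) * h y) (at y)" for y
    unfolding has_real_derivative_iff_has_vector_derivative[symmetric]
    by (rule DERIV_cong[OF DERIV_mult[OF _ dfx]], (auto intro!: derivative_eq_intros)[1]) simp
  then have "(LBINT y:{0..1}. f (x + y) + (y - 1/2) * h y) = (1 - 1/2) * f (x + 1) - (0 - 1/2) * f (x + 0)"
    by (intro set_integral_FTC[where F = "\<lambda>y. (y - 1/2) * f (x + y)"] continuous_intros fx hc) auto
  also have "\<dots> = f x" using per(1) by (simp add: periodic1_def)
  also have "(LBINT y:{0..1}. f (x + y) + (y - 1/2) * h y) = (LBINT y:{0..1}. f (x + y)) + (LBINT y:{0..1}. (y - 1/2) * h y)"
    by (intro set_integral_add(2) continuous_set_integrable continuous_intros fx hc)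
  also have "(LBINT y:{0..1}. f (x + y)) = circle_mean f"
    unfolding circle_mean_def by (rule periodic1_integral_shift[OF fc per(1)])
  finally have I: "(LBINT y:{0..1}. (y - 1/2) * h y) = I" by (simp add: I_def)
  have "((\<lambda>y. (y - 1/2) ^ 3 / 3) has_vector_derivative (y - 1/2)\<^sup>2) (at y)" for y :: real
    unfolding has_real_derivative_iff_has_vector_derivative[symmetric]
    by (auto intro!: derivative_eq_intros)
  then have "(LBINT y:{0..1::real}. (y - 1/2)\<^sup>2) = (1 - 1/2) ^ 3 / 3 - (0 - 1/2) ^ 3 / 3"
    by (intro set_integral_FTC[where F = "\<lambda>y. (y - 1/2) ^ 3 / 3"] continuous_intros) auto
  then have Q: "(LBINT y:{0..1::real}. (y - 1/2)\<^sup>2) = 1/12" by (simp add: power3_eq_cube)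
  have HH: "(LBINT y:{0..1}. (h y)\<^sup>2) = H"
    unfolding h_def H_def using per(2)
    by (intro periodic1_integral_shift[where h = "\<lambda>y. (f' y)\<^sup>2"] continuous_intros f') (simp add: periodic1_def)
  \<comment> \<open>This square replaces Cauchy-Schwarz: as y - 1/2 has squared norm 1/12,
    \<open>12 * I\<close> is the coefficient of the projection of \<open>h\<close> onto it.\<close>
  have "0 \<le> (LBINT y:{0..1}. (h y - 12 * I * (y - 1/2))\<^sup>2)"
    unfolding set_lebesgue_integral_def by (intro Bochner_Integration.integral_nonneg) auto
  also have "(LBINT y:{0..1}. (h y - 12 * I * (y - 1/2))\<^sup>2)
      = (LBINT y:{0..1}. ((h y)\<^sup>2 - 24 * I * ((y - 1/2) * h y)) + 144 * I\<^sup>2 * (y - 1/2)\<^sup>2)"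
    by (intro arg_cong[where f = "set_lebesgue_integral lborel {0..1}"] ext) (simp add: power2_eq_square algebra_simps)
  also have "\<dots> = (H - 24 * I * I) + 144 * I\<^sup>2 * (1/12)"
    unfolding HH[symmetric] Q[symmetric]
    by (subst set_integral_add(2), (intro continuous_set_integrable continuous_intros hc)+,
        subst set_integral_diff(2), (intro continuous_set_integrable continuous_intros hc)+) (simp add: I)
  finally have "I\<^sup>2 \<le> H / 12" by (simp add: power2_eq_square)
  also have "H / 12 = (sqrt 3 / 6)\<^sup>2 * H" by (simp add: power_divide)
  finally have "sqrt (I\<^sup>2) \<le> sqrt ((sqrt 3 / 6)\<^sup>2 * H)" by (rule real_sqrt_le_mono)
  then show ?thesis by (simp add: real_sqrt_mult I_def H_def)
qed

section \<open>Calculus along curves and existence of characteristics\<close>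

text \<open>No order of the endpoints is assumed, so later arguments need not know which
  characteristic lies to the right.\<close>

lemma mean_value_between:
  fixes f :: "real \<Rightarrow> real"
  assumes "\<And>x. (f has_real_derivative f' x) (at x)"
  obtains \<xi> where "\<xi> \<in> closed_segment a b" "f b - f a = (b - a) * f' \<xi>"
proof -
  consider "a < b" | "a = b" | "b < a" by linarith
  then show ?thesis
  proof cases
    case 1
    from MVT2[OF this assms] obtain z where "a < z" "z < b" "f b - f a = (b - a) * f' z" by blast
    then show ?thesis using that[of z] 1 by (simp add: closed_segment_eq_real_ivl)
  next
    case 2
    then show ?thesis using that[of a] by simp
  next
    case 3
    from MVT2[OF this assms] obtain z where "b < z" "z < a" "f a - f b = (a - b) * f' z" by blast
    then show ?thesis using that[of z] 3 by (simp add: closed_segment_eq_real_ivl algebra_simps)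
  qed
qed

lemma closed_segment_dist:
  fixes a b x y :: real
  assumes "x \<in> closed_segment a b" "y \<in> closed_segment a b"
  shows "\<bar>x - y\<bar> \<le> \<bar>b - a\<bar>"
  using assms by (auto simp: closed_segment_eq_real_ivl split: if_splits)

text \<open>Joint differentiability of \<open>F\<close> is not assumed. The increment is split at
  time \<tau> and position \<open>p t\<close>: the time part uses the derivative at the fixed
  position, the space part the mean value theorem and joint continuity of \<open>Fx\<close>.\<close>

lemma has_derivative_along_curve:
  fixes F Fx :: "real \<Rightarrow> real \<Rightarrow> real"
  assumes Ft: "((\<lambda>\<tau>. F \<tau> (p t)) has_real_derivative a) (at t within A)"
    and Fx: "\<And>\<tau> x. \<tau> \<in> A \<Longrightarrow> (F \<tau> has_real_derivative Fx \<tau> x) (at x)"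
    and cont: "continuous_on (A \<times> UNIV) (\<lambda>(t, x). Fx t x)"
    and p: "(p has_real_derivative b) (at t within A)" and t: "t \<in> A"
  shows "((\<lambda>\<tau>. F \<tau> (p \<tau>)) has_real_derivative a + Fx t (p t) * b) (at t within A)"
proof -
  have "\<exists>\<xi>. \<tau> \<in> A \<longrightarrow> \<bar>\<xi> - p t\<bar> \<le> \<bar>p \<tau> - p t\<bar> \<and> F \<tau> (p \<tau>) - F \<tau> (p t) = (p \<tau> - p t) * Fx \<tau> \<xi>" for \<tau>
  proof (cases "\<tau> \<in> A")
    case True
    from mean_value_between[of "F \<tau>" "Fx \<tau>" "p t" "p \<tau>", OF Fx[OF True]]
    show ?thesis using closed_segment_dist[of _ "p t" "p \<tau>" "p t"] by (metis ends_in_segment(1))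
  qed simp
  then obtain \<xi> where \<xi>: "\<And>\<tau>. \<tau> \<in> A \<Longrightarrow> \<bar>\<xi> \<tau> - p t\<bar> \<le> \<bar>p \<tau> - p t\<bar>"
      "\<And>\<tau>. \<tau> \<in> A \<Longrightarrow> F \<tau> (p \<tau>) - F \<tau> (p t) = (p \<tau> - p t) * Fx \<tau> (\<xi> \<tau>)" by metis
  have inA: "\<forall>\<^sub>F \<tau> in at t within A. \<tau> \<in> A" by (simp add: eventually_at_filter)
  have "(p \<longlongrightarrow> p t) (at t within A)"
    using DERIV_continuous[OF p] by (simp add: continuous_within)
  then have "((\<lambda>\<tau>. \<bar>p \<tau> - p t\<bar>) \<longlongrightarrow> \<bar>p t - p t\<bar>) (at t within A)" by (intro tendsto_intros)
  then have "((\<lambda>\<tau>. \<bar>p \<tau> - p t\<bar>) \<longlongrightarrow> 0) (at t within A)" by simp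
  then have "((\<lambda>\<tau>. \<xi> \<tau> - p t) \<longlongrightarrow> 0) (at t within A)"
    by (rule Lim_null_comparison[rotated]) (use inA in eventually_elim, simp add: \<xi>(1))
  then have "(\<xi> \<longlongrightarrow> p t) (at t within A)" by (rule LIM_zero_cancel)
  then have "((\<lambda>\<tau>. (\<tau>, \<xi> \<tau>)) \<longlongrightarrow> (t, p t)) (at t within A)" by (intro tendsto_Pair tendsto_ident_at)
  from continuous_on_tendsto_compose[OF cont this]
  have "((\<lambda>\<tau>. Fx \<tau> (\<xi> \<tau>)) \<longlongrightarrow> Fx t (p t)) (at t within A)" using t inA by simp
  then have "((\<lambda>\<tau>. (F \<tau> (p t) - F t (p t)) / (\<tau> - t) + Fx \<tau> (\<xi> \<tau>) * ((p \<tau> - p t) / (\<tau> - t))) \<longlongrightarrow> a + Fx t (p t) * b) (at t within A)"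
    using Ft p unfolding has_field_derivative_iff by (intro tendsto_intros)
  then show ?thesis unfolding has_field_derivative_iff
  proof (rule Lim_transform_eventually)
    show "\<forall>\<^sub>F \<tau> in at t within A. (F \<tau> (p t) - F t (p t)) / (\<tau> - t) + Fx \<tau> (\<xi> \<tau>) * ((p \<tau> - p t) / (\<tau> - t)) = (F \<tau> (p \<tau>) - F t (p t)) / (\<tau> - t)"
      using inA
    proof eventually_elim
      case (elim \<tau>)
      have eq: "F \<tau> (p \<tau>) - F t (p t) = (F \<tau> (p t) - F t (p t)) + Fx \<tau> (\<xi> \<tau>) * (p \<tau> - p t)"
        using \<xi>(2)[OF elim] by (simp add: algebra_simps)
      show ?case unfolding eq add_divide_distrib by simp
    qed
  qed
qed

lemma derivative_ge_imp_growth: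
  fixes f :: "real \<Rightarrow> real"
  assumes "\<And>t. t \<in> {0..T} \<Longrightarrow> (f has_real_derivative f' t) (at t within {0..T})"
    and "\<And>t. t \<in> {0..T} \<Longrightarrow> \<kappa> \<le> f' t" and t: "t \<in> {0..T}"
  shows "f 0 + \<kappa> * t \<le> f t"
proof -
  have "\<exists>x\<in>{0..t}. f t - f 0 = f' x * (t - 0)"
  proof (rule mvt_very_simple[where f' = "\<lambda>x h. f' x * h"])
    fix x assume "0 \<le> x" "x \<le> t"
    then show "(f has_derivative (*) (f' x)) (at x within {0..t})"
      using assms(1)[of x] t unfolding has_field_derivative_def by (auto intro: has_derivative_subset)
  qed (use t in auto)
  then obtain x where x: "x \<in> {0..t}" "f t - f 0 = f' x * t" by auto
  have "\<kappa> * t \<le> f' x * t" using x t by (intro mult_right_mono assms(2)) auto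
  with x show ?thesis by linarith
qed

text \<open>
  Writing \<open>p t = x0 + exp (K * t) * z t\<close> with \<open>K > 2 * L\<close> makes the Picard map a contraction in \<open>z\<close> on the
  whole interval.
\<close>

lemma lipschitz_ode_solution:
  fixes b :: "real \<Rightarrow> real \<Rightarrow> real"
  assumes cont: "continuous_on ({0..T} \<times> UNIV) (\<lambda>(t, x). b t x)"
    and lip: "\<And>t x y. t \<in> {0..T} \<Longrightarrow> \<bar>b t x - b t y\<bar> \<le> L * \<bar>x - y\<bar>"
    and bd: "\<And>t x. t \<in> {0..T} \<Longrightarrow> \<bar>b t x\<bar> \<le> M" and T: "0 \<le> T"
  obtains p where "p 0 = x0" "\<And>t. t \<in> {0..T} \<Longrightarrow> (p has_real_derivative b t (p t)) (at t within {0..T})"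
proof -
  have L: "0 \<le> L" using lip[of 0 0 1] T by auto
  have M: "0 \<le> M" using bd[of 0 0] T by auto
  \<comment> \<open>The contraction factor comes out as L / K, at most 1/2; the added 1 keeps
    \<open>K\<close> positive when \<open>L\<close> is 0.\<close>
  define K where "K = 2 * L + 1"
  have K: "0 < K" using L by (simp add: K_def)
  \<comment> \<open>Bounded continuous functions are defined on the whole line, so time is clamped
    to [0,T].\<close>
  define c where "c = (\<lambda>t. max 0 (min T t))"
  have cI: "c t \<in> {0..T}" for t using T by (simp add: c_def)
  have cc: "continuous_on UNIV c" unfolding c_def by (intro continuous_intros)
  define G where "G = (\<lambda>(z :: real \<Rightarrow>\<^sub>C real) s. b s (x0 + exp (K * s) * apply_bcontfun z s))"
  have Gc: "continuous_on {0..T} (G z)" for z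
    unfolding G_def
    by (intro continuous_on_compose2[OF cont, where f = "\<lambda>s. (s, x0 + exp (K * s) * apply_bcontfun z s)", simplified] continuous_intros) auto
  have Gi: "G z integrable_on {0..r}" if "r \<le> T" for z r
    using that by (intro integrable_continuous_interval continuous_on_subset[OF Gc]) auto
  define \<Psi> where "\<Psi> = (\<lambda>z t. exp (- (K * c t)) * integral {0..c t} (G z))"
  have ic: "continuous_on {0..T} (\<lambda>r. integral {0..r} (G z))" for z
    by (rule indefinite_integral_continuous_1[OF Gi]) simp
  have \<Psi>c: "continuous_on UNIV (\<Psi> z)" for z
    unfolding \<Psi>_def using cI
    by (intro continuous_intros cc continuous_on_compose2[OF ic cc]) auto
  have \<Psi>b: "norm (\<Psi> z t) \<le> M * T" for z t
  proof -
    have r: "c t \<in> {0..T}" by (rule cI)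
    have "norm (integral {0..c t} (G z)) \<le> M * (c t - 0)"
      using r bd unfolding G_def
      by (intro integral_bound continuous_on_subset[OF Gc[unfolded G_def]]) auto
    also have "\<dots> \<le> M * T" using r M by (intro mult_left_mono) auto
    finally have i: "norm (integral {0..c t} (G z)) \<le> M * T" .
    have "norm (\<Psi> z t) \<le> 1 * norm (integral {0..c t} (G z))"
      unfolding \<Psi>_def norm_mult using r K by (intro mult_right_mono) auto
    with i show ?thesis by simp
  qed
  have \<Psi>in: "\<Psi> z \<in> bcontfun" for z by (rule bcontfun_normI[OF \<Psi>c \<Psi>b])
  define \<Phi> where "\<Phi> = (\<lambda>z. Bcontfun (\<Psi> z))"
  have \<Phi>: "apply_bcontfun (\<Phi> z) = \<Psi> z" for z unfolding \<Phi>_def by (rule Bcontfun_inverse[OF \<Psi>in])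
  have "\<exists>!z\<in>UNIV. \<Phi> z = z"
  proof (rule Banach_fix[where c = "1/2"])
    show "complete (UNIV :: (real \<Rightarrow>\<^sub>C real) set)" by (rule complete_UNIV)
    fix y z :: "real \<Rightarrow>\<^sub>C real"
    show "dist (\<Phi> y) (\<Phi> z) \<le> 1/2 * dist y z"
    proof (rule dist_bound)
      fix t
      let ?d = "dist y z"
      have r: "c t \<in> {0..T}" by (rule cI)
      have ftc: "((\<lambda>s. L * ?d * exp (K * s)) has_integral (L * ?d * exp (K * c t) / K - L * ?d * exp (K * 0) / K)) {0..c t}"
        using r K by (intro fundamental_theorem_of_calculus)
          (auto simp: has_real_derivative_iff_has_vector_derivative[symmetric] intro!: derivative_eq_intros)
      have "\<bar>integral {0..c t} (G y) - integral {0..c t} (G z)\<bar> = norm (integral {0..c t} (\<lambda>s. G y s - G z s))"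
        using r by (subst integral_diff) (auto intro: Gi)
      also have "\<dots> \<le> integral {0..c t} (\<lambda>s. L * ?d * exp (K * s))"
      proof (rule integral_norm_bound_integral)
        show "(\<lambda>s. G y s - G z s) integrable_on {0..c t}" using r by (intro integrable_diff Gi) auto
        show "(\<lambda>s. L * ?d * exp (K * s)) integrable_on {0..c t}" using ftc by blast
        fix s assume s: "s \<in> {0..c t}"
        then have "\<bar>G y s - G z s\<bar> \<le> L * \<bar>exp (K * s) * (apply_bcontfun y s - apply_bcontfun z s)\<bar>"
          using lip[of s "x0 + exp (K * s) * apply_bcontfun y s" "x0 + exp (K * s) * apply_bcontfun z s"] r
          by (simp add: G_def right_diff_distrib)
        also have "\<dots> = L * (exp (K * s) * \<bar>apply_bcontfun y s - apply_bcontfun z s\<bar>)"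
          by (simp add: abs_mult)
        also have "\<dots> \<le> L * (exp (K * s) * ?d)"
          using dist_bounded[of y s z] L by (intro mult_left_mono) (auto simp: dist_real_def)
        finally show "norm (G y s - G z s) \<le> L * ?d * exp (K * s)" by (simp add: mult_ac)
      qed
      also have "\<dots> = L * ?d * exp (K * c t) / K - L * ?d * exp (K * 0) / K"
        using ftc by (rule integral_unique)
      also have "\<dots> \<le> L * ?d * exp (K * c t) / K" using L K by simp
      finally have i: "\<bar>integral {0..c t} (G y) - integral {0..c t} (G z)\<bar> \<le> L * ?d * exp (K * c t) / K" .
      have "dist (apply_bcontfun (\<Phi> y) t) (apply_bcontfun (\<Phi> z) t)
          = exp (- (K * c t)) * \<bar>integral {0..c t} (G y) - integral {0..c t} (G z)\<bar>"
        unfolding \<Phi> \<Psi>_def dist_real_def right_diff_distrib[symmetric] by (simp add: abs_mult)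
      also have "\<dots> \<le> exp (- (K * c t)) * (L * ?d * exp (K * c t) / K)"
        by (intro mult_left_mono i) auto
      also have "\<dots> = L / K * ?d" by (simp add: exp_minus field_simps)
      also have "\<dots> \<le> 1/2 * ?d"
        using L K by (intro mult_right_mono) (auto simp: K_def field_simps)
      finally show "dist (apply_bcontfun (\<Phi> y) t) (apply_bcontfun (\<Phi> z) t) \<le> 1/2 * ?d" .
    qed
  qed auto
  then obtain z where z: "\<Phi> z = z" by blast
  define p where "p = (\<lambda>t. x0 + exp (K * t) * apply_bcontfun z t)"
  have pI: "p t = x0 + integral {0..t} (\<lambda>s. b s (p s))" if t: "t \<in> {0..T}" for t
  proof -
    have ct: "c t = t" using t by (simp add: c_def)
    have "apply_bcontfun z t = exp (- (K * t)) * integral {0..t} (G z)"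
      using arg_cong[OF z, of "\<lambda>z. apply_bcontfun z t"] unfolding \<Phi> \<Psi>_def ct by simp
    then show ?thesis by (simp add: p_def G_def exp_minus)
  qed
  have "((\<lambda>t. x0 + integral {0..t} (\<lambda>s. b s (p s))) has_real_derivative 0 + b t (p t)) (at t within {0..T})" if "t \<in> {0..T}" for t
    using Gc[of z] that unfolding G_def p_def by (intro DERIV_add DERIV_const integral_has_real_derivative)
  then have "(p has_real_derivative b t (p t)) (at t within {0..T})" if "t \<in> {0..T}" for t
    using has_field_derivative_transform_within[OF _ zero_less_one that, of _ "b t (p t)" p] pI that by force
  then show ?thesis using that[of p] pI[of 0] T by simp
qed

section \<open>Contradiction for a global solution\<close>

context global_mu_HS
begin

lemma u_bound:
  assumes t: "0 \<le> t"
  shows "\<bar>u t x - circle_mean (u 0)\<bar> \<le> sqrt 3 / 6 * sqrt (energy 0)"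
proof -
  have "\<bar>u t x - circle_mean (u t)\<bar> \<le> sqrt 3 / 6 * sqrt (LBINT y:{0..1}. (v t y)\<^sup>2)"
    by (rule sup_deviation_from_mean[OF u_x[OF t] cont(3)[OF t] periodic(1,3)[OF t]])
  also have "(LBINT y:{0..1}. (v t y)\<^sup>2) \<le> energy t"
    unfolding energy_def by (intro set_integral_mono continuous_set_integrable continuous_intros cont t) auto
  then have "sqrt 3 / 6 * sqrt (LBINT y:{0..1}. (v t y)\<^sup>2) \<le> sqrt 3 / 6 * sqrt (energy t)"
    by (intro mult_left_mono real_sqrt_le_mono) auto
  finally show ?thesis using mean_const[OF t] energy_const[OF t] by simp
qed

text \<open>Periodicity reduces the claim to the compact set [0,T] x [0,1], where joint continuity
  applies.\<close>

lemma v_bounded: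
  obtains L where "0 \<le> L" "\<And>t x. t \<in> {0..T} \<Longrightarrow> \<bar>v t x\<bar> \<le> L"
proof -
  have "compact ((\<lambda>(t, x). v t x) ` ({0..T} \<times> {0..1}))"
    by (intro compact_continuous_image continuous_on_subset[OF joint_cont(2)] compact_Times) auto
  then obtain L where L: "\<forall>y\<in>(\<lambda>(t, x). v t x) ` ({0..T} \<times> {0..1}). norm y \<le> L"
    using compact_imp_bounded bounded_iff by metis
  have "\<bar>v t x\<bar> \<le> max L 0" if t: "t \<in> {0..T}" for t x
  proof -
    have "v t (frac x) \<in> (\<lambda>(t, x). v t x) ` ({0..T} \<times> {0..1})"
      using t frac_lt_1[of x] frac_ge_0[of x] by (intro image_eqI[of _ _ "(t, frac x)"]) auto
    with L have "\<bar>v t (frac x)\<bar> \<le> L" by auto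
    then show ?thesis using periodic_frac[of "v t" x] periodic(3)[of t] t by (simp add: periodic1_def)
  qed
  then show ?thesis using that[of "max L 0"] by auto
qed

lemma finite_time_blow_up:
  assumes gap: "2 * \<bar>circle_mean (u 0)\<bar> * (\<bar>circle_mean (u 0)\<bar> + sqrt 3 / 6 * sqrt (energy 0))
      < 2 * (circle_mean (u 0))\<^sup>2 + 1/2 * energy 0"
    and zero: "\<rho> 0 x0 = 0"
  shows False
proof -
  define \<mu> where "\<mu> = circle_mean (u 0)"
  define B where "B = \<bar>\<mu>\<bar> + sqrt 3 / 6 * sqrt (energy 0)"
  define a where "a = 2 * \<mu>\<^sup>2 + 1/2 * energy 0"
  \<comment> \<open>Since |u| \<le> B at all times, \<open>c\<close> bounds a - 2 \<mu> u from below
    everywhere; \<open>gap\<close> says that it is positive.\<close>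
  define c where "c = a - 2 * \<bar>\<mu>\<bar> * B"
  have c: "c > 0" using gap unfolding c_def a_def B_def \<mu>_def by simp
  have uB: "\<bar>u t x\<bar> \<le> B" if "0 \<le> t" for t x
    using u_bound[OF that, of x] unfolding B_def \<mu>_def by linarith
  have ac: "c \<le> a - 2 * \<mu> * u t x" if "0 \<le> t" for t x
  proof -
    have "\<mu> * u t x \<le> \<bar>\<mu>\<bar> * B"
      using mult_mono[OF order_refl uB[OF that, of x], of "\<bar>\<mu>\<bar>"] abs_ge_self[of "\<mu> * u t x"]
      by (simp add: abs_mult)
    then show ?thesis unfolding c_def by simp
  qed
  \<comment> \<open>no solution of the Riccati inequality \<open>D' \<ge> (c + D\<^sup>2) / 2\<close> exists on an interval of this length\<close>
  define T where "T = 2 * pi / sqrt c"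
  have T: "0 < T" using c by (simp add: T_def)
  obtain L where L: "0 \<le> L" "\<And>t x. t \<in> {0..T} \<Longrightarrow> \<bar>v t x\<bar> \<le> L" using v_bounded by blast
  have lip: "\<bar>u t x - u t y\<bar> \<le> L * \<bar>x - y\<bar>" if "t \<in> {0..T}" for t x y
    using field_differentiable_bound[of UNIV "u t" "v t" L x y] u_x L(2)[OF that] that by simp
  define M where "M = B + \<bar>\<gamma>\<bar>"
  have flow: "\<exists>p. p 0 = y \<and> (\<forall>t\<in>{0..T}. (p has_real_derivative - U t (p t)) (at t within {0..T}))" for y
  proof -
    have "continuous_on ({0..T} \<times> UNIV) (\<lambda>(t, x). u t x)"
      by (rule continuous_on_subset[OF joint_cont(1)]) auto
    then have "continuous_on ({0..T} \<times> UNIV) (\<lambda>(t, x). - U t x)"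
      unfolding U_def split_beta by (intro continuous_intros)
    then obtain p where "p 0 = y" "\<And>t. t \<in> {0..T} \<Longrightarrow> (p has_real_derivative - U t (p t)) (at t within {0..T})"
    proof (rule lipschitz_ode_solution[where ?x0.0 = y])
      show "\<bar>- U t x - - U t y\<bar> \<le> L * \<bar>x - y\<bar>" if "t \<in> {0..T}" for t x y
        using lip[OF that, of x y] unfolding U_def by (simp add: abs_minus_commute)
      show "\<bar>- U t x\<bar> \<le> M" if "t \<in> {0..T}" for t x
        using uB[of t x] that unfolding U_def M_def by auto
    qed (use T in auto)
    then show ?thesis by blast
  qed
  \<comment> \<open>Characteristics have speed at most \<open>M\<close>, so those starting within
    distance 1 of \<open>x0\<close> stay in [-R,R] up to time \<open>T\<close>. Uniform continuity
    is used on that rectangle.\<close>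
  define R where "R = \<bar>x0\<bar> + 1 + M * T"
  \<comment> \<open>\<open>r\<close> is the admissible size of |\<rho>|, as r^2 = c/2. Of the bounds
    in \<epsilon>, the first keeps the variation of v^2 below c/2, because |v| \<le> L; the second
    is half of \<open>r\<close>, the other half being reserved for \<rho> at one intermediate
    point.\<close>
  define r where "r = sqrt (c / 2)"
  have r: "r > 0" using c by (simp add: r_def)
  define \<epsilon> where "\<epsilon> = min (c / (4 * (L + 1))) (r / 2)"
  have \<epsilon>: "\<epsilon> > 0" using c r L by (simp add: \<epsilon>_def)
  let ?K = "{0..T} \<times> {-R..R}"
  have "uniformly_continuous_on ?K (\<lambda>(t, x). v t x)" "uniformly_continuous_on ?K (\<lambda>(t, x). \<rho> t x)"
    by (intro compact_uniformly_continuous continuous_on_subset[OF joint_cont(2)] continuous_on_subset[OF joint_cont(3)] compact_Times; auto)+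
  then obtain d1 d2 where d1: "d1 > 0" "\<And>z z'. z \<in> ?K \<Longrightarrow> z' \<in> ?K \<Longrightarrow> dist z' z < d1 \<Longrightarrow> dist (case z' of (t, x) \<Rightarrow> v t x) (case z of (t, x) \<Rightarrow> v t x) < \<epsilon>"
    and d2: "d2 > 0" "\<And>z z'. z \<in> ?K \<Longrightarrow> z' \<in> ?K \<Longrightarrow> dist z' z < d2 \<Longrightarrow> dist (case z' of (t, x) \<Rightarrow> \<rho> t x) (case z of (t, x) \<Rightarrow> \<rho> t x) < \<epsilon>"
    unfolding uniformly_continuous_on_def using \<epsilon> by metis
  have "isCont (\<rho> 0) x0" using cont(2)[of 0] by (simp add: continuous_on_eq_continuous_at)
  \<comment> \<open>The exponential compensates the largest possible shrinking of the gap, which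
    would amplify \<rho> by its inverse.\<close>
  moreover have "r / 2 * exp (- (L * T)) > 0" using r by simp
  ultimately obtain d3 where d3: "d3 > 0" "\<And>x. dist x x0 < d3 \<Longrightarrow> dist (\<rho> 0 x) (\<rho> 0 x0) < r / 2 * exp (- (L * T))"
    unfolding continuous_at_eps_delta by blast
  define \<delta> where "\<delta> = min d1 d2"
  \<comment> \<open>In turn: the gap stays below \<delta> although it may grow by exp (L T), the
    starting segment lies where the initial \<rho> is small, and both characteristics start in the
    range covered by \<open>R\<close>.\<close>
  define g0 where "g0 = min (\<delta> * exp (- (L * T)) / 2) (min (d3 / 2) 1)"
  have \<delta>: "\<delta> > 0" using d1 d2 by (simp add: \<delta>_def)
  have g0: "g0 > 0" "g0 < d3" "g0 \<le> 1" "g0 * exp (L * T) < \<delta>"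
  proof -
    show "g0 > 0" "g0 < d3" "g0 \<le> 1" using \<delta> d3(1) by (auto simp: g0_def)
    have "g0 * exp (L * T) \<le> (\<delta> * exp (- (L * T)) / 2) * exp (L * T)"
      by (intro mult_right_mono) (auto simp: g0_def)
    also have "\<dots> < \<delta>" using \<delta> by (simp add: exp_minus)
    finally show "g0 * exp (L * T) < \<delta>" .
  qed
  obtain p q where p: "p 0 = x0" "\<And>t. t \<in> {0..T} \<Longrightarrow> (p has_real_derivative - U t (p t)) (at t within {0..T})"
    and q: "q 0 = x0 + g0" "\<And>t. t \<in> {0..T} \<Longrightarrow> (q has_real_derivative - U t (q t)) (at t within {0..T})"
    using flow by metis
  have stay: "\<bar>f t\<bar> \<le> R" if f: "\<bar>f 0\<bar> \<le> \<bar>x0\<bar> + 1" "\<And>t. t \<in> {0..T} \<Longrightarrow> (f has_real_derivative - U t (f t)) (at t within {0..T})"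
    and t: "t \<in> {0..T}" for f t
  proof -
    have "norm (f t - f 0) \<le> M * norm (t - 0)"
    proof (rule field_differentiable_bound[where S = "{0..T}" and f' = "\<lambda>t. - U t (f t)"])
      show "norm (- U s (f s)) \<le> M" if "s \<in> {0..T}" for s
        using uB[of s "f s"] that unfolding U_def M_def by auto
    qed (use f t T in auto)
    moreover have "M * norm (t - 0) \<le> M * T"
      using t uB[of 0 0] unfolding M_def by (intro mult_left_mono) auto
    ultimately show ?thesis using f(1) unfolding R_def by simp
  qed
  have pR: "\<bar>p t\<bar> \<le> R" "\<bar>q t\<bar> \<le> R" if "t \<in> {0..T}" for t
    using stay[of p t] stay[of q t] p q g0 that by auto
  define g where "g = (\<lambda>t. q t - p t)"
  define N where "N = (\<lambda>t. u t (q t) - u t (p t))"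
  have g': "(g has_real_derivative - N t) (at t within {0..T})" if "t \<in> {0..T}" for t
    using DERIV_diff[OF q(2)[OF that] p(2)[OF that]] unfolding g_def[abs_def] N_def U_def by simp
  have Ng: "\<bar>N t\<bar> \<le> L * \<bar>g t\<bar>" if "t \<in> {0..T}" for t
    unfolding N_def g_def by (rule lip[OF that])
  have Ngg: "\<bar>N t * g t\<bar> \<le> L * (g t)\<^sup>2" if "t \<in> {0..T}" for t
    using mult_right_mono[OF Ng[OF that], of "\<bar>g t\<bar>"] by (simp add: abs_mult power2_eq_square mult.assoc)
  \<comment> \<open>Gronwall's argument on the square of the gap, so that its sign does not matter:
    g' = - N with |N| \<le> L |g| makes this product nondecreasing.\<close>
  have lower: "g0\<^sup>2 \<le> (g t)\<^sup>2 * exp (2 * L * t)" if t: "t \<in> {0..T}" for t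
  proof -
    have "(g 0)\<^sup>2 * exp (2 * L * 0) + 0 * t \<le> (g t)\<^sup>2 * exp (2 * L * t)"
    proof (rule derivative_ge_imp_growth[where f' = "\<lambda>t. (2 * L * (g t)\<^sup>2 - 2 * (N t * g t)) * exp (2 * L * t)", OF _ _ t])
      fix s assume s: "s \<in> {0..T}"
      show "((\<lambda>t. (g t)\<^sup>2 * exp (2 * L * t)) has_real_derivative (2 * L * (g s)\<^sup>2 - 2 * (N s * g s)) * exp (2 * L * s)) (at s within {0..T})"
        by (rule derivative_eq_intros g'[OF s] refl | simp add: algebra_simps)+
      show "0 \<le> (2 * L * (g s)\<^sup>2 - 2 * (N s * g s)) * exp (2 * L * s)"
        using Ngg[OF s] by (intro mult_nonneg_nonneg) auto
    qed
    then show ?thesis using p q by (simp add: g_def)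
  qed
  have upper: "(g t)\<^sup>2 * exp (- (2 * L * t)) \<le> g0\<^sup>2" if t: "t \<in> {0..T}" for t
  proof -
    have "- ((g 0)\<^sup>2 * exp (- (2 * L * 0))) + 0 * t \<le> - ((g t)\<^sup>2 * exp (- (2 * L * t)))"
    proof (rule derivative_ge_imp_growth[where f' = "\<lambda>t. (2 * L * (g t)\<^sup>2 + 2 * (N t * g t)) * exp (- (2 * L * t))", OF _ _ t])
      fix s assume s: "s \<in> {0..T}"
      show "((\<lambda>t. - ((g t)\<^sup>2 * exp (- (2 * L * t)))) has_real_derivative (2 * L * (g s)\<^sup>2 + 2 * (N s * g s)) * exp (- (2 * L * s))) (at s within {0..T})"
        by (rule derivative_eq_intros g'[OF s] refl | simp add: algebra_simps)+
      show "0 \<le> (2 * L * (g s)\<^sup>2 + 2 * (N s * g s)) * exp (- (2 * L * s))"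
        using Ngg[OF s] by (intro mult_nonneg_nonneg) auto
    qed
    then show ?thesis using p q by (simp add: g_def)
  qed
  have LT: "L * t \<le> L * T" if "t \<in> {0..T}" for t using L that by (intro mult_left_mono) auto
  have gl: "g0 * exp (- (L * T)) \<le> \<bar>g t\<bar>" if t: "t \<in> {0..T}" for t
  proof -
    have "\<bar>g0\<bar> \<le> \<bar>g t * exp (L * t)\<bar>"
      unfolding abs_le_square_iff power_mult_distrib exp_double[symmetric] using lower[OF t] by (simp add: mult.assoc)
    also have "\<dots> \<le> \<bar>g t\<bar> * exp (L * T)" unfolding abs_mult using LT[OF t] by (intro mult_left_mono) auto
    finally show ?thesis using g0 by (simp add: exp_minus field_simps)
  qed
  have gu: "\<bar>g t\<bar> < \<delta>" if t: "t \<in> {0..T}" for t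
  proof -
    have "\<bar>g t * exp (- (L * t))\<bar> \<le> \<bar>g0\<bar>"
      unfolding abs_le_square_iff power_mult_distrib exp_double[symmetric] using upper[OF t] by (simp add: mult.assoc)
    then have "\<bar>g t\<bar> \<le> g0 * exp (L * t)" using g0 by (simp add: abs_mult exp_minus field_simps)
    also have "\<dots> \<le> g0 * exp (L * T)" using g0 LT[OF t] by (intro mult_left_mono) auto
    finally show ?thesis using g0 by simp
  qed
  have gnz: "g t \<noteq> 0" if t: "t \<in> {0..T}" for t using gl[OF t] mult_pos_pos[OF g0(1) exp_gt_zero[of "- (L * T)"]] by auto
  have seg: "(t, x) \<in> ?K" if "t \<in> {0..T}" "x \<in> closed_segment (p t) (q t)" for t x
    using pR[OF that(1)] that by (auto simp: closed_segment_eq_real_ivl abs_le_iff split: if_splits)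
  have near: "\<bar>v t x - v t y\<bar> < \<epsilon>" "\<bar>\<rho> t x - \<rho> t y\<bar> < \<epsilon>"
    if t: "t \<in> {0..T}" and xy: "x \<in> closed_segment (p t) (q t)" "y \<in> closed_segment (p t) (q t)" for t x y
  proof -
    have "dist (t, x) (t, y) < \<delta>"
      using closed_segment_dist[OF xy] gu[OF t] by (simp add: dist_Pair_Pair dist_real_def g_def)
    then show "\<bar>v t x - v t y\<bar> < \<epsilon>" "\<bar>\<rho> t x - \<rho> t y\<bar> < \<epsilon>"
      using d1(2)[OF seg[OF t xy(2)] seg[OF t xy(1)]] d2(2)[OF seg[OF t xy(2)] seg[OF t xy(1)]]
      by (auto simp: \<delta>_def dist_real_def)
  qed
  have sub: "continuous_on ({0..T} \<times> UNIV) h" if "continuous_on ({0..} \<times> UNIV) h" for h :: "real \<times> real \<Rightarrow> real"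
    by (rule continuous_on_subset[OF that]) auto
  have u_along: "((\<lambda>t. u t (f t)) has_real_derivative w\<^sub>x t (f t)) (at t within {0..T})"
    and S_along: "((\<lambda>t. S t (f t)) has_real_derivative - Re (fhat (\<lambda>x. U t x * \<rho> t x) 0)) (at t within {0..T})"
    if f: "(f has_real_derivative - U t (f t)) (at t within {0..T})" and t: "t \<in> {0..T}" for f t
  proof -
    have t0: "0 \<le> t" using t by simp
    have "((\<lambda>t. u t (f t)) has_real_derivative u\<^sub>t t (f t) + v t (f t) * - U t (f t)) (at t within {0..T})"
      by (rule has_derivative_along_curve[OF DERIV_subset[OF u_t[OF t0]] u_x sub[OF joint_cont(2)] f t]) auto
    then show "((\<lambda>t. u t (f t)) has_real_derivative w\<^sub>x t (f t)) (at t within {0..T})"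
      by (simp add: u_t_eq[OF t0] mult.commute)
    have "((\<lambda>t. S t (f t)) has_real_derivative (U t (f t) * \<rho> t (f t) - Re (fhat (\<lambda>x. U t x * \<rho> t x) 0)) + \<rho> t (f t) * - U t (f t)) (at t within {0..T})"
      by (rule has_derivative_along_curve[OF DERIV_subset[OF S_t[OF t0]] S_x sub[OF joint_cont(3)] f t]) auto
    then show "((\<lambda>t. S t (f t)) has_real_derivative - Re (fhat (\<lambda>x. U t x * \<rho> t x) 0)) (at t within {0..T})"
      by (simp add: mult.commute)
  qed
  have S_const: "S t (q t) - S t (p t) = S 0 (q 0) - S 0 (p 0)" if t: "t \<in> {0..T}" for t
  proof -
    have "\<exists>k. \<forall>t\<in>{0..T}. S t (q t) - S t (p t) = k"
    proof (rule has_field_derivative_zero_constant)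
      fix t assume t: "t \<in> {0..T}"
      show "((\<lambda>t. S t (q t) - S t (p t)) has_real_derivative 0) (at t within {0..T})"
        using DERIV_diff[OF S_along[OF q(2)[OF t] t] S_along[OF p(2)[OF t] t]] by simp
    qed simp
    then show ?thesis using t T by force
  qed
  \<comment> \<open>At time \<open>t\<close> as at time 0, the conserved difference of
    \<open>S\<close> is the gap times \<rho> at an intermediate point. The lower bound on the gap
    carries the smallness over, and uniform continuity spreads it to the whole segment.\<close>
  have rho_small: "(\<rho> t x)\<^sup>2 \<le> c / 2" if t: "t \<in> {0..T}" and x: "x \<in> closed_segment (p t) (q t)" for t x
  proof -
    obtain \<zeta> where \<zeta>: "\<zeta> \<in> closed_segment (p t) (q t)" "S t (q t) - S t (p t) = g t * \<rho> t \<zeta>"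
      using mean_value_between[OF S_x, of t "p t" "q t"] t unfolding g_def by auto
    obtain \<zeta>0 where \<zeta>0: "\<zeta>0 \<in> closed_segment (p 0) (q 0)" "S 0 (q 0) - S 0 (p 0) = g 0 * \<rho> 0 \<zeta>0"
      using mean_value_between[OF S_x, of 0 "p 0" "q 0"] unfolding g_def by auto
    have g00: "g 0 = g0" using p q by (simp add: g_def)
    have "dist \<zeta>0 x0 < d3"
      using closed_segment_dist[OF \<zeta>0(1) ends_in_segment(1)] p q g0 by (simp add: dist_real_def)
    from d3(2)[OF this] have z0: "\<bar>\<rho> 0 \<zeta>0\<bar> \<le> r / 2 * exp (- (L * T))" using zero by (simp add: dist_real_def)
    have "\<bar>g t\<bar> * \<bar>\<rho> t \<zeta>\<bar> = g0 * \<bar>\<rho> 0 \<zeta>0\<bar>"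
      using \<zeta>(2) \<zeta>0(2) S_const[OF t] g0 by (metis abs_mult abs_of_pos g00)
    also have "\<dots> \<le> g0 * (r / 2 * exp (- (L * T)))" using z0 g0 by (intro mult_left_mono) auto
    also have "\<dots> \<le> \<bar>g t\<bar> * (r / 2)" using mult_right_mono[OF gl[OF t], of "r / 2"] r by (simp add: mult_ac)
    finally have "\<bar>\<rho> t \<zeta>\<bar> \<le> r / 2" using gnz[OF t] by simp
    moreover have "\<bar>\<rho> t x - \<rho> t \<zeta>\<bar> < r / 2" using near(2)[OF t x \<zeta>(1)] by (simp add: \<epsilon>_def)
    ultimately have "\<bar>\<rho> t x\<bar> \<le> \<bar>r\<bar>" using r by linarith
    then show ?thesis unfolding abs_le_square_iff using c by (simp add: r_def)
  qed
  \<comment> \<open>\<open>D\<close> stands in for \<open>u\<^sub>x\<close> along a characteristic, which need not have a classical time derivative.\<close>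
  define D where "D = (\<lambda>t. N t / g t)"
  \<comment> \<open>The square is the quotient rule's contribution from g' = - N.\<close>
  define D' where "D' = (\<lambda>t. (w\<^sub>x t (q t) - w\<^sub>x t (p t)) / g t + (D t)\<^sup>2)"
  have D': "(D has_real_derivative D' t) (at t within {0..T})" if t: "t \<in> {0..T}" for t
  proof -
    have "(N has_real_derivative w\<^sub>x t (q t) - w\<^sub>x t (p t)) (at t within {0..T})"
      unfolding N_def by (intro DERIV_diff u_along p q t)
    from DERIV_divide[OF this g'[OF t] gnz[OF t]] show ?thesis
      unfolding D_def by (rule DERIV_cong) (use gnz[OF t] in \<open>simp add: D'_def D_def field_simps power2_eq_square\<close>)
  qed
  have riccati: "(c + (D t)\<^sup>2) / 2 \<le> D' t" if t: "t \<in> {0..T}" for t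
  proof -
    have t0: "0 \<le> t" using t by simp
    obtain \<xi> where \<xi>: "\<xi> \<in> closed_segment (p t) (q t)" "w\<^sub>x t (q t) - w\<^sub>x t (p t) = g t * (circle_mean (src t) - src t \<xi>)"
      using mean_value_between[OF w_x(1)[OF t0], of "p t" "q t"] unfolding g_def by auto
    obtain \<eta> where \<eta>: "\<eta> \<in> closed_segment (p t) (q t)" "N t = g t * v t \<eta>"
      using mean_value_between[OF u_x[OF t0], of "p t" "q t"] unfolding g_def N_def by auto
    have D: "D t = v t \<eta>" using \<eta>(2) gnz[OF t] by (simp add: D_def)
    have "(v t \<xi>)\<^sup>2 - (v t \<eta>)\<^sup>2 = (v t \<xi> - v t \<eta>) * (v t \<xi> + v t \<eta>)" by (simp add: power2_eq_square algebra_simps)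
    also have "\<dots> \<le> \<bar>v t \<xi> - v t \<eta>\<bar> * \<bar>v t \<xi> + v t \<eta>\<bar>" by (simp add: abs_mult[symmetric])
    also have "\<dots> \<le> (c / (4 * (L + 1))) * (2 * (L + 1))"
      using near(1)[OF t \<xi>(1) \<eta>(1)] L(2)[OF t, of \<xi>] L(2)[OF t, of \<eta>] L(1) c
      by (intro mult_mono) (auto simp: \<epsilon>_def)
    also have "\<dots> = c / 2" using L(1) by (simp add: field_simps)
    finally have vv: "(v t \<xi>)\<^sup>2 - (v t \<eta>)\<^sup>2 \<le> c / 2" .
    have src: "circle_mean (src t) - src t \<xi> = (a - 2 * \<mu> * u t \<xi>) - 1/2 * (v t \<xi>)\<^sup>2 - 1/2 * (\<rho> t \<xi>)\<^sup>2"
      unfolding src_mean[OF t0] src_def mean_const[OF t0] a_def \<mu>_def by simp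
    have D't: "D' t = circle_mean (src t) - src t \<xi> + (v t \<eta>)\<^sup>2"
      unfolding D'_def \<xi>(2) D using gnz[OF t] by simp
    \<comment> \<open>The \<rho> term and the change of evaluation point each cost c/4; half of v^2
      at \<eta> survives.\<close>
    have "(c + e) / 2 \<le> A - 1/2 * x - 1/2 * y + e" if "c \<le> A" "y \<le> c / 2" "x - e \<le> c / 2" for A x y e :: real
      using that by (simp add: field_simps)
    from this[OF ac[OF t0, of \<xi>] rho_small[OF t \<xi>(1)] vv] show ?thesis
      unfolding D't src D .
  qed
  have sc: "sqrt c > 0" using c by simp
  \<comment> \<open>The Riccati inequality gives arctan (D / sqrt c) a rate of at least sqrt c / 2,
    hence an increase of at least pi over [0,T], although its values lie strictly between -pi/2 and
    pi/2.\<close>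
  have "arctan (D 0 / sqrt c) + sqrt c / 2 * T \<le> arctan (D T / sqrt c)"
  proof (rule derivative_ge_imp_growth[where f' = "\<lambda>t. D' t / sqrt c / (1 + (D t / sqrt c)\<^sup>2)" and f = "\<lambda>t. arctan (D t / sqrt c)"])
    fix t assume t: "t \<in> {0..T}"
    show "((\<lambda>t. arctan (D t / sqrt c)) has_real_derivative D' t / sqrt c / (1 + (D t / sqrt c)\<^sup>2)) (at t within {0..T})"
      by (rule DERIV_cong[OF DERIV_arctan[THEN DERIV_chain2, OF DERIV_cdivide[OF D'[OF t]]]]) (simp add: field_simps)
    have pos: "1 + (D t / sqrt c)\<^sup>2 > 0" by (simp add: add_pos_nonneg)
    have eq: "1 + (D t / sqrt c)\<^sup>2 = (c + (D t)\<^sup>2) / (sqrt c * sqrt c)" using c by (simp add: power_divide field_simps)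
    have "sqrt c / 2 * (1 + (D t / sqrt c)\<^sup>2) = (c + (D t)\<^sup>2) / 2 / sqrt c"
    proof -
      have "k / 2 * (X / (k * k)) = X / 2 / k" if "k > 0" for k X :: real using that by (simp add: field_simps)
      from this[OF sc] show ?thesis unfolding eq .
    qed
    also have "\<dots> \<le> D' t / sqrt c" using riccati[OF t] sc by (intro divide_right_mono) auto
    finally show "sqrt c / 2 \<le> D' t / sqrt c / (1 + (D t / sqrt c)\<^sup>2)"
      unfolding pos_le_divide_eq[OF pos] .
  qed (use T in auto)
  moreover have "sqrt c / 2 * T = pi" using sc by (simp add: T_def)
  ultimately show False
    using arctan_ubound[of "D T / sqrt c"] arctan_lbound[of "D 0 / sqrt c"] by linarith
qed

end

section \<open>Reduction of the stated hypotheses to the global setting\<close>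

theorem theorem4p2:
  fixes \<gamma>\<^sub>1 \<gamma>\<^sub>2 s \<mu>\<^sub>0 \<mu>\<^sub>1 a :: real
    and u\<^sub>0 \<rho>\<^sub>0 :: "real \<Rightarrow> real"
    and T :: ereal
    and u \<rho> :: "real \<Rightarrow> real \<Rightarrow> real"
  assumes "2 \<le> s"
    and "u\<^sub>0 \<in> sobolev s"
    and "\<rho>\<^sub>0 \<in> sobolev (s - 1)"
    and "mu_HS_maximal_solution \<gamma>\<^sub>1 \<gamma>\<^sub>2 s u\<^sub>0 \<rho>\<^sub>0 T u \<rho>"
    and "\<mu>\<^sub>0 = (LBINT x:{0..1}. u\<^sub>0 x)"
    and "\<mu>\<^sub>1 = sqrt (LBINT x:{0..1}. (deriv u\<^sub>0 x)\<^sup>2 + (\<rho>\<^sub>0 x)\<^sup>2)"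
    and "a = 2 * \<mu>\<^sub>0\<^sup>2 + 1/2 * (LBINT x:{0..1}. (deriv u\<^sub>0 x)\<^sup>2 + (\<rho>\<^sub>0 x)\<^sup>2)"
    and "\<gamma>\<^sub>1 = 2 * \<gamma>\<^sub>2"
    and "\<mu>\<^sub>0 \<noteq> 0"
    and "\<bar>\<mu>\<^sub>0\<bar> + sqrt 3 / 6 * \<mu>\<^sub>1 < a / (2 * \<bar>\<mu>\<^sub>0\<bar>)"
    and "\<exists>x\<^sub>0. \<rho>\<^sub>0 (- x\<^sub>0) = 0"
  shows "T < \<infinity>"
proof (rule ccontr)
  assume "\<not> T < \<infinity>"
  then have T: "T = \<infinity>" by simp
  have sol: "mu_HS_solution \<gamma>\<^sub>1 \<gamma>\<^sub>2 s u\<^sub>0 \<rho>\<^sub>0 \<infinity> u \<rho>"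
    using assms(4) unfolding mu_HS_maximal_solution_def T by blast
  then obtain u\<^sub>t \<rho>\<^sub>t where init: "u 0 = u\<^sub>0" "\<rho> 0 = \<rho>\<^sub>0"
    and C0: "C0_sobolev s \<infinity> u" "C0_sobolev (s - 1) \<infinity> \<rho>"
    and C1: "C1_sobolev (s - 1) \<infinity> u u\<^sub>t" "C1_sobolev (s - 2) \<infinity> \<rho> \<rho>\<^sub>t"
    and eqs: "\<forall>t\<in>time_interval \<infinity>.
           (\<forall>x. u\<^sub>t t x - (u t x + \<gamma>\<^sub>1) * deriv (u t) x =
              deriv (mu_dxx_inv (\<lambda>y. 2 * circle_mean (u t) * u t y
                + 1/2 * (deriv (u t) y)\<^sup>2 + 1/2 * (\<rho> t y)\<^sup>2)) x) \<and>
           (\<exists>\<rho>\<^sub>x. has_weak_deriv (\<rho> t) \<rho>\<^sub>x \<and>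
              (AE x in lborel. \<rho>\<^sub>t t x - (u t x + 2 * \<gamma>\<^sub>2) * \<rho>\<^sub>x x = deriv (u t) x * \<rho> t x))"
    unfolding mu_HS_solution_def by blast
  interpret global_mu_HS \<gamma>\<^sub>1 u \<rho> u\<^sub>t \<rho>\<^sub>t
  proof
    show "C0_sobolev 2 \<infinity> u" "C0_sobolev 1 \<infinity> \<rho>" "C1_sobolev 1 \<infinity> u u\<^sub>t" "C1_sobolev 0 \<infinity> \<rho> \<rho>\<^sub>t"
      using C0_sobolev_mono[OF C0(1)] C0_sobolev_mono[OF C0(2)] C1_sobolev_mono[OF C1(1)] C1_sobolev_mono[OF C1(2)] assms(1)
      by auto
  qed (use eqs assms(8) in \<open>auto simp: time_interval_def\<close>)
  have mean: "circle_mean (u 0) = \<mu>\<^sub>0" by (simp add: circle_mean_def init assms(5))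
  have energy: "energy 0 = (LBINT x:{0..1}. (deriv u\<^sub>0 x)\<^sup>2 + (\<rho>\<^sub>0 x)\<^sup>2)"
    by (simp add: energy_def v_def init)
  obtain x\<^sub>0 where "\<rho> 0 (- x\<^sub>0) = 0" using assms(11) init by auto
  \<comment> \<open>The smallness hypothesis is multiplied by the positive number
    \<open>2 * \<bar>\<mu>\<^sub>0\<bar>\<close>.\<close>
  moreover have "2 * \<bar>\<mu>\<^sub>0\<bar> * (\<bar>\<mu>\<^sub>0\<bar> + sqrt 3 / 6 * sqrt (energy 0)) < 2 * \<mu>\<^sub>0\<^sup>2 + 1/2 * energy 0"
    using assms(10) unfolding assms(6) assms(7) energy[symmetric] using assms(9)
    by (simp add: pos_less_divide_eq mult.commute)
  ultimately show False using finite_time_blow_up mean by simp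
qed

end
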